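(* Let $R=\bigoplus_{n\ge 0}R_n$ be a $d$-dimensional Noetherian graded commutative ring, $d\ge 1$, with $R_0$ a field of characteristic $p>0$. Let $\mathfrak a$ be an ideal generated by a full homogeneous system of parameters of degrees $a_1\le\dots\le a_d$ for $R$, and let $J$ be an ideal generated by a full homogeneous system of parameters of degrees $b_1\le\dots\le b_d$ for $R$. Then $$e(\mathfrak a)\ \ge\ \left(\frac{d}{c_-^J(\mathfrak a)}\right)^d e(J).$$ Moreover, if equality holds in this inequality, then $(a_1,\dots,a_d)$ and $(b_1,\dots,b_d)$ are proportional, that is, $a_1/b_1=\dots=a_d/b_d$.
   Context: Let $\mathfrak m=\bigoplus_{n\ge1}R_n$. A full homogeneous system of parameters for $R$ is a sequence of $d=\dim R$ homogeneous elements of $\mathfrak m$ generating an $\mathfrak m$-primary ideal. For an $\mathfrak m$-primary ideal $K$, $e(K)=\lim_{n\to\infty} d!\,\ell_R(R/K^n)/n^d$ denotes its (Hilbert–Samuel) multiplicity. Throughout, $q=p^e$ denotes a power of $p$ ($e\ge 0$), and for an ideal $I$, $I^{[q]}$ is the ideal generated by all $x^q$ with $x\in I$. Let $\mathfrak a$ be a proper ideal containing an element that lies in no minimal prime of $R$, and let $J$ be an ideal with $\mathfrak a\subseteq\sqrt J$. Put $\nu^J_{\mathfrak a}(q)=\max\{r\in\mathbb N\mid \mathfrak a^r\not\subseteq J^{[q]}\}$ (with $\nu^J_{\mathfrak a}(q)=0$ if $\mathfrak a\subseteq J^{[q]}$), and $$c_-^J(\mathfrak a)=\liminf_{q\to\infty}\frac{\nu^J_{\mathfrak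 a}(q)}{q}.$$ *)

theory Defs
  imports "HOL-Algebra.Algebra" "HOL-Library.Extended_Real"
begin

section \<open>Graded rings\<close>

locale graded_cring = cring R for R (structure) +
  fixes G :: "nat \<Rightarrow> 'a set"
  assumes component_subgroup: "additive_subgroup (G n) R"
    and component_mult: "\<lbrakk>x \<in> G m; y \<in> G n\<rbrakk> \<Longrightarrow> x \<otimes> y \<in> G (m + n)"
    and direct_sum: "x \<in> carrier R \<Longrightarrow>
      \<exists>!f. (\<forall>n. f n \<in> G n) \<and> finite {n. f n \<noteq> \<zero>} \<and> x = (\<Oplus>n\<in>{n. f n \<noteq> \<zero>}. f n)"

definition irrelevant_ideal :: "('a, 'b) ring_scheme \<Rightarrow> (nat \<Rightarrow> 'a set) \<Rightarrow> 'a set" where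
  "irrelevant_ideal R G = {\<Oplus>\<^bsub>R\<^esub>n\<in>A. f n | f A. finite A \<and> 0 \<notin> A \<and> (\<forall>n\<in>A. f n \<in> G n)}"

text \<open>The characteristic of a subring \<open>K\<close> is obtained from \<^term>\<open>R\<lparr>carrier := K\<rparr>\<close>.\<close>

definition ring_characteristic :: "('a, 'b) ring_scheme \<Rightarrow> nat" where
  "ring_characteristic R =
    (if \<exists>n>0. add_pow R (n::nat) \<one>\<^bsub>R\<^esub> = \<zero>\<^bsub>R\<^esub>
     then LEAST n. n > 0 \<and> add_pow R n \<one>\<^bsub>R\<^esub> = \<zero>\<^bsub>R\<^esub> else 0)"


section \<open>Krull dimension, primary ideals, systems of parameters\<close>

definition krull_dim :: "('a, 'b) ring_scheme \<Rightarrow> enat" where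
  "krull_dim R = Sup {enat n | n. \<exists>P :: nat \<Rightarrow> 'a set.
     (\<forall>i\<le>n. primeideal (P i) R) \<and> (\<forall>i<n. P i \<subset> P (Suc i))}"

definition radical :: "('a, 'b) ring_scheme \<Rightarrow> 'a set \<Rightarrow> 'a set" where
  "radical R I = {x \<in> carrier R. \<exists>n::nat. x [^]\<^bsub>R\<^esub> n \<in> I}"

definition primary_ideal :: "('a, 'b) ring_scheme \<Rightarrow> 'a set \<Rightarrow> bool" where
  "primary_ideal R Q \<longleftrightarrow> ideal Q R \<and> Q \<noteq> carrier R \<and>
     (\<forall>x\<in>carrier R. \<forall>y\<in>carrier R. x \<otimes>\<^bsub>R\<^esub> y \<in> Q \<longrightarrow> x \<in> Q \<or> y \<in> radical R Q)"

text \<open>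
  The elements are \<open>x 1, \<dots>, x d\<close>, where \<open>d\<close> is the dimension of \<open>R\<close>, and \<open>a i\<close> is the degree
  of \<open>x i\<close>.  No \<open>x i\<close> has to be required to be nonzero: by Krull's height theorem, fewer
  than \<open>d\<close> elements cannot generate a primary ideal of the irrelevant ideal, so zero does not occur
  and the degrees are well defined.
\<close>

definition full_hsop ::
  "('a, 'b) ring_scheme \<Rightarrow> (nat \<Rightarrow> 'a set) \<Rightarrow> nat \<Rightarrow> (nat \<Rightarrow> 'a) \<Rightarrow> (nat \<Rightarrow> nat) \<Rightarrow> bool" where
  "full_hsop R G d x a \<longleftrightarrow> krull_dim R = enat d \<and>
     (\<forall>i\<in>{1..d}. x i \<in> G (a i) \<and> x i \<in> irrelevant_ideal R G) \<and>
     primary_ideal R (Idl\<^bsub>R\<^esub> (x ` {1..d})) \<and>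
     radical R (Idl\<^bsub>R\<^esub> (x ` {1..d})) = irrelevant_ideal R G"


section \<open>Length and multiplicity\<close>

definition module_length :: "('a, 'b) ring_scheme \<Rightarrow> ('a, 'c, 'm) module_scheme \<Rightarrow> enat" where
  "module_length R M = Sup {enat n | n. \<exists>N :: nat \<Rightarrow> 'c set.
     (\<forall>i\<le>n. submodule (N i) R M) \<and> (\<forall>i<n. N i \<subset> N (Suc i))}"

text \<open>The quotient ring \<open>R Quot I\<close> regarded as an \<open>R\<close>-module.\<close>

definition quot_module :: "('a, 'b) ring_scheme \<Rightarrow> 'a set \<Rightarrow> ('a, 'a set) module" where
  "quot_module R I =
    \<lparr>carrier = carrier (R Quot I), monoid.mult = monoid.mult (R Quot I), monoid.one = \<one>\<^bsub>R Quot I\<^esub>,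
     ring.zero = \<zero>\<^bsub>R Quot I\<^esub>, ring.add = ring.add (R Quot I),
     module.smult = (\<lambda>r C. (I +>\<^bsub>R\<^esub> r) \<otimes>\<^bsub>R Quot I\<^esub> C)\<rparr>"

lemma (in cring) module_quot_module:
  assumes "ideal I R"
  shows "module R (quot_module R I)"
proof -
  interpret I: ideal I R by fact
  interpret Q: cring "R Quot I"
    by (rule I.quotient_is_cring) (rule is_cring)
  interpret h: ring_hom_ring R "R Quot I" "(+>) I"
    by (rule I.rcos_ring_hom_ring)
  have ag: "abelian_group (quot_module R I)"
  proof (rule abelian_groupI)
    fix x assume "x \<in> carrier (quot_module R I)"
    then show "\<exists>y\<in>carrier (quot_module R I). y \<oplus>\<^bsub>quot_module R I\<^esub> x = \<zero>\<^bsub>quot_module R I\<^esub>"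
      using Q.l_neg[of x] Q.a_inv_closed[of x] by (auto simp: quot_module_def)
  qed (simp_all add: quot_module_def Q.add.m_ac)
  show ?thesis
  proof (rule moduleI)
  qed (use ag is_cring in \<open>simp_all add: quot_module_def Q.l_distr Q.r_distr Q.m_assoc\<close>)
qed

abbreviation ideal_power :: "('a, 'b) ring_scheme \<Rightarrow> 'a set \<Rightarrow> nat \<Rightarrow> 'a set" where
  "ideal_power R I n \<equiv> I [^]\<^bsub>ideals_set R\<^esub> n"

text \<open>To be used with \<open>d\<close> the Krull dimension of \<open>R\<close>.\<close>

definition hs_multiplicity :: "('a, 'b) ring_scheme \<Rightarrow> nat \<Rightarrow> 'a set \<Rightarrow> ereal" where
  "hs_multiplicity R d K =
    lim (\<lambda>n::nat. ereal (fact d) * ereal_of_enat (module_length R (quot_module R (ideal_power R K n)))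
                  / ereal (real n ^ d))"


section \<open>F-thresholds\<close>

definition frobenius_power :: "('a, 'b) ring_scheme \<Rightarrow> 'a set \<Rightarrow> nat \<Rightarrow> 'a set" where
  "frobenius_power R I q = Idl\<^bsub>R\<^esub> ((\<lambda>x. x [^]\<^bsub>R\<^esub> q) ` I)"

definition f_nu :: "('a, 'b) ring_scheme \<Rightarrow> 'a set \<Rightarrow> 'a set \<Rightarrow> nat \<Rightarrow> nat" where
  "f_nu R J I q = (if I \<subseteq> frobenius_power R J q then 0
     else Max {r. \<not> ideal_power R I r \<subseteq> frobenius_power R J q})"

text \<open>The lower limit is over \<open>q = p ^ e\<close> as the exponent \<open>e\<close> tends to infinity.\<close>

definition f_threshold_lower :: "('a, 'b) ring_scheme \<Rightarrow> nat \<Rightarrow> 'a set \<Rightarrow> 'a set \<Rightarrow> ereal" where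
  "f_threshold_lower R p J I =
    liminf (\<lambda>e::nat. ereal (real (f_nu R J I (p ^ e)) / real (p ^ e)))"

end

theory Submission
  imports Defs "HOL-Library.Function_Algebras" "HOL-Library.Infinite_Set" "HOL-Real_Asymp.Real_Asymp"
begin

text \<open>
  Let \<open>c\<close> be the lower F-threshold of \<open>I\<close> with respect to \<open>J\<close>.  Three facts are combined.

  First, \<open>R\<close> has a rank \<open>\<rho>\<close> over the polynomial ring generated by a homogeneous system of parameters.
  Comparing \<open>R\<close> with a free submodule of that rank shows that the multiplicity of the ideal of
  parameters is \<open>\<rho>\<close> and that the dimension of the part of \<open>R\<close> in degrees below \<open>n\<close> is asymptotically
  \<open>\<rho>\<close> times the volume of a simplex.  Hence the multiplicity divided by the product of the degrees
  is the same for \<open>I\<close> and \<open>J\<close>.  The rank is positive because a chain of \<open>d\<close> proper inclusions of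
  primes forces the dimension to grow like \<open>n ^ d\<close>.

  Second, \<open>c\<close> is at least the sum of all \<open>b i / a i\<close>.  Let \<open>f \<noteq> 0\<close> multiply \<open>R\<close> into a free module
  over the polynomials in the \<open>y i\<close>.  Instead of the Frobenius power \<open>(y 1 ^ q, \<dots>, y d ^ q) R\<close> use the
  larger ideal of all \<open>w\<close> such that each monomial in \<open>f R w\<close> is divisible by some \<open>y i ^ q\<close>; this replaces
  regularity of the sequence by statements on monomials.  Take a monomial \<open>x 1 ^ u 1 \<dots> x d ^ u d\<close>
  outside this ideal greedily.  Its truncation to \<open>x 1, \<dots>, x j\<close> is
  multiplied into the ideal by \<open>x 1, \<dots>, x j\<close>, and \<open>R / (x 1, \<dots>, x j)\<close> has growth of order \<open>d - j\<close>, so any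
  \<open>d - j + 1\<close> of the \<open>y i\<close> satisfy an algebraic relation modulo \<open>(x 1, \<dots>, x j)\<close>.  Comparing leading
  monomials, at least \<open>j\<close> of the exponents of some monomial in the \<open>y i\<close>, of about the same degree as the
  truncation, are close to \<open>q\<close>.  So \<open>a 1 u 1 + \<dots> + a j u j\<close> is at least
  \<open>q (b 1 + \<dots> + b j)\<close> up to a bounded error, for each \<open>j\<close>, and summation by parts gives the bound
  on \<open>u 1 + \<dots> + u d\<close>.

  Third, the inequality between the arithmetic and the geometric mean of the \<open>b i / a i\<close>, with its
  case of equality, gives the claim.
\<close>

text \<open>The parameters need not form a regular sequence, so whether a monomial lies in a
  Frobenius power cannot be read off its exponents. Multiplication by \<open>f\<close> moves the
  question into a free module with a monomial basis, where it can. The price is the fixed leading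
  exponent of \<open>f\<close>, a bounded shift that disappears in every limit. The characteristic
  enters through the additivity of q-th powers: J^[q] is generated by the y_i^q, all of which lie in
  the larger ideal. What escapes the larger ideal escapes J^[q], the direction that a lower bound
  requires. The relations modulo (x_1, ..., x_j) are chosen before q, one for each j and each set of
  variables, so the errors do not depend on q and vanish after division by q. Both orderings of the
  degrees matter: b increasing makes b_1 + ... + b_j the least sum of j of the b_i, and a increasing
  makes the weights 1/a_i decrease, as summation by parts requires. Lengths become dimensions over
  R_0: the quotients in question vanish in high degrees and have one-dimensional composition
  factors.\<close>

context cring
begin

lemma idealI_cring:
  assumes V: "V \<subseteq> carrier R" "\<zero> \<in> V" and add: "\<And>x y. \<lbrakk>x \<in> V; y \<in> V\<rbrakk> \<Longrightarrow> x \<oplus> y \<in> V"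
    and mult: "\<And>r x. \<lbrakk>r \<in> carrier R; x \<in> V\<rbrakk> \<Longrightarrow> r \<otimes> x \<in> V"
  shows "ideal V R"
proof (rule idealI)
  show "ring R" by (rule ring_axioms)
  show "subgroup V (add_monoid R)"
  proof (rule add.subgroupI)
    show "V \<subseteq> carrier R" "V \<noteq> {}" using V by auto
    fix x assume x: "x \<in> V"
    have "\<ominus> \<one> \<otimes> x \<in> V" by (rule mult[OF _ x]) simp
    then show "\<ominus> x \<in> V" using x V(1) by (auto simp: l_minus)
    fix y assume "y \<in> V"
    then show "x \<oplus> y \<in> V" by (rule add[OF x])
  qed
  fix x r assume xr: "x \<in> V" "r \<in> carrier R"
  show "r \<otimes> x \<in> V" by (rule mult[OF xr(2,1)])
  then show "x \<otimes> r \<in> V" using xr V(1) m_comm[of x r] by auto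
qed

lemma ideal_colon:
  assumes I: "ideal I R" and w: "w \<in> carrier R"
  shows "ideal {x \<in> carrier R. x \<otimes> w \<in> I} R"
proof -
  interpret I: ideal I R by fact
  show ?thesis
    by (rule idealI_cring) (use w I.zero_closed I.a_closed I.I_l_closed in \<open>auto simp: l_distr m_assoc\<close>)
qed

end

section \<open>Linear algebra modulo a subset\<close>

locale subfield_algebra = cring R for R (structure) +
  fixes K :: "'a set"
  assumes K: "subfield K R"
begin

text \<open>Linear combinations as an inductive closure, without coefficient families: a span is
  bounded by any set that contains the generators and is closed under the operations, and facts
  about its elements follow by rule induction.\<close>

inductive_set span :: "'a set \<Rightarrow> 'a set" for E where
  span_zero: "\<zero> \<in> span E"
| span_base: "x \<in> E \<Longrightarrow> x \<in> span E"
| span_add: "\<lbrakk>x \<in> span E; y \<in> span E\<rbrakk> \<Longrightarrow> x \<oplus> y \<in> span E"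
| span_smult: "\<lbrakk>c \<in> K; x \<in> span E\<rbrakk> \<Longrightarrow> c \<otimes> x \<in> span E"

lemma K_carrier: "K \<subseteq> carrier R"
  using subfieldE(3)[OF K] .

lemma K_carr [simp]: "c \<in> K \<Longrightarrow> c \<in> carrier R"
  using K_carrier by blast

lemma K_one [simp]: "\<one> \<in> K" and K_zero [simp]: "\<zero> \<in> K"
  and K_neg: "c \<in> K \<Longrightarrow> \<ominus> c \<in> K"
  and K_mult: "c \<in> K \<Longrightarrow> c' \<in> K \<Longrightarrow> c \<otimes> c' \<in> K"
  using subringE(2,3,5,6)[OF subfieldE(1)[OF K]] by auto

lemma K_inv:
  assumes "c \<in> K" "c \<noteq> \<zero>"
  obtains c' where "c' \<in> K" "c' \<otimes> c = \<one>" "c' \<noteq> \<zero>"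
proof -
  have "inv c \<in> K - {\<zero>}" "inv c \<otimes> c = \<one>"
    using subfield_m_inv[OF K, of c] assms by auto
  then show ?thesis using that by auto
qed

lemma one_not_zero: "\<one> \<noteq> \<zero>"
  using subfieldE(6)[OF K] by simp

lemma span_closed: assumes "E \<subseteq> carrier R" shows "span E \<subseteq> carrier R"
proof
  fix x assume "x \<in> span E"
  then show "x \<in> carrier R" by induction (use assms in auto)
qed

lemma span_carr: "x \<in> span E \<Longrightarrow> E \<subseteq> carrier R \<Longrightarrow> x \<in> carrier R"
  using span_closed by blast

lemma span_subsetI:
  assumes "E \<subseteq> V" and "\<zero> \<in> V" and "\<And>x y. x \<in> V \<Longrightarrow> y \<in> V \<Longrightarrow> x \<oplus> y \<in> V"
    and "\<And>c x. c \<in> K \<Longrightarrow> x \<in> V \<Longrightarrow> c \<otimes> x \<in> V"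
  shows "span E \<subseteq> V"
proof
  fix x assume "x \<in> span E"
  then show "x \<in> V" by induction (use assms in auto)
qed

lemma span_least: assumes "E \<subseteq> span Y" shows "span E \<subseteq> span Y"
  by (rule span_subsetI[OF assms]) (auto intro: span.intros)

lemma span_mono: "E \<subseteq> Y \<Longrightarrow> span E \<subseteq> span Y"
  by (rule span_least) (auto intro: span.intros)

lemma span_superset: "E \<subseteq> span E"
  by (auto intro: span.intros)

lemma span_neg: assumes "x \<in> span E" "E \<subseteq> carrier R" shows "\<ominus> x \<in> span E"
proof -
  have "\<ominus> \<one> \<otimes> x \<in> span E" by (rule span_smult[OF K_neg]) (use assms in auto)
  then show ?thesis using span_carr[OF assms] by (simp add: l_minus)
qed

lemma span_minus: "\<lbrakk>x \<in> span E; y \<in> span E; E \<subseteq> carrier R\<rbrakk> \<Longrightarrow> x \<ominus> y \<in> span E"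
  unfolding a_minus_def by (intro span_add span_neg)

lemma ideal_span: assumes "ideal I R" shows "span I = I"
proof
  interpret ideal I R by fact
  show "span I \<subseteq> I"
    by (rule span_subsetI) (auto intro: I_l_closed)
qed (rule span_superset)

lemma span_UnE:
  assumes "w \<in> span (E \<union> Y)" "E \<subseteq> carrier R" "Y \<subseteq> carrier R"
  obtains x y where "x \<in> span E" "y \<in> span Y" "w = x \<oplus> y"
proof -
  have "span (E \<union> Y) \<subseteq> {x \<oplus> y | x y. x \<in> span E \<and> y \<in> span Y}" (is "_ \<subseteq> ?V")
  proof (rule span_subsetI)
    show "E \<union> Y \<subseteq> ?V"
    proof
      fix z assume "z \<in> E \<union> Y"
      then consider "z \<in> E" | "z \<in> Y" by blast
      then show "z \<in> ?V"
      proof cases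
        case 1
        then have "z = z \<oplus> \<zero>" "z \<in> span E" using assms by (auto intro: span.intros)
        then show ?thesis using span_zero[of Y] by blast
      next
        case 2
        then have "z = \<zero> \<oplus> z" "z \<in> span Y" using assms by (auto intro: span.intros)
        then show ?thesis using span_zero[of E] by blast
      qed
    qed
    have "\<zero> = \<zero> \<oplus> \<zero>" by simp
    then show "\<zero> \<in> ?V" using span_zero by blast
  next
    fix u v assume "u \<in> ?V" "v \<in> ?V"
    then obtain x y x' y' where *: "x \<in> span E" "y \<in> span Y" "u = x \<oplus> y"
      "x' \<in> span E" "y' \<in> span Y" "v = x' \<oplus> y'" by blast
    then have "u \<oplus> v = (x \<oplus> x') \<oplus> (y \<oplus> y')"
      using span_carr assms by (simp add: add.m_ac)
    then show "u \<oplus> v \<in> ?V" using * span_add by blast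
  next
    fix c u assume c: "c \<in> K" and "u \<in> ?V"
    then obtain x y where *: "x \<in> span E" "y \<in> span Y" "u = x \<oplus> y" by blast
    then have "c \<otimes> u = c \<otimes> x \<oplus> c \<otimes> y"
      using span_carr assms c by (simp add: r_distr)
    then show "c \<otimes> u \<in> ?V" using * c span_smult by blast
  qed
  then show ?thesis using assms that by blast
qed

lemma span_singletonE:
  assumes "w \<in> span {v}" "v \<in> carrier R"
  obtains c where "c \<in> K" "w = c \<otimes> v"
proof -
  have "span {v} \<subseteq> {c \<otimes> v | c. c \<in> K}"
  proof (rule span_subsetI)
    have "v = \<one> \<otimes> v" "\<zero> = \<zero> \<otimes> v" using assms by auto
    then show "{v} \<subseteq> {c \<otimes> v | c. c \<in> K}" "\<zero> \<in> {c \<otimes> v | c. c \<in> K}"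
      using K_one K_zero by blast+
  next
    fix x y assume "x \<in> {c \<otimes> v | c. c \<in> K}" "y \<in> {c \<otimes> v | c. c \<in> K}"
    then obtain c c' where *: "c \<in> K" "x = c \<otimes> v" "c' \<in> K" "y = c' \<otimes> v" by blast
    then have "x \<oplus> y = (c \<oplus> c') \<otimes> v" using assms by (simp add: l_distr)
    moreover have "c \<oplus> c' \<in> K" using * subringE(7)[OF subfieldE(1)[OF K]] by blast
    ultimately show "x \<oplus> y \<in> {c \<otimes> v | c. c \<in> K}" by blast
  next
    fix c x assume c: "c \<in> K" and "x \<in> {c \<otimes> v | c. c \<in> K}"
    then obtain c' where *: "c' \<in> K" "x = c' \<otimes> v" by blast
    then have "c \<otimes> x = (c \<otimes> c') \<otimes> v" using assms c by (simp add: m_assoc)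
    then show "c \<otimes> x \<in> {c \<otimes> v | c. c \<in> K}" using K_mult[OF c *(1)] by blast
  qed
  then show ?thesis using assms that by blast
qed

lemma span_insertE:
  assumes "w \<in> span (insert v E)" "E \<subseteq> carrier R" "v \<in> carrier R"
  obtains c x where "c \<in> K" "x \<in> span E" "w = x \<oplus> c \<otimes> v"
proof -
  have "w \<in> span (E \<union> {v})" using assms by simp
  then obtain x y where "x \<in> span E" "y \<in> span {v}" "w = x \<oplus> y"
    by (rule span_UnE) (use assms in auto)
  then show ?thesis using that span_singletonE[of y v] assms by metis
qed

lemma span_finite_subset:
  assumes "w \<in> span E"
  obtains S where "finite S" "S \<subseteq> E" "w \<in> span S"
proof -
  have "\<exists>S. finite S \<and> S \<subseteq> E \<and> w \<in> span S" using assms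
  proof induction
    case span_zero
    show ?case by (rule exI[of _ "{}"]) (auto intro: span.intros)
  next
    case (span_base x)
    then show ?case by (intro exI[of _ "{x}"]) (auto intro: span.intros)
  next
    case (span_add x y)
    then obtain S S' where "finite S" "S \<subseteq> E" "x \<in> span S" "finite S'" "S' \<subseteq> E" "y \<in> span S'"
      by blast
    then show ?case
      using span_mono[of S "S \<union> S'"] span_mono[of S' "S \<union> S'"]
      by (intro exI[of _ "S \<union> S'"]) (auto intro: span.span_add)
  qed (auto intro: span.intros)
  then show ?thesis using that by blast
qed

lemma span_mult_in:
  assumes "w \<in> span E" "r \<in> carrier R" "E \<subseteq> carrier R" "\<And>x. x \<in> E \<Longrightarrow> r \<otimes> x \<in> span Y"
  shows "r \<otimes> w \<in> span Y"
proof -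
  from assms(1) have "w \<in> carrier R \<and> r \<otimes> w \<in> span Y"
  proof induction
    case (span_add x y)
    then show ?case using assms(2) by (auto simp: r_distr intro: span.span_add)
  next
    case (span_smult c x)
    then have "r \<otimes> (c \<otimes> x) = c \<otimes> (r \<otimes> x)" using assms(2) by (simp add: m_lcomm)
    with span_smult show ?case by (auto intro: span.span_smult)
  qed (use assms in \<open>auto intro: span.intros\<close>)
  then show ?thesis ..
qed

lemma add_minus_cancel: "\<lbrakk>x \<in> carrier R; y \<in> carrier R\<rbrakk> \<Longrightarrow> (x \<oplus> y) \<ominus> x = y"
  by (simp add: a_minus_def a_comm[of x y] a_assoc r_neg)

lemma span_exchange:
  assumes "w \<in> span (insert v E)" "w \<notin> span E" "E \<subseteq> carrier R" "v \<in> carrier R"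
  shows "v \<in> span (insert w E)"
proof -
  obtain c x where *: "c \<in> K" "x \<in> span E" "w = x \<oplus> c \<otimes> v"
    using span_insertE assms by metis
  have x: "x \<in> carrier R" using * span_carr assms by blast
  have "c \<noteq> \<zero>" using * assms x by auto
  then obtain c' where c': "c' \<in> K" "c' \<otimes> c = \<one>" using K_inv * by metis
  have "w \<ominus> x = c \<otimes> v" unfolding *(3) by (rule add_minus_cancel) (use x assms * in auto)
  then have "c' \<otimes> (w \<ominus> x) = (c' \<otimes> c) \<otimes> v" using x assms * c'(1) by (simp add: m_assoc)
  then have "v = c' \<otimes> (w \<ominus> x)" using c' assms by simp
  moreover have w: "w \<in> carrier R" using * x assms by auto
  have "w \<ominus> x \<in> span (insert w E)"
    using span_mono[of E "insert w E"] *(2) w assms by (intro span_minus) (auto intro: span.intros)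
  ultimately show ?thesis using c' span_smult by simp
qed

text \<open>Linear independence in the quotient by the span of \<open>U\<close>, expressed inside
  \<open>R\<close>. The family is indexed, so a repeated value already violates it, and
  cardinalities of index sets count dimensions.\<close>

definition indep :: "'a set \<Rightarrow> ('s \<Rightarrow> 'a) \<Rightarrow> 's set \<Rightarrow> bool" where
  "indep U b A \<longleftrightarrow> (\<forall>s\<in>A. b s \<notin> span (U \<union> b ` (A - {s})))"

lemma indepD: "\<lbrakk>indep U b A; s \<in> A\<rbrakk> \<Longrightarrow> b s \<notin> span (U \<union> b ` (A - {s}))"
  by (simp add: indep_def)

lemma indep_mono:
  assumes "indep U b A" "V \<subseteq> span U" "B \<subseteq> A" shows "indep V b B"
  unfolding indep_def
proof (intro ballI notI)
  fix s assume s: "s \<in> B" "b s \<in> span (V \<union> b ` (B - {s}))"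
  have "span (V \<union> b ` (B - {s})) \<subseteq> span (U \<union> b ` (A - {s}))"
  proof (rule span_least)
    have "V \<subseteq> span (U \<union> b ` (A - {s}))" using assms(2) span_mono[of U "U \<union> b ` (A - {s})"] by blast
    moreover have "b ` (B - {s}) \<subseteq> span (U \<union> b ` (A - {s}))"
      using assms(3) by (auto intro: span.intros)
    ultimately show "V \<union> b ` (B - {s}) \<subseteq> span (U \<union> b ` (A - {s}))" by blast
  qed
  then show False using s assms(3) indepD[OF assms(1), of s] by auto
qed

text \<open>Some \<open>b s\<close> outside the span of \<open>U \<union> W\<close> can be exchanged
  for the vector \<open>v\<close>. Moving \<open>b s\<close> into \<open>U\<close> then removes one
  index from \<open>A\<close> and one vector from the spanning set, which is why \<open>U\<close> is
  arbitrary in the induction.\<close>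

theorem steinitz:
  assumes "indep U b A" "finite W" "b ` A \<subseteq> span (U \<union> W)"
    and "U \<subseteq> carrier R" "W \<subseteq> carrier R"
  shows "finite A \<and> card A \<le> card W"
  using assms(2,1,3-)
proof (induction W arbitrary: U A rule: finite_induct)
  case empty
  have "A = {}"
  proof (rule ccontr)
    assume "A \<noteq> {}"
    then obtain s where s: "s \<in> A" by blast
    then have "b s \<in> span U" using empty by auto
    then show False using indepD[OF empty(1) s] span_mono[of U "U \<union> b ` (A - {s})"] by blast
  qed
  then show ?case by simp
next
  case (insert v W)
  have carr: "b ` A \<subseteq> carrier R" using insert.prems span_closed[of "U \<union> insert v W"] by auto
  show ?case
  proof (cases "b ` A \<subseteq> span (U \<union> W)")
    case True
    then have "finite A \<and> card A \<le> card W" using insert by auto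
    then show ?thesis using insert by simp
  next
    case False
    then obtain s where s: "s \<in> A" "b s \<notin> span (U \<union> W)" by blast
    have "b s \<in> span (insert v (U \<union> W))" using s insert.prems by auto
    from span_exchange[OF this] s(2) have v: "v \<in> span (insert (b s) (U \<union> W))"
      using insert.prems by blast
    have "indep (insert (b s) U) b (A - {s})"
      unfolding indep_def
    proof
      fix t assume t: "t \<in> A - {s}"
      have "insert (b s) U \<union> b ` (A - {s} - {t}) = U \<union> b ` (A - {t})" using s t by auto
      then show "b t \<notin> span (insert (b s) U \<union> b ` (A - {s} - {t}))"
        using indepD[OF insert.prems(1), of t] t by simp
    qed
    moreover have "b ` (A - {s}) \<subseteq> span (insert (b s) U \<union> W)"
    proof -
      have "U \<union> insert v W \<subseteq> span (insert (b s) (U \<union> W))" using v by (auto intro: span.intros)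
      then have "span (U \<union> insert v W) \<subseteq> span (insert (b s) U \<union> W)" by (simp add: span_least)
      then show ?thesis using insert.prems by blast
    qed
    ultimately have "finite (A - {s}) \<and> card (A - {s}) \<le> card W"
      using insert.prems carr s by (intro insert.IH[of "insert (b s) U" "A - {s}"]) auto
    then show ?thesis using insert s by (auto simp: card_Diff_singleton)
  qed
qed

lemma indep_insert:
  assumes "indep U b A" "b s \<notin> span (U \<union> b ` A)" "U \<subseteq> carrier R" "b ` A \<subseteq> carrier R" "b s \<in> carrier R"
  shows "indep U b (insert s A)"
  unfolding indep_def
proof (intro ballI notI)
  fix t assume t: "t \<in> insert s A" and bt: "b t \<in> span (U \<union> b ` (insert s A - {t}))"
  have sA: "s \<notin> A"
  proof
    assume "s \<in> A"
    then have "b s \<in> U \<union> b ` A" by blast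
    from span_base[OF this] show False using assms(2) by contradiction
  qed
  show False
  proof (cases "t = s")
    case True
    then have "insert s A - {t} = A" using sA by auto
    then show ?thesis using bt assms(2) True by simp
  next
    case False
    then have tA: "t \<in> A" using t by simp
    have "U \<union> b ` (insert s A - {t}) = insert (b s) (U \<union> b ` (A - {t}))" using False by auto
    then have "b t \<in> span (insert (b s) (U \<union> b ` (A - {t})))" using bt by simp
    then have "b s \<in> span (insert (b t) (U \<union> b ` (A - {t})))"
      by (rule span_exchange) (use indepD[OF assms(1) tA] assms in auto)
    moreover have "insert (b t) (U \<union> b ` (A - {t})) = U \<union> b ` A" using tA by auto
    ultimately show ?thesis using assms(2) by simp
  qed
qed

lemma indep_empty [simp]: "indep U b {}" by (simp add: indep_def)

text \<open>One vector is picked from each difference of consecutive subspaces. Together with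
  \<open>steinitz\<close> this bounds the length of a chain by a dimension.\<close>

lemma chain_indep:
  assumes "\<And>i. i \<le> n \<Longrightarrow> N i \<subseteq> carrier R \<and> span (N i) = N i" "\<And>i. i < n \<Longrightarrow> N i \<subset> N (Suc i)"
  shows "\<exists>w. indep (N 0) w {..<n} \<and> w ` {..<n} \<subseteq> N n"
  using assms
proof (induction n)
  case 0
  then show ?case by simp
next
  case (Suc n)
  have N: "N i \<subseteq> carrier R" "span (N i) = N i" if "i \<le> Suc n" for i
    using Suc.prems(1)[OF that] by auto
  have st: "N i \<subset> N (Suc i)" if "i \<le> n" for i
    using Suc.prems(2)[of i] that by simp
  have "\<exists>w. indep (N 0) w {..<n} \<and> w ` {..<n} \<subseteq> N n"
    by (rule Suc.IH) (use N st in auto)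
  then obtain w where w: "indep (N 0) w {..<n}" "w ` {..<n} \<subseteq> N n"
    by blast
  obtain v where v: "v \<in> N (Suc n)" "v \<notin> N n" using st[of n] by blast
  define w' where "w' = w(n := v)"
  have im: "w' ` B = w ` B" if "B \<subseteq> {..<n}" for B
    by (rule image_cong) (use that in \<open>auto simp: w'_def\<close>)
  have 1: "indep (N 0) w' {..<n}"
    unfolding indep_def
  proof
    fix s assume s: "s \<in> {..<n}"
    have "w' ` ({..<n} - {s}) = w ` ({..<n} - {s})" by (rule im) auto
    moreover have "w' s = w s" using s by (simp add: w'_def)
    ultimately show "w' s \<notin> span (N 0 \<union> w' ` ({..<n} - {s}))" using indepD[OF w(1) s] by simp
  qed
  have 2: "w' ` {..<n} \<subseteq> N n" using w(2) im[of "{..<n}"] by simp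
  have mono: "m \<le> n \<Longrightarrow> N 0 \<subseteq> N m" for m
  proof (induction m)
    case (Suc m)
    then show ?case using st[of m] by auto
  qed simp
  have "N 0 \<union> w' ` {..<n} \<subseteq> N n" using 2 mono[of n] by auto
  then have *: "span (N 0 \<union> w' ` {..<n}) \<subseteq> N n"
    using span_mono[of _ "N n"] N(2)[of n] by auto
  have "indep (N 0) w' (insert n {..<n})"
  proof (rule indep_insert[OF 1])
    have "w' n = v" by (simp add: w'_def)
    then show "w' n \<notin> span (N 0 \<union> w' ` {..<n})" "w' n \<in> carrier R"
      using * v N(1)[of "Suc n"] by auto
    show "N 0 \<subseteq> carrier R" "w' ` {..<n} \<subseteq> carrier R" using N(1)[of 0] N(1)[of n] 2 by auto
  qed
  moreover have "w' ` insert n {..<n} \<subseteq> N (Suc n)"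
    using 2 v st[of n] by (auto simp: w'_def)
  moreover have "insert n {..<n} = {..<Suc n}" by auto
  ultimately show ?case by auto
qed

end

section \<open>Graded algebras over a field\<close>

locale graded_algebra = graded_cring +
  assumes subfield_G0: "subfield (G 0) R"

sublocale graded_algebra \<subseteq> subfield_algebra R "G 0"
  by (intro subfield_algebra.intro subfield_algebra_axioms.intro is_cring subfield_G0)

context graded_algebra
begin

section \<open>Homogeneous components and uniqueness of the decomposition\<close>

lemma G_carrier: "G n \<subseteq> carrier R"
  using additive_subgroup.a_subset[OF component_subgroup] .

lemma G_carr: "x \<in> G n \<Longrightarrow> x \<in> carrier R"
  using G_carrier by blast

lemma UN_G_carrier: "(\<Union>m\<in>M. G m) \<subseteq> carrier R"
  using G_carrier by blast

lemma G_zero [simp]: "\<zero> \<in> G n"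
  using additive_subgroup.zero_closed[OF component_subgroup] .

lemma G_add: "\<lbrakk>x \<in> G n; y \<in> G n\<rbrakk> \<Longrightarrow> x \<oplus> y \<in> G n"
  using additive_subgroup.a_closed[OF component_subgroup] .

lemma G_neg: "x \<in> G n \<Longrightarrow> \<ominus> x \<in> G n"
  using additive_subgroup.a_inv_closed[OF component_subgroup] .

lemma G_smult: "\<lbrakk>c \<in> G 0; x \<in> G n\<rbrakk> \<Longrightarrow> c \<otimes> x \<in> G n"
  using component_mult[of c 0 x n] by simp

lemma G_pow: "x \<in> G n \<Longrightarrow> x [^] (k::nat) \<in> G (k * n)"
proof (induction k)
  case (Suc k)
  then show ?case using component_mult[of "x [^] k" "k * n" x n] by (simp add: add.commute)
qed simp

lemma span_G: "span (G n) = G n"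
proof
  show "span (G n) \<subseteq> G n" by (rule span_subsetI) (auto intro: G_add G_smult)
qed (rule span_superset)

text \<open>Returns from the inductive span to a finite sum of homogeneous components, the form to
  which the uniqueness in \<open>direct_sum\<close> applies. The function is total and zero off
  \<open>A\<close>, so that sums over different index sets can be merged.\<close>

lemma span_UN_rep:
  assumes "y \<in> span (\<Union>m\<in>M. G m)"
  shows "\<exists>f A. finite A \<and> A \<subseteq> M \<and> (\<forall>m. f m \<in> G m) \<and> (\<forall>m. m \<notin> A \<longrightarrow> f m = \<zero>) \<and> y = finsum R f A"
  using assms
proof induction
  case span_zero
  show ?case by (rule exI[of _ "\<lambda>_. \<zero>"], rule exI[of _ "{}"]) simp
next
  case (span_base x)
  then obtain m where m: "m \<in> M" "x \<in> G m" by blast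
  let ?f = "\<lambda>k. if k = m then x else \<zero>"
  have "finsum R ?f {m} = x" using m G_carr by simp
  then show ?case using m by (intro exI[of _ ?f] exI[of _ "{m}"]) auto
next
  case (span_add x y)
  then obtain f A g B where *:
    "finite A" "A \<subseteq> M" "\<forall>m. f m \<in> G m" "\<forall>m. m \<notin> A \<longrightarrow> f m = \<zero>" "x = finsum R f A"
    "finite B" "B \<subseteq> M" "\<forall>m. g m \<in> G m" "\<forall>m. m \<notin> B \<longrightarrow> g m = \<zero>" "y = finsum R g B" by blast
  have c: "f \<in> C \<rightarrow> carrier R" "g \<in> C \<rightarrow> carrier R" for C using * G_carr by blast+
  have "finsum R f A = finsum R f (A \<union> B)"
    by (rule add.finprod_mono_neutral_cong_left) (use * c in auto)
  moreover have "finsum R g B = finsum R g (A \<union> B)"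
    by (rule add.finprod_mono_neutral_cong_left) (use * c in auto)
  ultimately have "x \<oplus> y = finsum R (\<lambda>m. f m \<oplus> g m) (A \<union> B)"
    using * c by (simp add: finsum_addf)
  then show ?case using *
    by (intro exI[of _ "\<lambda>m. f m \<oplus> g m"] exI[of _ "A \<union> B"]) (auto intro: G_add)
next
  case (span_smult c x)
  then obtain f A where *:
    "finite A" "A \<subseteq> M" "\<forall>m. f m \<in> G m" "\<forall>m. m \<notin> A \<longrightarrow> f m = \<zero>" "x = finsum R f A" by blast
  have "f \<in> A \<rightarrow> carrier R" using * G_carr by blast
  then have "c \<otimes> x = finsum R (\<lambda>m. c \<otimes> f m) A" using * span_smult by (simp add: finsum_rdistr)
  then show ?case using * span_smult G_carr
    by (intro exI[of _ "\<lambda>m. c \<otimes> f m"] exI[of _ A]) (auto intro: G_smult)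
qed

lemma finsum_support:
  assumes "finite A" "\<forall>m. f m \<in> G m" "\<forall>m. m \<notin> A \<longrightarrow> f m = \<zero>"
  shows "finsum R f A = finsum R f {m. f m \<noteq> \<zero>}"
proof -
  have "f \<in> A \<rightarrow> carrier R" using assms(2) G_carr by blast
  then show ?thesis by (intro add.finprod_mono_neutral_cong_right) (use assms in auto)
qed

lemma disjoint_degrees:
  assumes "y \<in> span (\<Union>m\<in>M. G m)" "y \<in> G n" "n \<notin> M"
  shows "y = \<zero>"
proof -
  obtain f A where *: "finite A" "A \<subseteq> M" "\<forall>m. f m \<in> G m" "\<forall>m. m \<notin> A \<longrightarrow> f m = \<zero>" "y = finsum R f A"
    using span_UN_rep[OF assms(1)] by blast
  define g where "g = (\<lambda>m. if m = n then y else \<zero>)"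
  have g: "\<forall>m. g m \<in> G m" using assms by (simp add: g_def)
  have "finsum R g {n} = y" using assms G_carr by (simp add: g_def)
  then have gy: "y = finsum R g {m. g m \<noteq> \<zero>}"
    using finsum_support[of "{n}" g] g by (simp add: g_def)
  have fin: "finite {m. f m \<noteq> \<zero>}" "finite {m. g m \<noteq> \<zero>}"
    using * by (auto intro: finite_subset[of _ A] finite_subset[of _ "{n}"] simp: g_def)
  have "f = g"
    using direct_sum[OF G_carr[OF assms(2)]] fin * g gy finsum_support[of A f] by auto
  then have "y = f n" by (simp add: g_def)
  then show ?thesis using * assms(3) by auto
qed

text \<open>The part of the combination outside degree \<open>n\<close> is a difference of elements
  of \<open>G n\<close>, hence lies in \<open>G n\<close> as well and vanishes.\<close>

lemma span_degree:
  assumes "x \<in> G n" "x \<in> span (\<Union>m. Y m)" "\<And>m. Y m \<subseteq> G m"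
  shows "x \<in> span (Y n)"
proof -
  have "(\<Union>m. Y m) = Y n \<union> (\<Union>m\<in>-{n}. Y m)" by auto
  then have "x \<in> span (Y n \<union> (\<Union>m\<in>-{n}. Y m))" using assms by simp
  then obtain u v where uv: "u \<in> span (Y n)" "v \<in> span (\<Union>m\<in>-{n}. Y m)" "x = u \<oplus> v"
    by (rule span_UnE) (use assms(3) G_carr in blast)+
  have v: "v \<in> span (\<Union>m\<in>-{n}. G m)"
    using uv(2) span_mono[of "\<Union>m\<in>-{n}. Y m" "\<Union>m\<in>-{n}. G m"] assms(3) by blast
  have u: "u \<in> G n" using uv(1) span_mono[OF assms(3)[of n]] span_G by blast
  have carr: "u \<in> carrier R" "v \<in> carrier R" using u G_carr span_carr[OF v UN_G_carrier] by auto
  have "v = x \<oplus> \<ominus> u" using uv(3) add_minus_cancel[OF carr] by (simp add: a_minus_def)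
  then have "v \<in> G n" using u assms(1) G_add G_neg by simp
  then have "v = \<zero>" using disjoint_degrees[OF v] by simp
  then show ?thesis using uv carr by simp
qed

lemma finsum_in_span:
  assumes "finite A" "\<And>m. m \<in> A \<Longrightarrow> f m \<in> span E" "E \<subseteq> carrier R"
  shows "finsum R f A \<in> span E"
  using assms(1,2)
proof (induction A rule: finite_induct)
  case empty
  then show ?case by (simp add: span_zero)
next
  case (insert m A)
  then have "finsum R f (insert m A) = f m \<oplus> finsum R f A"
    using span_carr assms(3) by (intro finsum_insert) auto
  then show ?case using insert by (simp add: span_add)
qed

lemma span_all: "span (\<Union>m. G m) = carrier R"
proof
  show "carrier R \<subseteq> span (\<Union>m. G m)"
  proof
    fix x assume "x \<in> carrier R"
    then obtain f where f: "\<forall>n. f n \<in> G n" "finite {n. f n \<noteq> \<zero>}" "x = finsum R f {n. f n \<noteq> \<zero>}"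
      using direct_sum by blast
    show "x \<in> span (\<Union>m. G m)" unfolding f(3)
      by (rule finsum_in_span[OF f(2) _ UN_G_carrier]) (use f(1) in \<open>auto intro: span_base\<close>)
  qed
qed (rule span_closed[OF UN_G_carrier])

lemma ideal_spanI:
  assumes "E \<subseteq> carrier R" "\<And>n r x. \<lbrakk>r \<in> G n; x \<in> E\<rbrakk> \<Longrightarrow> r \<otimes> x \<in> span E"
  shows "ideal (span E) R"
proof (rule idealI_cring)
  show "span E \<subseteq> carrier R" "\<zero> \<in> span E" by (rule span_closed[OF assms(1)], rule span_zero)
  show "x \<oplus> y \<in> span E" if "x \<in> span E" "y \<in> span E" for x y using that by (rule span_add)
  fix x r assume x: "x \<in> span E" and r: "r \<in> carrier R"
  have xc: "x \<in> carrier R" using span_carr[OF x assms(1)] .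
  have "x \<otimes> r \<in> span E"
  proof (rule span_mult_in[OF _ xc UN_G_carrier])
    show "r \<in> span (\<Union>m\<in>UNIV. G m)" using r span_all by simp
    fix s assume "s \<in> (\<Union>m\<in>UNIV. G m)"
    then obtain m where s: "s \<in> G m" by blast
    have "s \<otimes> x \<in> span E"
      by (rule span_mult_in[OF x _ assms(1)]) (use s assms G_carr in auto)
    then show "x \<otimes> s \<in> span E" using m_comm[OF xc G_carr[OF s]] by simp
  qed
  then show "r \<otimes> x \<in> span E" using m_comm[OF xc r] by simp
qed

section \<open>The ideals of elements of degree at least \<open>n\<close>\<close>

definition gr_ge :: "nat \<Rightarrow> 'a set" where
  "gr_ge n = span (\<Union>m\<in>{n..}. G m)"

lemma ideal_gr_ge: "ideal (gr_ge n) R"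
  unfolding gr_ge_def
proof (rule ideal_spanI[OF UN_G_carrier])
  fix k r x assume r: "r \<in> G k" and "x \<in> (\<Union>m\<in>{n..}. G m)"
  then obtain m where "m \<ge> n" "x \<in> G m" by auto
  then have "r \<otimes> x \<in> G (k + m)" "k + m \<ge> n" using r component_mult by auto
  then show "r \<otimes> x \<in> span (\<Union>m\<in>{n..}. G m)" by (intro span_base) blast
qed

lemma gr_ge_carrier: "gr_ge n \<subseteq> carrier R"
  unfolding gr_ge_def by (rule span_closed[OF UN_G_carrier])

lemma G_gr_ge: "n \<le> m \<Longrightarrow> G m \<subseteq> gr_ge n"
  unfolding gr_ge_def by (auto intro: span_base)

lemma irrelevant_ideal_eq: "irrelevant_ideal R G = gr_ge 1"
proof
  show "irrelevant_ideal R G \<subseteq> gr_ge 1"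
  proof
    fix x assume "x \<in> irrelevant_ideal R G"
    then obtain f A where *: "x = finsum R f A" "finite A" "0 \<notin> A" "\<forall>n\<in>A. f n \<in> G n"
      by (auto simp: irrelevant_ideal_def)
    show "x \<in> gr_ge 1" unfolding *(1) gr_ge_def
    proof (rule finsum_in_span[OF *(2) _ UN_G_carrier])
      fix m assume "m \<in> A"
      then have "m \<in> {1..}" "f m \<in> G m" using * by (auto intro: Suc_leI gr0I)
      then show "f m \<in> span (\<Union>m\<in>{1..}. G m)" by (intro span_base) blast
    qed
  qed
  show "gr_ge 1 \<subseteq> irrelevant_ideal R G"
  proof
    fix x assume "x \<in> gr_ge 1"
    then obtain f A where *: "finite A" "A \<subseteq> {1..}" "\<forall>m. f m \<in> G m" "x = finsum R f A"
      unfolding gr_ge_def using span_UN_rep[of x "{1..}"] by blast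
    then have "0 \<notin> A" by auto
    then show "x \<in> irrelevant_ideal R G" using * unfolding irrelevant_ideal_def by blast
  qed
qed

section \<open>Length of graded quotients\<close>

text \<open>A homogeneous \<open>w\<close> in the highest degree that is not contained in
  \<open>N\<close> is a socle element of \<open>R / N\<close>: every positive degree multiplies it
  into \<open>N\<close>. Adjoining it as a vector, without its multiples, already gives an
  ideal.\<close>

lemma ideal_step:
  assumes N: "ideal N R" and D: "\<And>m. m \<ge> D \<Longrightarrow> G m \<subseteq> N" and neq: "N \<noteq> carrier R"
  shows "\<exists>w\<in>carrier R. w \<notin> N \<and> ideal (span (insert w N)) R"
proof -
  interpret N: ideal N R by fact
  have Nc: "N \<subseteq> carrier R" by (rule N.a_subset)
  have "\<exists>m. \<not> G m \<subseteq> N"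
  proof (rule ccontr)
    assume "\<not> ?thesis"
    then have "(\<Union>m. G m) \<subseteq> N" by blast
    then have "carrier R \<subseteq> N" using span_mono[of "\<Union>m. G m" N] span_all ideal_span[OF N] by simp
    then show False using neq Nc by blast
  qed
  moreover have bound: "m \<le> D" if "\<not> G m \<subseteq> N" for m using D[of m] that by linarith
  ultimately obtain m where m: "\<not> G m \<subseteq> N" "\<And>k. \<not> G k \<subseteq> N \<Longrightarrow> k \<le> m"
    using GreatestI_ex_nat[of "\<lambda>m. \<not> G m \<subseteq> N" D] Greatest_le_nat[of "\<lambda>m. \<not> G m \<subseteq> N" _ D] by metis
  then obtain w where w: "w \<in> G m" "w \<notin> N" by blast
  have wc: "w \<in> carrier R" using w G_carr by blast
  have "ideal (span (insert w N)) R"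
  proof (rule ideal_spanI)
    show "insert w N \<subseteq> carrier R" using wc Nc by simp
    fix n r x assume r: "r \<in> G n" and x: "x \<in> insert w N"
    show "r \<otimes> x \<in> span (insert w N)"
    proof (cases "x \<in> N")
      case True
      then have "r \<otimes> x \<in> N" using r G_carr N.I_l_closed by blast
      then show ?thesis by (auto intro: span_base)
    next
      case False
      then have [simp]: "x = w" using x by simp
      show ?thesis
      proof (cases n)
        case 0
        then show ?thesis using r by (auto intro: span_smult span_base)
      next
        case (Suc k)
        have "r \<otimes> w \<in> G (n + m)" using r w component_mult by blast
        moreover have "G (n + m) \<subseteq> N" using m(2)[of "n + m"] Suc by fastforce
        ultimately show ?thesis by (auto intro: span_base)
      qed
    qed
  qed
  then show ?thesis using w wc by blast
qed

text \<open>A composition series of \<open>R / I\<close> with one-dimensional factors. It is a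
  longest chain of ideals from \<open>I\<close> whose i-th member is spanned over \<open>I\<close>
  by i vectors; the finite spanning set \<open>W\<close> bounds such chains, and
  \<open>ideal_step\<close> would prolong one that ends in a proper ideal.\<close>

lemma ideal_filtration:
  assumes I: "ideal I R" and D: "\<And>m. m \<ge> D \<Longrightarrow> G m \<subseteq> I"
    and W: "finite W" "W \<subseteq> carrier R" "carrier R \<subseteq> span (I \<union> W)"
  obtains n N w where "N 0 = I" "\<And>i. i \<le> n \<Longrightarrow> ideal (N i) R"
    "\<And>i. i < n \<Longrightarrow> N i \<subset> N (Suc i)"
    "w ` {..<n} \<subseteq> carrier R" "carrier R \<subseteq> span (I \<union> w ` {..<n})"
proof -
  let ?P = "\<lambda>n N w. N 0 = I \<and> (\<forall>i\<le>n. ideal (N i) R) \<and> (\<forall>i<n. N i \<subset> N (Suc i)) \<and>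
     w ` {..<n} \<subseteq> carrier R \<and> (\<forall>i\<le>n. N i \<subseteq> span (I \<union> w ` {..<i}))"
  define Q where "Q n \<longleftrightarrow> (\<exists>N w. ?P n N w)" for n
  have Ic: "I \<subseteq> carrier R" using ideal.axioms(1)[OF I] additive_subgroup.a_subset by blast
  have bound: "n \<le> card W" if "Q n" for n
  proof -
    from that obtain N w where N: "N 0 = I" "\<And>i. i \<le> n \<Longrightarrow> ideal (N i) R" "\<And>i. i < n \<Longrightarrow> N i \<subset> N (Suc i)"
      unfolding Q_def by blast
    have Ni: "N i \<subseteq> carrier R \<and> span (N i) = N i" if "i \<le> n" for i
    proof -
      have "ideal (N i) R" using N(2) that .
      then show ?thesis using ideal_span ideal.axioms(1) additive_subgroup.a_subset by metis
    qed
    have "\<exists>v. indep (N 0) v {..<n} \<and> v ` {..<n} \<subseteq> N n"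
      by (rule chain_indep[of n N, OF Ni N(3)])
    then obtain v where v: "indep (N 0) v {..<n}" "v ` {..<n} \<subseteq> N n" by blast
    have "v ` {..<n} \<subseteq> span (I \<union> W)" using v(2) Ni[of n] W(3) by blast
    then show ?thesis using steinitz[of I v "{..<n}" W] v(1) N(1) W Ic by simp
  qed
  have "?P 0 (\<lambda>_. I) (\<lambda>_. \<zero>)" using I span_superset[of I] by simp
  then have "Q 0" unfolding Q_def by (intro exI)
  then obtain n where n: "Q n" "\<And>k. Q k \<Longrightarrow> k \<le> n"
    using GreatestI_nat[of Q 0 "card W"] Greatest_le_nat[of Q _ "card W"] bound by metis
  obtain N w where N: "?P n N w" using n(1) unfolding Q_def by blast
  have N1: "N 0 = I" "w ` {..<n} \<subseteq> carrier R" and N2: "\<And>i. i \<le> n \<Longrightarrow> ideal (N i) R"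
    and N3: "\<And>i. i < n \<Longrightarrow> N i \<subset> N (Suc i)" and N4: "\<And>i. i \<le> n \<Longrightarrow> N i \<subseteq> span (I \<union> w ` {..<i})"
    using N by blast+
  have "N n = carrier R"
  proof (rule ccontr)
    assume neq: "N n \<noteq> carrier R"
    have mono: "i \<le> n \<Longrightarrow> I \<subseteq> N i" for i
    proof (induction i)
      case (Suc i)
      then show ?case using N3[of i] by auto
    qed (use N1 in simp)
    have "G m \<subseteq> N n" if "m \<ge> D" for m using D[OF that] mono[of n] by blast
    from ideal_step[OF N2[OF order_refl] this neq]
    obtain v where v: "v \<in> carrier R" "v \<notin> N n" "ideal (span (insert v (N n))) R"
      by blast
    define N' where "N' = N(Suc n := span (insert v (N n)))"
    define w' where "w' = w(n := v)"
    have im: "w' ` {..<i} = w ` {..<i}" if "i \<le> n" for i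
      by (rule image_cong) (use that in \<open>auto simp: w'_def\<close>)
    have w'S: "w' ` {..<Suc n} = insert v (w ` {..<n})"
      unfolding lessThan_Suc image_insert im[OF order_refl] by (simp add: w'_def)
    have "N n \<subset> span (insert v (N n))"
    proof
      show "N n \<subseteq> span (insert v (N n))" using span_superset[of "insert v (N n)"] by simp
      show "N n \<noteq> span (insert v (N n))" using v(2) span_base[of v "insert v (N n)"] by auto
    qed
    then have 1: "\<forall>i<Suc n. N' i \<subset> N' (Suc i)" using N3 by (auto simp: N'_def less_Suc_eq)
    have "N n \<subseteq> span (I \<union> w' ` {..<Suc n})"
      using N4[of n] span_mono[of "I \<union> w ` {..<n}" "I \<union> w' ` {..<Suc n}"] w'S by auto
    moreover have "v \<in> span (I \<union> w' ` {..<Suc n})" unfolding w'S by (rule span_base) simp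
    ultimately have "span (insert v (N n)) \<subseteq> span (I \<union> w' ` {..<Suc n})" by (intro span_least) simp
    then have 2: "\<forall>i\<le>Suc n. N' i \<subseteq> span (I \<union> w' ` {..<i})"
      using N4 im by (simp add: N'_def le_Suc_eq)
    have 3: "\<forall>i\<le>Suc n. ideal (N' i) R" using N2 v(3) by (simp add: N'_def le_Suc_eq)
    have 4: "w' ` {..<Suc n} \<subseteq> carrier R" "N' 0 = I" using N1 v(1) w'S by (auto simp: N'_def)
    have "Q (Suc n)" unfolding Q_def by (intro exI[of _ N'] exI[of _ w'] conjI) (use 1 2 3 4 in simp_all)
    then show False using n(2) by fastforce
  qed
  then have "carrier R \<subseteq> span (I \<union> w ` {..<n})" using N4[of n] by simp
  from that[of N n w, OF N1(1) N2 N3 N1(2) this] show ?thesis .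
qed

end

section \<open>Module length\<close>

context cring
begin

section \<open>Submodules of \<open>R / I\<close> and ideals containing \<open>I\<close>\<close>

lemma submodule_preimage:
  assumes I: "ideal I R" and N: "submodule N R (quot_module R I)"
  defines "M \<equiv> {x \<in> carrier R. I +> x \<in> N}"
  shows "ideal M R" "I \<subseteq> M" "N = (\<lambda>x. I +> x) ` M"
proof -
  interpret I: ideal I R by fact
  interpret h: ring_hom_ring R "R Quot I" "(+>) I"
    by (rule I.rcos_ring_hom_ring)
  interpret Q: module R "quot_module R I" by (rule module_quot_module[OF I])
  interpret N: submodule N R "quot_module R I" by fact
  have N0: "\<zero>\<^bsub>R Quot I\<^esub> \<in> N" using N.one_closed by (simp add: quot_module_def)
  have Na: "x \<oplus>\<^bsub>R Quot I\<^esub> y \<in> N" if "x \<in> N" "y \<in> N" for x y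
    using N.m_closed[OF that] by (simp add: quot_module_def)
  have Ns: "(I +> r) \<otimes>\<^bsub>R Quot I\<^esub> x \<in> N" if "x \<in> N" "r \<in> carrier R" for r x
    using N.smult_closed[OF that(2,1)] by (simp add: quot_module_def)
  have mem: "I +> (r \<otimes> x) \<in> N" if "x \<in> M" "r \<in> carrier R" for r x
    using Ns[of "I +> x" r] that by (simp add: M_def)
  have Mc: "x \<in> carrier R" "I +> x \<in> N" if "x \<in> M" for x using that by (simp_all add: M_def)
  have MI: "x \<in> M" if "x \<in> carrier R" "I +> x \<in> N" for x using that by (simp add: M_def)
  have Mmult: "r \<otimes> x \<in> M" if "x \<in> M" "r \<in> carrier R" for r x
    using mem[OF that] Mc[OF that(1)] that m_comm[of x r] by (intro MI) auto
  have Madd: "x \<oplus> y \<in> M" if "x \<in> M" "y \<in> M" for x y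
    using Na[OF Mc(2)[OF that(1)] Mc(2)[OF that(2)]] h.hom_add[of x y] Mc[OF that(1)] Mc[OF that(2)]
    by (intro MI) auto
  have Mzero: "\<zero> \<in> M" using N0 h.hom_zero by (intro MI) auto
  show "ideal M R" by (rule idealI_cring) (use Mc Mzero Madd Mmult in auto)
  show "I \<subseteq> M"
  proof
    fix x assume x: "x \<in> I"
    have "I +> x = I" using I.a_rcos_const[OF x] .
    moreover have "I \<in> N" using N0 unfolding FactRing_def by simp
    ultimately show "x \<in> M" using MI[OF I.Icarr[OF x]] by simp
  qed
  have "N \<subseteq> carrier (quot_module R I)" using N.subset by simp
  then have N: "N \<subseteq> a_rcosets I" unfolding quot_module_def FactRing_def by simp
  show "N = (\<lambda>x. I +> x) ` M"
  proof
    show "N \<subseteq> (\<lambda>x. I +> x) ` M"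
    proof
      fix c assume c: "c \<in> N"
      then obtain x where "x \<in> carrier R" "c = I +> x" using N unfolding A_RCOSETS_def' by blast
      then show "c \<in> (\<lambda>x. I +> x) ` M" using MI c by blast
    qed
    show "(\<lambda>x. I +> x) ` M \<subseteq> N" using Mc by blast
  qed
qed

lemma ideal_image_submodule:
  assumes I: "ideal I R" and M: "ideal M R"
  shows "submodule ((\<lambda>x. I +> x) ` M) R (quot_module R I)"
proof -
  interpret I: ideal I R by fact
  interpret M: ideal M R by fact
  interpret h: ring_hom_ring R "R Quot I" "(+>) I"
    by (rule I.rcos_ring_hom_ring)
  interpret Q: module R "quot_module R I" by (rule module_quot_module[OF I])
  show ?thesis
  proof (rule Q.submoduleI)
    show sub: "(\<lambda>x. I +> x) ` M \<subseteq> carrier (quot_module R I)"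
      using M.Icarr by (auto simp: quot_module_def)
    show "\<zero>\<^bsub>quot_module R I\<^esub> \<in> (\<lambda>x. I +> x) ` M"
      using h.hom_zero M.zero_closed by (force simp: quot_module_def simp del: h.hom_zero)
  next
    fix a assume "a \<in> (\<lambda>x. I +> x) ` M"
    then obtain x where x: "x \<in> M" "a = I +> x" by blast
    have ac: "a \<in> carrier (quot_module R I)" using x M.Icarr by (auto simp: quot_module_def)
    have "a \<oplus>\<^bsub>quot_module R I\<^esub> (I +> \<ominus> x) = \<zero>\<^bsub>quot_module R I\<^esub>"
      using x M.Icarr h.hom_add[of x "\<ominus> x"] by (simp add: quot_module_def r_neg)
    moreover have "I +> \<ominus> x \<in> carrier (quot_module R I)" using x M.Icarr by (auto simp: quot_module_def)
    ultimately have "\<ominus>\<^bsub>quot_module R I\<^esub> a = I +> \<ominus> x"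
      using ac Q.minus_equality Q.a_comm by metis
    then show "\<ominus>\<^bsub>quot_module R I\<^esub> a \<in> (\<lambda>x. I +> x) ` M" using x by blast
  next
    fix a b assume "a \<in> (\<lambda>x. I +> x) ` M" "b \<in> (\<lambda>x. I +> x) ` M"
    then obtain x y where *: "x \<in> M" "a = I +> x" "y \<in> M" "b = I +> y" by blast
    then have "a \<oplus>\<^bsub>quot_module R I\<^esub> b = I +> (x \<oplus> y)"
      using M.Icarr h.hom_add[of x y] by (simp add: quot_module_def)
    moreover have "x \<oplus> y \<in> M" using * M.a_closed by blast
    ultimately show "a \<oplus>\<^bsub>quot_module R I\<^esub> b \<in> (\<lambda>x. I +> x) ` M" by (metis imageI)
  next
    fix r a assume r: "r \<in> carrier R" and "a \<in> (\<lambda>x. I +> x) ` M"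
    then obtain x where x: "x \<in> M" "a = I +> x" by blast
    then have "r \<odot>\<^bsub>quot_module R I\<^esub> a = I +> (r \<otimes> x)"
      using r M.Icarr by (simp add: quot_module_def)
    then show "r \<odot>\<^bsub>quot_module R I\<^esub> a \<in> (\<lambda>x. I +> x) ` M" using x r M.I_l_closed by blast
  qed
qed

lemma rcos_image_inject:
  assumes I: "ideal I R" and M: "ideal M R" "I \<subseteq> M" and x: "x \<in> carrier R" "I +> x \<in> (\<lambda>x. I +> x) ` M"
  shows "x \<in> M"
proof -
  interpret I: ideal I R by fact
  interpret M: ideal M R by fact
  obtain y where y: "y \<in> M" "I +> x = I +> y" using x by blast
  then have "x \<ominus> y \<in> M" using quotient_eq_iff_same_a_r_cos[OF I x(1)] M.Icarr M(2) by blast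
  moreover have "x = (x \<ominus> y) \<oplus> y" using x(1) M.Icarr[OF y(1)] by (simp add: a_minus_def a_assoc l_neg)
  ultimately show ?thesis using y(1) M.a_closed by metis
qed

end

context subfield_algebra
begin

text \<open>A strict chain of submodules pulls back to a strict chain of subspaces containing
  \<open>I\<close>, so the length is at most the dimension of \<open>R / I\<close> over
  \<open>K\<close>.\<close>

lemma module_length_le:
  assumes I: "ideal I R" and W: "finite W" "W \<subseteq> carrier R" "carrier R \<subseteq> span (I \<union> W)"
  shows "module_length R (quot_module R I) \<le> enat (card W)"
  unfolding module_length_def
proof (rule Sup_least)
  fix e assume "e \<in> {enat n | n. \<exists>N :: nat \<Rightarrow> 'a set set.
     (\<forall>i\<le>n. submodule (N i) R (quot_module R I)) \<and> (\<forall>i<n. N i \<subset> N (Suc i))}"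
  then obtain n N where e: "e = enat n" and N: "\<And>i. i \<le> n \<Longrightarrow> submodule (N i) R (quot_module R I)"
     "\<And>i. i < n \<Longrightarrow> N i \<subset> N (Suc i)" by blast
  define M where "M i = {x \<in> carrier R. I +> x \<in> N i}" for i
  note pre = submodule_preimage[OF I N(1), folded M_def]
  have Mi: "M i \<subseteq> carrier R \<and> span (M i) = M i" if "i \<le> n" for i
    using ideal_span[OF pre(1)[OF that]] by (simp add: M_def)
  have Ms: "M i \<subset> M (Suc i)" if "i < n" for i
  proof
    show "M i \<subseteq> M (Suc i)" using N(2)[OF that] by (auto simp: M_def)
    show "M i \<noteq> M (Suc i)" using N(2)[OF that] pre(3)[of i] pre(3)[of "Suc i"] that by auto
  qed
  have "\<exists>v. indep (M 0) v {..<n} \<and> v ` {..<n} \<subseteq> M n"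
    by (rule chain_indep[of n M, OF Mi Ms])
  then obtain v where v: "indep (M 0) v {..<n}" "v ` {..<n} \<subseteq> M n" by blast
  have "I \<subseteq> span (M 0)" using pre(2)[of 0] span_superset[of "M 0"] by blast
  then have v': "indep I v {..<n}" using indep_mono[OF v(1)] by blast
  have "I \<subseteq> carrier R" using pre(2)[of 0] Mi[of 0] by blast
  moreover have "v ` {..<n} \<subseteq> span (I \<union> W)" using v(2) Mi[of n] W(3) by blast
  ultimately have "card {..<n} \<le> card W" using steinitz[OF v' W(1)] W(2) by blast
  then show "e \<le> enat (card W)" using e by simp
qed

end

text \<open>The series from \<open>ideal_filtration\<close> has as many steps as vectors that span
  \<open>R\<close> modulo \<open>I\<close>, so its length is at least the size of any family
  independent modulo \<open>I\<close>.\<close>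

lemma (in graded_algebra) module_length_ge:
  assumes I: "ideal I R" and D: "\<And>m. m \<ge> D \<Longrightarrow> G m \<subseteq> I"
    and W: "finite W" "W \<subseteq> carrier R" "carrier R \<subseteq> span (I \<union> W)"
    and b: "indep I b A" "b ` A \<subseteq> carrier R"
  shows "enat (card A) \<le> module_length R (quot_module R I)"
proof (rule ideal_filtration[OF I D W])
  fix n :: nat and N w
  assume N: "N 0 = I" "\<And>i. i \<le> n \<Longrightarrow> ideal (N i) R"
    "\<And>i. i < n \<Longrightarrow> N i \<subset> N (Suc i)"
    "w ` {..<n} \<subseteq> carrier R" "carrier R \<subseteq> span (I \<union> w ` {..<n})"
  have Ic: "I \<subseteq> carrier R" using additive_subgroup.a_subset[OF ideal.axioms(1)[OF I]] .
  have "b ` A \<subseteq> span (I \<union> w ` {..<n})" using b(2) N(5) by blast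
  then have "card A \<le> card (w ` {..<n})"
    using steinitz[OF b(1) _ _ Ic N(4)] by simp
  also have "\<dots> \<le> n" using card_image_le[of "{..<n}" w] by simp
  finally have An: "card A \<le> n" .
  let ?N = "\<lambda>i. (\<lambda>x. I +> x) ` N i"
  have I0: "i \<le> n \<Longrightarrow> I \<subseteq> N i" for i
  proof (induction i)
    case (Suc i)
    then show ?case using N(3)[of i] by auto
  qed (use N in simp)
  have st: "?N i \<subset> ?N (Suc i)" if i: "i < n" for i
  proof -
    obtain x where x: "x \<in> N (Suc i)" "x \<notin> N i" using N(3) i by blast
    have xc: "x \<in> carrier R" using x(1) ideal.Icarr[OF N(2)[of "Suc i"]] i by simp
    have "I +> x \<notin> ?N i"
      using rcos_image_inject[OF I N(2) I0 xc, of i] x(2) i by (meson less_imp_le)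
    moreover have "?N i \<subseteq> ?N (Suc i)" using N(3)[OF i] by (intro image_mono) blast
    ultimately show ?thesis using x(1) by blast
  qed
  have sm: "submodule (?N i) R (quot_module R I)" if "i \<le> n" for i
    using ideal_image_submodule[OF I N(2)[OF that]] .
  have "enat n \<le> module_length R (quot_module R I)"
    unfolding module_length_def
  proof (rule Sup_upper, rule CollectI, intro exI[of _ n] exI[of _ ?N] conjI)
    show "\<forall>i\<le>n. submodule (?N i) R (quot_module R I)" using sm by blast
    show "\<forall>i<n. ?N i \<subset> ?N (Suc i)" using st by blast
  qed simp
  then show ?thesis using An order_trans[of "enat (card A)" "enat n"] by simp
qed

section \<open>Counting lattice points in a simplex\<close>

text \<open>Because the inequality is strict, the set is empty for \<open>n = 0\<close>. Truncated
  subtraction in the last argument therefore gives the correct count 0 whenever the shift exceeds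
  \<open>n\<close>.\<close>

definition simplex_points :: "nat \<Rightarrow> (nat \<Rightarrow> nat) \<Rightarrow> nat \<Rightarrow> (nat \<Rightarrow> nat) set" where
  "simplex_points d \<omega> n = {u. (\<forall>i. i \<notin> {1..d} \<longrightarrow> u i = 0) \<and> (\<Sum>i\<in>{1..d}. \<omega> i * u i) < n}"

text \<open>A point either has last coordinate zero or arises by raising that coordinate by one,
  which costs its weight. Counting turns this into a recursion in \<open>d\<close> and
  \<open>n\<close>.\<close>

lemma simplex_points_Suc:
  assumes "\<omega> (Suc d) > 0"
  shows "simplex_points (Suc d) \<omega> n = simplex_points d \<omega> n \<union>
     (\<lambda>u. u(Suc d := Suc (u (Suc d)))) ` simplex_points (Suc d) \<omega> (n - \<omega> (Suc d))" (is "?L = ?A \<union> ?h ` ?B")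
proof (intro equalityI subsetI)
  fix u assume u: "u \<in> ?L"
  show "u \<in> ?A \<union> ?h ` ?B"
  proof (cases "u (Suc d)")
    case 0
    then have "u \<in> ?A" using u by (auto simp: simplex_points_def not_less_eq_eq le_Suc_eq)
    then show ?thesis by simp
  next
    case (Suc k)
    define v where "v = u(Suc d := k)"
    have "(\<Sum>i\<in>{1..d}. \<omega> i * v i) = (\<Sum>i\<in>{1..d}. \<omega> i * u i)"
      by (rule sum.cong) (auto simp: v_def)
    then have "v \<in> ?B" using u Suc by (auto simp: simplex_points_def v_def)
    moreover have "u = ?h v" using Suc by (auto simp: v_def)
    ultimately show ?thesis by blast
  qed
next
  fix u assume "u \<in> ?A \<union> ?h ` ?B"
  then show "u \<in> ?L"
  proof
    assume u: "u \<in> ?A"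
    then have "u (Suc d) = 0" by (simp add: simplex_points_def)
    then show ?thesis using u by (auto simp: simplex_points_def)
  next
    assume "u \<in> ?h ` ?B"
    then obtain v where v: "v \<in> ?B" "u = ?h v" by blast
    have "(\<Sum>i\<in>{1..d}. \<omega> i * u i) = (\<Sum>i\<in>{1..d}. \<omega> i * v i)"
      by (rule sum.cong) (auto simp: v(2))
    then show ?thesis using v by (auto simp: simplex_points_def algebra_simps)
  qed
qed

lemma finite_simplex_points:
  assumes "\<And>i. i \<in> {1..d} \<Longrightarrow> \<omega> i > 0"
  shows "finite (simplex_points d \<omega> n)"
proof (rule finite_subset)
  show "simplex_points d \<omega> n \<subseteq> {u. (\<forall>i\<in>{1..d}. u i \<in> {..n}) \<and> (\<forall>i. i \<notin> {1..d} \<longrightarrow> u i = 0)}"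
  proof
    fix u assume u: "u \<in> simplex_points d \<omega> n"
    have "u i \<le> n" if "i \<in> {1..d}" for i
    proof -
      have "u i \<le> \<omega> i * u i" using assms[OF that] by simp
      also have "\<dots> \<le> (\<Sum>i\<in>{1..d}. \<omega> i * u i)" by (rule member_le_sum[OF that]) auto
      also have "\<dots> \<le> n" using u by (simp add: simplex_points_def)
      finally show ?thesis .
    qed
    then show "u \<in> {u. (\<forall>i\<in>{1..d}. u i \<in> {..n}) \<and> (\<forall>i. i \<notin> {1..d} \<longrightarrow> u i = 0)}"
      using u by (auto simp: simplex_points_def)
  qed
  show "finite {u::nat \<Rightarrow> nat. (\<forall>i\<in>{1..d}. u i \<in> {..n}) \<and> (\<forall>i. i \<notin> {1..d} \<longrightarrow> u i = 0)}"
  proof (rule finite_subset)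
    show "finite {u::nat \<Rightarrow> nat. \<forall>x. (x \<in> {1..d} \<longrightarrow> u x \<in> {..n}) \<and> (x \<notin> {1..d} \<longrightarrow> u x = 0)}"
      by (rule finite_set_of_finite_funs) auto
  qed auto
qed

lemma card_simplex_points_Suc:
  assumes "\<And>i. i \<in> {1..Suc d} \<Longrightarrow> \<omega> i > 0"
  shows "card (simplex_points (Suc d) \<omega> n) =
    card (simplex_points d \<omega> n) + card (simplex_points (Suc d) \<omega> (n - \<omega> (Suc d)))"
proof -
  let ?h = "\<lambda>u::nat \<Rightarrow> nat. u(Suc d := Suc (u (Suc d)))"
  have "inj ?h"
  proof (rule injI, rule ext)
    fix u v :: "nat \<Rightarrow> nat" and i assume eq: "?h u = ?h v"
    show "u i = v i" using fun_cong[OF eq, of i] by (cases "i = Suc d") auto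
  qed
  then have "card (?h ` simplex_points (Suc d) \<omega> (n - \<omega> (Suc d))) = card (simplex_points (Suc d) \<omega> (n - \<omega> (Suc d)))"
    by (intro card_image) (auto intro: inj_on_subset)
  moreover have "simplex_points d \<omega> n \<inter> ?h ` simplex_points (Suc d) \<omega> (n - \<omega> (Suc d)) = {}"
  proof -
    have "u (Suc d) = 0" if "u \<in> simplex_points d \<omega> n" for u using that by (simp add: simplex_points_def)
    then show ?thesis by fastforce
  qed
  ultimately show ?thesis
    using assms by (subst simplex_points_Suc) (simp, subst card_Un_disjoint, auto intro!: finite_simplex_points)
qed

section \<open>Asymptotics of the number of lattice points\<close>

lemma power_add_ge:
  fixes x w :: real
  assumes "x \<ge> 0" "w \<ge> 0"
  shows "x ^ Suc k + real (Suc k) * w * x ^ k \<le> (x + w) ^ Suc k"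
proof (induction k)
  case (Suc k)
  have "(x + w) ^ Suc (Suc k) \<ge> (x + w) * (x ^ Suc k + real (Suc k) * w * x ^ k)"
    using Suc assms by (simp add: mult_left_mono)
  moreover have "(x + w) * (x ^ Suc k + real (Suc k) * w * x ^ k) =
     x ^ Suc (Suc k) + real (Suc (Suc k)) * w * x ^ Suc k + real (Suc k) * w * w * x ^ k"
    by (simp add: algebra_simps)
  moreover have "real (Suc k) * w * w * x ^ k \<ge> 0" using assms by simp
  ultimately show ?case by linarith
qed simp

lemma power_diff_ge:
  fixes x w :: real
  assumes "0 \<le> w" "w \<le> x"
  shows "x ^ Suc k \<le> real (Suc k) * w * x ^ k + (x - w) ^ Suc k"
proof (induction k)
  case (Suc k)
  have "x ^ Suc (Suc k) \<le> x * (real (Suc k) * w * x ^ k + (x - w) ^ Suc k)"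
    using Suc assms by (simp add: mult_left_mono)
  moreover have "x * (real (Suc k) * w * x ^ k + (x - w) ^ Suc k) =
     real (Suc k) * w * x ^ Suc k + (x - w) ^ Suc (Suc k) + w * (x - w) ^ Suc k"
    by (simp add: algebra_simps)
  moreover have "w * (x - w) ^ Suc k \<le> w * x ^ Suc k"
    using assms by (intro mult_left_mono power_mono) auto
  moreover have "real (Suc k) * w * x ^ Suc k + w * x ^ Suc k = real (Suc (Suc k)) * w * x ^ Suc k"
    by (simp add: algebra_simps)
  ultimately show ?case by linarith
qed simp

text \<open>The factor normalizes by the volume of the simplex. Both bounds follow the recursion
  N_{d+1}(n) = N_d(n) + N_{d+1}(n - w); \<open>power_diff_ge\<close> and \<open>power_add_ge\<close>
  play the role of integrating x^d over an interval of length w.\<close>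

lemma card_simplex_points_bounds:
  assumes "\<And>i. i \<in> {1..d} \<Longrightarrow> \<omega> i > 0"
  shows "n > 0 \<Longrightarrow> real n ^ d \<le> real (card (simplex_points d \<omega> n)) * (fact d * (\<Prod>i\<in>{1..d}. real (\<omega> i)))"
    and "n > 0 \<Longrightarrow> real (card (simplex_points d \<omega> n)) * (fact d * (\<Prod>i\<in>{1..d}. real (\<omega> i)))
       \<le> (real n + (\<Sum>i\<in>{1..d}. real (\<omega> i))) ^ d"
proof -
  have "n > 0 \<Longrightarrow> real n ^ d \<le> real (card (simplex_points d \<omega> n)) * (fact d * (\<Prod>i\<in>{1..d}. real (\<omega> i))) \<and>
    (real (card (simplex_points d \<omega> n)) * (fact d * (\<Prod>i\<in>{1..d}. real (\<omega> i)))
       \<le> (real n + (\<Sum>i\<in>{1..d}. real (\<omega> i))) ^ d)"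
    using assms
  proof (induction d arbitrary: n)
    case 0
    have "simplex_points 0 \<omega> n = (if n > 0 then {\<lambda>_. 0} else {})"
      by (auto simp: simplex_points_def)
    then show ?case using 0 by simp
  next
    case (Suc d)
    define P where "P = fact d * (\<Prod>i\<in>{1..d}. real (\<omega> i))"
    define \<Omega> where "\<Omega> = (\<Sum>i\<in>{1..d}. real (\<omega> i))"
    define w where "w = \<omega> (Suc d)"
    have w: "w > 0" using Suc.prems by (simp add: w_def)
    have \<Omega>: "\<Omega> \<ge> 0" by (simp add: \<Omega>_def sum_nonneg)
    have P': "fact (Suc d) * (\<Prod>i\<in>{1..Suc d}. real (\<omega> i)) = real (Suc d) * real w * P"
      by (simp add: P_def w_def)
    have \<Omega>': "(\<Sum>i\<in>{1..Suc d}. real (\<omega> i)) = \<Omega> + real w" by (simp add: \<Omega>_def w_def)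
    have IH: "n > 0 \<Longrightarrow> real n ^ d \<le> real (card (simplex_points d \<omega> n)) * P"
      "n > 0 \<Longrightarrow> real (card (simplex_points d \<omega> n)) * P \<le> (real n + \<Omega>) ^ d" for n
      using Suc.IH[of n] Suc.prems by (auto simp: P_def \<Omega>_def)
    let ?N = "\<lambda>n. real (card (simplex_points (Suc d) \<omega> n)) * (real (Suc d) * real w * P)"
    have rec: "?N n = real (Suc d) * real w * (real (card (simplex_points d \<omega> n)) * P) + ?N (n - w)" for n
      using card_simplex_points_Suc[of d \<omega> n] Suc.prems by (simp add: w_def algebra_simps)
    have N0: "?N 0 = 0" by (simp add: simplex_points_def)
    \<comment> \<open>The positive exponent makes the lower bound true at \<open>n = 0\<close> too,
      a value that \<open>n - w\<close> can take.\<close>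
    have "real n ^ Suc d \<le> ?N n \<and> (n > 0 \<longrightarrow> ?N n \<le> (real n + (\<Omega> + real w)) ^ Suc d)"
    proof (induction n rule: less_induct)
      case (less n)
      show ?case
      proof (cases "n = 0")
        case True
        then show ?thesis by (simp add: simplex_points_def)
      next
        case False
        have lo: "real (Suc d) * real w * real n ^ d \<le> real (Suc d) * real w * (real (card (simplex_points d \<omega> n)) * P)"
          by (rule mult_left_mono[OF IH(1)]) (use False in auto)
        have hi: "real (Suc d) * real w * (real (card (simplex_points d \<omega> n)) * P) \<le> real (Suc d) * real w * (real n + \<Omega>) ^ d"
          by (rule mult_left_mono[OF IH(2)]) (use False in auto)
        have big: "(real n + \<Omega>) ^ Suc d + real (Suc d) * real w * (real n + \<Omega>) ^ d \<le> (real n + (\<Omega> + real w)) ^ Suc d"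
          using power_add_ge[of "real n + \<Omega>" "real w" d] \<Omega> by (simp add: add.assoc)
        have IHn: "real (n - w) ^ Suc d \<le> ?N (n - w)"
          "n - w > 0 \<Longrightarrow> ?N (n - w) \<le> (real (n - w) + (\<Omega> + real w)) ^ Suc d"
          using less[of "n - w"] w False by auto
        show ?thesis
        proof (cases "w \<le> n")
          case True
          then have nw: "real (n - w) = real n - real w" by simp
          have "real n ^ Suc d \<le> ?N n"
            using power_diff_ge[of "real w" "real n" d] True IHn(1) lo unfolding rec[of n] nw by linarith
          moreover have "?N (n - w) \<le> (real n + \<Omega>) ^ Suc d"
          proof (cases "n - w > 0")
            case True
            then show ?thesis using IHn(2) unfolding nw by (simp add: algebra_simps)
          next
            case False
            then show ?thesis using \<Omega> by (simp add: simplex_points_def)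
          qed
          then have "?N n \<le> (real n + (\<Omega> + real w)) ^ Suc d"
            unfolding rec[of n] using hi big by linarith
          ultimately show ?thesis by blast
        next
          case nw: False
          then have "n - w = 0" by simp
          then have rec': "?N n = real (Suc d) * real w * (real (card (simplex_points d \<omega> n)) * P)"
            using rec[of n] N0 unfolding \<open>n - w = 0\<close> by linarith
          have "real n ^ Suc d \<le> real w * real n ^ d" using nw by (simp add: mult_right_mono)
          also have "\<dots> \<le> real (Suc d) * real w * real n ^ d" by (simp add: algebra_simps)
          finally have "real n ^ Suc d \<le> ?N n" using lo rec' by linarith
          moreover have "(real n + \<Omega>) ^ Suc d \<ge> 0" using \<Omega> by simp
          then have "?N n \<le> (real n + (\<Omega> + real w)) ^ Suc d" using rec' hi big by linarith
          ultimately show ?thesis by blast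
        qed
      qed
    qed
    then show ?case unfolding P' \<Omega>' using Suc.prems(1) by blast
  qed
  then show "n > 0 \<Longrightarrow> real n ^ d \<le> real (card (simplex_points d \<omega> n)) * (fact d * (\<Prod>i\<in>{1..d}. real (\<omega> i)))"
    and "n > 0 \<Longrightarrow> real (card (simplex_points d \<omega> n)) * (fact d * (\<Prod>i\<in>{1..d}. real (\<omega> i)))
       \<le> (real n + (\<Sum>i\<in>{1..d}. real (\<omega> i))) ^ d"
    by auto
qed

text \<open>The limit is the volume of the simplex and ignores the shifts \<open>c\<close> and
  \<open>s\<close>; these will be degrees of module generators and weights of leading
  exponents.\<close>

lemma card_simplex_points_limit:
  assumes "\<And>i. i \<in> {1..d} \<Longrightarrow> \<omega> i > 0"
  shows "(\<lambda>n. real (card (simplex_points d \<omega> (n + c - s))) / real n ^ d)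
     \<longlonglongrightarrow> 1 / (fact d * (\<Prod>i\<in>{1..d}. real (\<omega> i)))"
proof -
  define P where "P = fact d * (\<Prod>i\<in>{1..d}. real (\<omega> i))"
  define \<Omega> where "\<Omega> = (\<Sum>i\<in>{1..d}. real (\<omega> i))"
  have P: "P > 0" unfolding P_def using assms by (intro mult_pos_pos prod_pos) auto
  have ev: "eventually (\<lambda>n. n > s) sequentially" by (rule eventually_gt_at_top)
  have lim: "(\<lambda>n. (real (n + c - s) + e) / real n) \<longlonglongrightarrow> 1" for e
  proof (rule Lim_transform_eventually)
    show "(\<lambda>n. (real n + real c - real s + e) / real n) \<longlonglongrightarrow> 1" by real_asymp
    show "eventually (\<lambda>n. (real n + real c - real s + e) / real n = (real (n + c - s) + e) / real n) sequentially"
      using ev by eventually_elim simp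
  qed
  have l1: "(\<lambda>n. (real (n + c - s) / real n) ^ d / P) \<longlonglongrightarrow> 1 ^ d / P"
    using tendsto_divide[OF tendsto_power[OF lim[of 0]] tendsto_const] P by simp
  have l2: "(\<lambda>n. ((real (n + c - s) + \<Omega>) / real n) ^ d / P) \<longlonglongrightarrow> 1 ^ d / P"
    using tendsto_divide[OF tendsto_power[OF lim[of \<Omega>]] tendsto_const] P by simp
  have e1: "eventually (\<lambda>n. (real (n + c - s) / real n) ^ d / P \<le>
      real (card (simplex_points d \<omega> (n + c - s))) / real n ^ d) sequentially"
    using ev
  proof eventually_elim
    case (elim n)
    have "real (n + c - s) ^ d / P \<le> real (card (simplex_points d \<omega> (n + c - s)))"
      using card_simplex_points_bounds(1)[of d \<omega> "n + c - s", OF assms] elim P by (simp add: P_def divide_le_eq)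
    then have "real (n + c - s) ^ d / P / real n ^ d \<le> real (card (simplex_points d \<omega> (n + c - s))) / real n ^ d"
      by (rule divide_right_mono) simp
    then show ?case by (simp add: power_divide field_simps)
  qed
  have e2: "eventually (\<lambda>n. real (card (simplex_points d \<omega> (n + c - s))) / real n ^ d \<le>
      ((real (n + c - s) + \<Omega>) / real n) ^ d / P) sequentially"
    using ev
  proof eventually_elim
    case (elim n)
    then have "real (card (simplex_points d \<omega> (n + c - s))) \<le> (real (n + c - s) + \<Omega>) ^ d / P"
      using card_simplex_points_bounds(2)[of d \<omega> "n + c - s", OF assms] elim P by (simp add: P_def \<Omega>_def le_divide_eq)
    then have "real (card (simplex_points d \<omega> (n + c - s))) / real n ^ d \<le> (real (n + c - s) + \<Omega>) ^ d / P / real n ^ d"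
      by (rule divide_right_mono) simp
    then show ?case by (simp add: power_divide field_simps)
  qed
  show ?thesis
    using tendsto_sandwich[OF e1 e2 l1 l2] by (simp add: P_def)
qed

section \<open>Monomials\<close>

locale monomials = graded_algebra +
  fixes d :: nat and z :: "nat \<Rightarrow> 'a"
  assumes z_closed: "i \<in> {1..d} \<Longrightarrow> z i \<in> carrier R"
begin

definition exps :: "(nat \<Rightarrow> nat) set" where
  "exps = {u. \<forall>i. i \<notin> {1..d} \<longrightarrow> u i = 0}"

definition mon :: "(nat \<Rightarrow> nat) \<Rightarrow> 'a" where
  "mon u = (\<Otimes>i\<in>{1..d}. z i [^] u i)"

lemma exps_add [intro]: "\<lbrakk>u \<in> exps; v \<in> exps\<rbrakk> \<Longrightarrow> u + v \<in> exps"
  by (simp add: exps_def)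

lemma exps_zero [simp]: "0 \<in> exps"
  by (simp add: exps_def)

lemma mon_closed [simp]: "mon u \<in> carrier R"
  unfolding mon_def by (rule finprod_closed) (use z_closed in auto)

lemma mon_zero [simp]: "mon 0 = \<one>"
  unfolding mon_def by (rule finprod_one_eqI) simp

lemma mon_add: "mon (u + v) = mon u \<otimes> mon v"
proof -
  have "(\<Otimes>i\<in>{1..d}. z i [^] (u + v) i) = (\<Otimes>i\<in>{1..d}. z i [^] u i \<otimes> z i [^] v i)"
    by (rule finprod_cong') (use z_closed in \<open>auto simp: nat_pow_mult\<close>)
  also have "\<dots> = mon u \<otimes> mon v" unfolding mon_def by (rule finprod_multf) (use z_closed in auto)
  finally show ?thesis unfolding mon_def .
qed

lemma mon_image_carrier: "mon ` A \<subseteq> carrier R"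
  by auto

text \<open>Monomials are ordered by these numbers; unique factorization makes the order total.\<close>

definition key :: "(nat \<Rightarrow> nat) \<Rightarrow> nat" where
  "key u = (\<Prod>i\<in>{1..d}. enumerate {p::nat. Factorial_Ring.prime p} i ^ u i)"

lemma enum_prime: "Factorial_Ring.prime (enumerate {p::nat. Factorial_Ring.prime p} i)"
  using enumerate_in_set[OF primes_infinite, of i] by simp

lemma key_pos: "key u > 0"
  unfolding key_def using enum_prime by (simp add: prod_pos prime_gt_0_nat)

lemma key_add: "key (u + v) = key u * key v"
  by (simp add: key_def power_add prod.distrib)

lemma key_inject:
  assumes "u \<in> exps" "v \<in> exps" "key u = key v"
  shows "u = v"
proof
  fix i
  let ?e = "enumerate {p::nat. Factorial_Ring.prime p}"
  have inj: "inj ?e"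
    using strict_mono_enumerate[OF primes_infinite] strict_mono_imp_inj_on by blast
  have key: "key w = (\<Prod>p\<in>?e ` {1..d}. p ^ w (inv_into UNIV ?e p))" for w
    unfolding key_def using inj by (subst prod.reindex) (auto intro: inj_on_subset)
  show "u i = v i"
  proof (cases "i \<in> {1..d}")
    case True
    have "multiplicity (?e i) (key w) = w i" for w
      unfolding key using True inj enum_prime
      by (subst multiplicity_prod_prime_powers) auto
    then show ?thesis using assms(3) by metis
  next
    case False
    then show ?thesis using assms by (simp add: exps_def)
  qed
qed

lemma key_add_less: "\<lbrakk>key u < key v; key m \<le> key m'\<rbrakk> \<Longrightarrow> key (u + m) < key (v + m')"
  using key_pos[of m] by (simp add: key_add mult_less_le_imp_less)

text \<open>The leading term is the one of smallest key and has coefficient one. The predicate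
  refers to some expression of \<open>f\<close> in monomials: these may be linearly dependent at
  this stage, so an element can have several leading exponents, and zero can have one.\<close>

definition lead :: "'a \<Rightarrow> (nat \<Rightarrow> nat) \<Rightarrow> bool" where
  "lead f m \<longleftrightarrow> m \<in> exps \<and> (\<exists>g\<in>span (mon ` {u \<in> exps. key u > key m}). f = mon m \<oplus> g)"

lemma leadE:
  assumes "lead f m"
  obtains g where "m \<in> exps" "g \<in> span (mon ` {u \<in> exps. key u > key m})" "g \<in> carrier R"
    "f = mon m \<oplus> g"
proof -
  obtain g where g: "m \<in> exps" "g \<in> span (mon ` {u \<in> exps. key u > key m})" "f = mon m \<oplus> g"
    using assms unfolding lead_def by auto
  show thesis by (rule that[OF g(1,2) span_carr[OF g(2) mon_image_carrier] g(3)])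
qed

lemma lead_span:
  assumes "lead f m" shows "f \<in> span (mon ` {u \<in> exps. key u \<ge> key m})"
proof -
  obtain g where g: "m \<in> exps" "g \<in> span (mon ` {u \<in> exps. key u > key m})" "f = mon m \<oplus> g"
    using leadE[OF assms] .
  have "span (mon ` {u \<in> exps. key u > key m}) \<subseteq> span (mon ` {u \<in> exps. key u \<ge> key m})"
    by (rule span_mono) auto
  moreover have "mon m \<in> span (mon ` {u \<in> exps. key u \<ge> key m})" by (rule span_base) (use g(1) in auto)
  ultimately show ?thesis unfolding g(3) using g(2) by (intro span_add) auto
qed

lemma lead_span_exps: assumes "lead f m" shows "f \<in> span (mon ` exps)"
proof -
  have "mon ` {u \<in> exps. key u \<ge> key m} \<subseteq> mon ` exps" by auto
  from subsetD[OF span_mono[OF this] lead_span[OF assms]] show ?thesis .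
qed

lemma lead_closed: "lead f m \<Longrightarrow> f \<in> carrier R"
  by (erule leadE) simp

lemma lead_one: "lead \<one> 0"
  unfolding lead_def using span_zero by (intro conjI bexI[of _ \<zero>]) auto

lemma span_mon_mult:
  assumes "f \<in> span (mon ` A)" "x \<in> span (b ` B)" "b ` B \<subseteq> carrier R"
    and "\<And>u t. \<lbrakk>u \<in> A; t \<in> B\<rbrakk> \<Longrightarrow> mon u \<otimes> b t \<in> span E"
  shows "f \<otimes> x \<in> span E"
proof -
  have fc: "f \<in> carrier R" using span_carr[OF assms(1) mon_image_carrier] .
  show ?thesis
  proof (rule span_mult_in[OF assms(2) fc assms(3)])
    fix y assume "y \<in> b ` B"
    then obtain t where t: "t \<in> B" "y = b t" by blast
    then have yc: "y \<in> carrier R" using assms(3) by blast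
    have "y \<otimes> f \<in> span E"
    proof (rule span_mult_in[OF assms(1) yc mon_image_carrier])
      fix w assume "w \<in> mon ` A"
      then obtain u where u: "u \<in> A" "w = mon u" by blast
      then show "y \<otimes> w \<in> span E" using assms(4)[OF u(1) t(1)] t(2) yc by (simp add: m_comm)
    qed
    then show "f \<otimes> y \<in> span E" using fc yc by (simp add: m_comm)
  qed
qed

lemma lead_mult:
  assumes "lead f m" "lead f' m'"
  shows "lead (f \<otimes> f') (m + m')"
proof -
  obtain g where g: "m \<in> exps" "g \<in> span (mon ` {u \<in> exps. key u > key m})" "g \<in> carrier R" "f = mon m \<oplus> g"
    using leadE[OF assms(1)] .
  obtain g' where g': "m' \<in> exps" "g' \<in> span (mon ` {u \<in> exps. key u > key m'})" "g' \<in> carrier R" "f' = mon m' \<oplus> g'"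
    using leadE[OF assms(2)] .
  let ?E = "mon ` {u \<in> exps. key u > key (m + m')}"
  have "g \<otimes> f' \<in> span ?E"
  proof (rule span_mon_mult[OF g(2) lead_span[OF assms(2)] mon_image_carrier])
    fix u t assume *: "u \<in> {u \<in> exps. key u > key m}" "t \<in> {u \<in> exps. key u \<ge> key m'}"
    then have "u + t \<in> {u \<in> exps. key u > key (m + m')}" using key_add_less by auto
    then show "mon u \<otimes> mon t \<in> span ?E" unfolding mon_add[symmetric] by (intro span_base) blast
  qed
  moreover have "mon m \<otimes> g' \<in> span ?E"
  proof (rule span_mult_in[OF g'(2) mon_closed mon_image_carrier])
    fix y assume "y \<in> mon ` {u \<in> exps. key u > key m'}"
    then obtain t where t: "t \<in> exps" "key t > key m'" "y = mon t" by blast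
    have "key (t + m) > key (m' + m)" using key_add_less[OF t(2), of m m] by simp
    then have "m + t \<in> {u \<in> exps. key u > key (m + m')}" using t g(1) by (auto simp: add.commute)
    then show "mon m \<otimes> y \<in> span ?E" unfolding t(3) mon_add[symmetric] by (intro span_base) blast
  qed
  ultimately have "mon m \<otimes> g' \<oplus> g \<otimes> f' \<in> span ?E" by (rule span_add[rotated])
  moreover have "f \<otimes> f' = mon (m + m') \<oplus> (mon m \<otimes> g' \<oplus> g \<otimes> f')"
    using g g' by (simp add: mon_add l_distr r_distr a_ac)
  ultimately show ?thesis unfolding lead_def using exps_add[OF g(1) g'(1)] by blast
qed

text \<open>If the term of smallest key has a nonzero coefficient, dividing by it produces a leading
  term; otherwise the term is dropped and the induction continues with fewer exponents. The nonzero
  coefficient of \<open>mon u\<close> guarantees that a leading term is found.\<close>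

lemma lead_normalize:
  assumes "finite S" "S \<subseteq> exps" "u \<in> exps" "u \<notin> S" "g \<in> span (mon ` S)" "c \<in> G 0" "c \<noteq> \<zero>"
  shows "\<exists>c'\<in>G 0. \<exists>m\<in>insert u S. lead (c' \<otimes> (c \<otimes> mon u \<oplus> g)) m"
  using assms
proof (induction S arbitrary: g rule: finite_psubset_induct)
  case (psubset S)
  have gc: "g \<in> carrier R" using span_carr[OF psubset.prems(4) mon_image_carrier] .
  obtain m where m: "m \<in> insert u S" "\<And>v. v \<in> insert u S \<Longrightarrow> key m \<le> key v"
    using arg_min_if_finite(1)[of "insert u S" key] arg_min_least[of "insert u S" _ key] psubset.hyps(1)
    by (metis finite.insertI insert_not_empty)
  have mexp: "m \<in> exps" using m(1) psubset.prems by auto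
  have gt: "key v > key m" if "v \<in> insert u S" "v \<noteq> m" for v
  proof -
    have "v \<in> exps" using that psubset.prems(1,2) by auto
    then have "key v \<noteq> key m" using key_inject[OF _ mexp] that(2) by blast
    then show ?thesis using m(2)[OF that(1)] by simp
  qed
  show ?case
  proof (cases "m = u")
    case True
    obtain c' where c': "c' \<in> G 0" "c' \<otimes> c = \<one>" using K_inv psubset.prems by metis
    have "mon ` S \<subseteq> mon ` {v \<in> exps. key v > key m}"
      using gt psubset.prems True by auto
    then have "c' \<otimes> g \<in> span (mon ` {v \<in> exps. key v > key m})"
      using psubset.prems(4) span_mono c'(1) span_smult by blast
    moreover have "c' \<otimes> (c \<otimes> mon u \<oplus> g) = mon m \<oplus> c' \<otimes> g"
      using c' psubset.prems gc True by (simp add: r_distr m_assoc[symmetric])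
    ultimately have "lead (c' \<otimes> (c \<otimes> mon u \<oplus> g)) m" unfolding lead_def using mexp by blast
    then show ?thesis using c' m(1) by blast
  next
    case False
    then have mS: "m \<in> S" using m(1) by simp
    have "g \<in> span (insert (mon m) (mon ` (S - {m})))"
      using psubset.prems(4) mS by (metis image_insert insert_Diff)
    then obtain c1 g' where g': "c1 \<in> G 0" "g' \<in> span (mon ` (S - {m}))" "g = g' \<oplus> c1 \<otimes> mon m"
      by (rule span_insertE) auto
    have g'c: "g' \<in> carrier R" using span_carr[OF g'(2) mon_image_carrier] .
    show ?thesis
    proof (cases "c1 = \<zero>")
      case True
      then have "g = g'" using g' g'c by simp
      then have "g \<in> span (mon ` (S - {m}))" using g' by simp
      then have "\<exists>c'\<in>G 0. \<exists>m\<in>insert u (S - {m}). lead (c' \<otimes> (c \<otimes> mon u \<oplus> g)) m"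
        using psubset.prems mS by (intro psubset.IH) auto
      then show ?thesis by blast
    next
      case False
      obtain c' where c': "c' \<in> G 0" "c' \<otimes> c1 = \<one>" using K_inv g'(1) False by metis
      let ?E = "mon ` {v \<in> exps. key v > key m}"
      have "mon ` (S - {m}) \<subseteq> ?E" using gt psubset.prems by auto
      then have 1: "c' \<otimes> g' \<in> span ?E" using g'(2) span_mono c'(1) span_smult by blast
      have "mon u \<in> ?E" using gt[of u] \<open>m \<noteq> u\<close> psubset.prems by auto
      then have 2: "c' \<otimes> (c \<otimes> mon u) \<in> span ?E"
        by (intro span_smult span_base) (use c' psubset.prems in auto)
      have "c' \<otimes> (c1 \<otimes> mon m) = mon m" using c' g'(1) by (simp add: m_assoc[symmetric])
      then have "c' \<otimes> (c \<otimes> mon u \<oplus> g) = mon m \<oplus> (c' \<otimes> (c \<otimes> mon u) \<oplus> c' \<otimes> g')"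
        using c' psubset.prems g'(1,3) g'c by (simp add: r_distr a_ac)
      then have "lead (c' \<otimes> (c \<otimes> mon u \<oplus> g)) m" unfolding lead_def using mexp span_add[OF 2 1] by blast
      then show ?thesis using c' m(1) by blast
    qed
  qed
qed

section \<open>Free modules over the ring of polynomials in the parameters\<close>

definition pm :: "(nat \<Rightarrow> nat) \<times> 'a \<Rightarrow> 'a" where
  "pm s = mon (fst s) \<otimes> snd s"

lemma pm_closed: "Z \<subseteq> carrier R \<Longrightarrow> pm ` (A \<times> Z) \<subseteq> carrier R"
  by (auto simp: pm_def)

lemma pm_subset_closed: "\<lbrakk>Z \<subseteq> carrier R; S \<subseteq> A \<times> Z\<rbrakk> \<Longrightarrow> pm ` S \<subseteq> carrier R"
  by (auto simp: pm_def)

lemma mon_pm: "snd s \<in> carrier R \<Longrightarrow> mon u \<otimes> pm s = pm (u + fst s, snd s)"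
  by (simp add: pm_def mon_add m_assoc)

lemma mon_mult_pm_span:
  assumes "f \<in> span (mon ` A)" "x \<in> span (pm ` (B \<times> Z))" "Z \<subseteq> carrier R"
    and "\<And>u v. \<lbrakk>u \<in> A; v \<in> B\<rbrakk> \<Longrightarrow> u + v \<in> C"
  shows "f \<otimes> x \<in> span (pm ` (C \<times> Z))"
proof (rule span_mon_mult[OF assms(1,2) pm_closed[OF assms(3)]])
  fix u t assume "u \<in> A" "t \<in> B \<times> Z"
  then have "mon u \<otimes> pm t = pm (u + fst t, snd t)" "(u + fst t, snd t) \<in> C \<times> Z"
    using assms(3,4) by (auto intro!: mon_pm)
  then show "mon u \<otimes> pm t \<in> span (pm ` (C \<times> Z))" by (auto intro: span_base)
qed

text \<open>These are the exponent sets of monomial ideals.\<close>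

definition upset :: "(nat \<Rightarrow> nat) set \<Rightarrow> bool" where
  "upset M \<longleftrightarrow> M \<subseteq> exps \<and> (\<forall>u\<in>M. \<forall>v\<in>exps. v + u \<in> M)"

text \<open>\<open>u0\<close> is the exponent of smallest key in a shortest expression of
  \<open>e\<close> modulo the monomial submodule of \<open>M\<close>, so it does not depend on
  \<open>f\<close>. In \<open>f \<otimes> e\<close> the product of the two leading terms cannot be
  cancelled: any other product has a larger key, belongs to another basis element, or has its
  exponent in \<open>M\<close>. If \<open>f \<otimes> e\<close> lies in the submodule, independence
  forces the exponent \<open>m + u0\<close> into \<open>M\<close>.\<close>

lemma leading_exponent:
  assumes ind: "indep {} pm (exps \<times> Z)" and Z: "Z \<subseteq> carrier R" and M: "upset M" and A: "A \<subseteq> exps"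
    and e: "e \<in> span (pm ` (A \<times> Z))" "e \<notin> span (pm ` (M \<times> Z))"
  shows "\<exists>u0\<in>A - M. \<forall>f m. lead f m \<longrightarrow> f \<otimes> e \<in> span (pm ` (M \<times> Z)) \<longrightarrow> m + u0 \<in> M"
proof -
  define P where "P S \<longleftrightarrow> finite S \<and> S \<subseteq> A \<times> Z \<and> e \<in> span (pm ` (S \<union> M \<times> Z))" for S
  obtain T where T: "finite T" "T \<subseteq> pm ` (A \<times> Z)" "e \<in> span T" using span_finite_subset[OF e(1)] .
  obtain S' where S': "S' \<subseteq> A \<times> Z" "finite S'" "T = pm ` S'" using T(1,2) finite_subset_image by metis
  have "P S'" unfolding P_def using T S' span_mono[of T "pm ` (S' \<union> M \<times> Z)"] by auto
  then obtain S where S: "P S" "\<And>S'. P S' \<Longrightarrow> card S \<le> card S'"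
    using ex_min_if_finite arg_min_nat_lemma[of P _ card] by metis
  have Mexp: "M \<subseteq> exps" using M by (simp add: upset_def)
  have fin: "finite S" "S \<subseteq> A \<times> Z" and eS: "e \<in> span (pm ` (S \<union> M \<times> Z))" using S(1) by (auto simp: P_def)
  have notP: "e \<notin> span (pm ` (S - {s} \<union> M \<times> Z))" if "s \<in> S" for s
  proof
    assume "e \<in> span (pm ` (S - {s} \<union> M \<times> Z))"
    then have "P (S - {s})" unfolding P_def using fin by auto
    then have "card S \<le> card (S - {s})" by (rule S(2))
    then show False using card_Diff1_less[OF fin(1) that] by simp
  qed
  have "S \<noteq> {}" using eS e(2) by auto
  then obtain s0 where s0: "s0 \<in> S" "\<And>s. s \<in> S \<Longrightarrow> key (fst s0) \<le> key (fst s)"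
    using arg_min_if_finite(1)[of S "\<lambda>s. key (fst s)"] arg_min_least[of S _ "\<lambda>s. key (fst s)"] fin(1) by metis
  obtain u0 g0 where ug: "s0 = (u0, g0)" by (cases s0)
  have u0: "u0 \<in> A" "g0 \<in> Z" using s0(1) ug fin(2) by auto
  have u0M: "u0 \<notin> M"
  proof
    assume "u0 \<in> M"
    then have "S - {s0} \<union> M \<times> Z = S \<union> M \<times> Z" using ug u0 by auto
    then show False using notP[OF s0(1)] eS by simp
  qed
  let ?S = "S - {s0} \<union> M \<times> Z"
  have Sc: "pm ` ?S \<subseteq> carrier R" using fin(2) pm_subset_closed[OF Z, of ?S "A \<union> M"] by auto
  have pc: "pm s0 \<in> carrier R" using u0 Z ug by (auto simp: pm_def)
  have "S \<union> M \<times> Z = insert s0 ?S" using s0(1) by auto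
  then have "e \<in> span (insert (pm s0) (pm ` ?S))" using eS by simp
  then obtain c0 e' where e': "c0 \<in> G 0" "e' \<in> span (pm ` ?S)" "e = e' \<oplus> c0 \<otimes> pm s0"
    by (rule span_insertE[OF _ Sc pc])
  have e'c: "e' \<in> carrier R" using span_carr[OF e'(2) Sc] .
  have "c0 \<noteq> \<zero>" using e' notP[OF s0(1)] e'c pc by auto
  then obtain c1 where c1: "c1 \<in> G 0" "c1 \<otimes> c0 = \<one>" using K_inv e'(1) by metis
  show ?thesis
  proof (intro bexI[of _ u0] allI impI)
    show "u0 \<in> A - M" using u0 u0M by blast
    fix f m assume f: "lead f m" "f \<otimes> e \<in> span (pm ` (M \<times> Z))"
    show "m + u0 \<in> M"
    proof (rule ccontr)
      assume nM: "m + u0 \<notin> M"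
      obtain g where g: "m \<in> exps" "g \<in> span (mon ` {u \<in> exps. key u > key m})" "g \<in> carrier R" "f = mon m \<oplus> g"
        using leadE[OF f(1)] .
      \<comment> \<open>All basis elements except the product of the leading terms; every remaining
        term of \<open>f \<otimes> e\<close> lies in their span.\<close>
      define B where "B = exps \<times> Z - {(m + u0, g0)}"
      have Bc: "pm ` B \<subseteq> carrier R" by (rule pm_subset_closed[OF Z, of _ exps]) (auto simp: B_def)
      have inB: "mon v \<otimes> pm s \<in> span (pm ` B)"
        if "v \<in> exps" "s \<in> exps \<times> Z" "(v + fst s, snd s) \<noteq> (m + u0, g0)" for v s
      proof -
        have "(v + fst s, snd s) \<in> B" unfolding B_def using that by auto
        moreover have "mon v \<otimes> pm s = pm (v + fst s, snd s)" using that(2) Z by (intro mon_pm) auto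
        ultimately show ?thesis by (auto intro: span_base)
      qed
      have Sexp: "?S \<subseteq> exps \<times> Z" using fin(2) A Mexp by auto
      have 1: "mon m \<otimes> pm s \<in> span (pm ` B)" if "s \<in> ?S" for s
      proof (rule inB[OF g(1)])
        show "s \<in> exps \<times> Z" using that Sexp by blast
        show "(m + fst s, snd s) \<noteq> (m + u0, g0)"
        proof
          assume "(m + fst s, snd s) = (m + u0, g0)"
          then have "s = s0" using ug by (simp add: prod_eq_iff)
          then show False using that u0M ug by auto
        qed
      qed
      have 2: "mon v \<otimes> pm s \<in> span (pm ` B)" if "v \<in> {u \<in> exps. key u > key m}" "s \<in> insert s0 ?S" for v s
      proof (rule inB)
        show "v \<in> exps" using that by simp
        show s: "s \<in> exps \<times> Z" using that(2) Sexp s0(1) fin(2) A by auto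
        show "(v + fst s, snd s) \<noteq> (m + u0, g0)"
        proof
          assume eq: "(v + fst s, snd s) = (m + u0, g0)"
          show False
          proof (cases "s \<in> M \<times> Z")
            case True
            then have "v + fst s \<in> M" using M that(1) by (auto simp: upset_def)
            then show False using eq nM by simp
          next
            case False
            then have "s \<in> S" using that(2) s0(1) by blast
            then have "key u0 \<le> key (fst s)" using s0(2) ug by fastforce
            then have "key (m + u0) < key (v + fst s)" using key_add_less that(1) by blast
            then show False using eq by simp
          qed
        qed
      qed
      have "g \<otimes> e' \<in> span (pm ` B)"
        by (rule span_mon_mult[OF g(2) e'(2) Sc]) (use 2 in blast)
      moreover have "mon m \<otimes> e' \<in> span (pm ` B)"
        by (rule span_mult_in[OF e'(2) mon_closed Sc]) (use 1 in blast)
      moreover have "g \<otimes> (c0 \<otimes> pm s0) \<in> span (pm ` B)"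
      proof (rule span_mon_mult[OF g(2), of _ pm "{s0}"])
        show "c0 \<otimes> pm s0 \<in> span (pm ` {s0})" using e'(1) by (auto intro: span_base span_smult)
        show "pm ` {s0} \<subseteq> carrier R" using pc by simp
      qed (use 2 in blast)
      moreover have "f \<otimes> e \<in> span (pm ` B)"
      proof -
        have "M \<times> Z \<subseteq> B" using nM Mexp by (auto simp: B_def)
        then show ?thesis using f(2) span_mono[of "pm ` (M \<times> Z)" "pm ` B"] by blast
      qed
      ultimately have *: "f \<otimes> e \<ominus> (mon m \<otimes> e' \<oplus> g \<otimes> e' \<oplus> g \<otimes> (c0 \<otimes> pm s0)) \<in> span (pm ` B)"
        using Bc by (intro span_minus span_add)
      have ec: "c0 \<in> carrier R" using e'(1) by simp
      have "f \<otimes> e = (mon m \<otimes> e' \<oplus> g \<otimes> e' \<oplus> g \<otimes> (c0 \<otimes> pm s0)) \<oplus> mon m \<otimes> (c0 \<otimes> pm s0)"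
        unfolding g(4) e'(3) using g(3) e'c ec pc by (simp add: l_distr r_distr a_ac)
      then have "f \<otimes> e \<ominus> (mon m \<otimes> e' \<oplus> g \<otimes> e' \<oplus> g \<otimes> (c0 \<otimes> pm s0)) = mon m \<otimes> (c0 \<otimes> pm s0)"
        using add_minus_cancel g(3) e'c ec pc by simp
      with * have "mon m \<otimes> (c0 \<otimes> pm s0) \<in> span (pm ` B)" by simp
      then have "c1 \<otimes> (mon m \<otimes> (c0 \<otimes> pm s0)) \<in> span (pm ` B)" using c1(1) by (rule span_smult[rotated])
      moreover have "c1 \<otimes> (mon m \<otimes> (c0 \<otimes> pm s0)) = (c1 \<otimes> c0) \<otimes> (mon m \<otimes> pm s0)"
        using c1(1) ec pc by (simp add: m_ac)
      moreover have "mon m \<otimes> pm s0 = pm (m + u0, g0)" using mon_pm[of s0 m] ug u0 Z by auto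
      moreover have "pm (m + u0, g0) \<in> carrier R" using u0 Z by (auto simp: pm_def)
      ultimately have "pm (m + u0, g0) \<in> span (pm ` B)" using c1(2) by simp
      moreover have "(m + u0, g0) \<in> exps \<times> Z" using g(1) u0 A by auto
      ultimately show False using indepD[OF ind] by (simp add: B_def)
    qed
  qed
qed

section \<open>Torsion, and a free submodule of maximal rank\<close>

lemma pm_span_singleton:
  assumes "x \<in> span (pm ` (A \<times> {y}))" "y \<in> carrier R"
  obtains g where "g \<in> span (mon ` A)" "x = g \<otimes> y"
proof -
  from assms(1) have "\<exists>g\<in>span (mon ` A). x = g \<otimes> y"
  proof induction
    case span_zero
    show ?case using assms(2) by (intro bexI[of _ \<zero>]) (auto intro: span.span_zero)
  next
    case (span_base x)
    then obtain u where "u \<in> A" "x = mon u \<otimes> y" by (auto simp: pm_def)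
    then show ?case by (intro bexI[of _ "mon u"]) (auto intro: span.span_base)
  next
    case (span_add x x')
    then obtain g g' where *: "g \<in> span (mon ` A)" "x = g \<otimes> y" "g' \<in> span (mon ` A)" "x' = g' \<otimes> y" by blast
    then have "x \<oplus> x' = (g \<oplus> g') \<otimes> y"
      using assms(2) span_carr[OF _ mon_image_carrier] by (simp add: l_distr)
    then show ?case using * span.span_add by blast
  next
    case (span_smult c x)
    then obtain g where *: "g \<in> span (mon ` A)" "x = g \<otimes> y" by blast
    then have "c \<otimes> x = (c \<otimes> g) \<otimes> y"
      using assms(2) span_smult(1) span_carr[OF _ mon_image_carrier] by (simp add: m_assoc)
    then show ?case using * span_smult(1) span.span_smult by blast
  qed
  then show thesis using that by blast
qed

text \<open>Collecting the multiples of \<open>y\<close> on one side leaves a polynomial times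
  \<open>y\<close> in the free module. The polynomial contains \<open>mon v\<close> with coefficient
  one, so after scaling it has a leading exponent.\<close>

lemma torsionI:
  assumes v: "v \<in> exps" "pm (v, y) \<in> span (pm ` (exps \<times> Z \<union> (exps - {v}) \<times> {y}))"
    and c: "Z \<subseteq> carrier R" "y \<in> carrier R"
  shows "\<exists>f m. lead f m \<and> f \<otimes> y \<in> span (pm ` (exps \<times> Z))"
proof -
  have "pm (v, y) \<in> span (pm ` (exps \<times> Z) \<union> pm ` ((exps - {v}) \<times> {y}))"
    using v(2) by (simp add: image_Un)
  then obtain e e2 where e: "e \<in> span (pm ` (exps \<times> Z))" "e2 \<in> span (pm ` ((exps - {v}) \<times> {y}))"
    "pm (v, y) = e \<oplus> e2"
    by (rule span_UnE) (use pm_closed c in auto)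
  obtain g where g: "g \<in> span (mon ` (exps - {v}))" "e2 = g \<otimes> y"
    using pm_span_singleton[OF e(2) c(2)] .
  obtain T where T: "finite T" "T \<subseteq> mon ` (exps - {v})" "g \<in> span T" using span_finite_subset[OF g(1)] .
  obtain S where S: "S \<subseteq> exps - {v}" "finite S" "T = mon ` S" using T(1,2) finite_subset_image by metis
  have gc: "g \<in> carrier R" "e \<in> carrier R"
    using span_carr[OF g(1) mon_image_carrier] span_carr[OF e(1) pm_closed[OF c(1)]] by auto
  have "\<ominus> g \<in> span (mon ` S)" using T(3) S(3) by (simp add: span_neg mon_image_carrier)
  then obtain c' m where cm: "c' \<in> G 0" "lead (c' \<otimes> (\<one> \<otimes> mon v \<oplus> \<ominus> g)) m"
    using lead_normalize[of S v "\<ominus> g" \<one>] S v(1) one_not_zero K_one by blast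
  have "mon v \<otimes> y = e \<oplus> g \<otimes> y" using e(3) g(2) by (simp add: pm_def)
  then have "(mon v \<oplus> \<ominus> g) \<otimes> y = e"
    using gc c(2) by (simp add: l_distr l_minus a_assoc r_neg)
  then have "(c' \<otimes> (\<one> \<otimes> mon v \<oplus> \<ominus> g)) \<otimes> y = c' \<otimes> e" using gc c(2) cm(1) by (simp add: m_assoc)
  moreover have "c' \<otimes> e \<in> span (pm ` (exps \<times> Z))" using cm(1) e(1) by (rule span_smult)
  ultimately show ?thesis using cm(2) by metis
qed

text \<open>The failure of independence may be witnessed at an element of \<open>Z\<close>. As
  \<open>Z\<close> alone is independent, a relation with fewest multiples of \<open>y\<close> still
  involves one, and exchange solves for it, which reduces to \<open>torsionI\<close>.\<close>

lemma dependent_torsion: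
  assumes ind: "indep {} pm (exps \<times> Z)" and dep: "\<not> indep {} pm (exps \<times> insert y Z)"
    and c: "Z \<subseteq> carrier R" "y \<in> carrier R" "y \<notin> Z"
  shows "\<exists>f m. lead f m \<and> f \<otimes> y \<in> span (pm ` (exps \<times> Z))"
proof -
  obtain u x where ux: "u \<in> exps" "x \<in> insert y Z" "pm (u, x) \<in> span (pm ` (exps \<times> insert y Z - {(u, x)}))"
    using dep by (auto simp: indep_def)
  show ?thesis
  proof (cases "x = y")
    case True
    have "exps \<times> insert y Z - {(u, y)} = exps \<times> Z \<union> (exps - {u}) \<times> {y}" using c(3) by auto
    then show ?thesis using torsionI[OF ux(1) _ c(1,2)] ux(3) True by simp
  next
    case False
    let ?B = "exps \<times> Z - {(u, x)}"
    define P where "P S \<longleftrightarrow> finite S \<and> S \<subseteq> exps \<and> pm (u, x) \<in> span (pm ` (?B \<union> S \<times> {y}))" for S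
    obtain T where T: "finite T" "T \<subseteq> pm ` (exps \<times> insert y Z - {(u, x)})" "pm (u, x) \<in> span T"
      using span_finite_subset[OF ux(3)] .
    obtain S' where S': "S' \<subseteq> exps \<times> insert y Z - {(u, x)}" "finite S'" "T = pm ` S'"
      using T(1,2) finite_subset_image by metis
    have "S' \<subseteq> ?B \<union> (fst ` S' \<inter> exps) \<times> {y}" using S'(1) by force
    then have "pm (u, x) \<in> span (pm ` (?B \<union> (fst ` S' \<inter> exps) \<times> {y}))"
      using T(3) S'(3) span_mono[OF image_mono] by blast
    then have "P (fst ` S' \<inter> exps)" unfolding P_def using S'(2) by auto
    then obtain S where S: "P S" "\<And>S'. P S' \<Longrightarrow> card S \<le> card S'"
      using arg_min_nat_lemma[of P _ card] by metis
    have xZ: "x \<in> Z" using False ux(2) by simp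
    have "S \<noteq> {}"
    proof
      assume "S = {}"
      then have "pm (u, x) \<in> span (pm ` ?B)" using S(1) by (simp add: P_def)
      then show False using indepD[OF ind, of "(u, x)"] ux(1) xZ by simp
    qed
    then obtain v where v: "v \<in> S" by blast
    have Sf: "finite S" "S \<subseteq> exps" using S(1) by (auto simp: P_def)
    let ?C = "?B \<union> (S - {v}) \<times> {y}"
    have "pm (u, x) \<notin> span (pm ` ?C)"
    proof
      assume "pm (u, x) \<in> span (pm ` ?C)"
      then have "P (S - {v})" unfolding P_def using Sf by auto
      then have "card S \<le> card (S - {v})" by (rule S(2))
      then show False using card_Diff1_less[OF Sf(1) v] by simp
    qed
    moreover have "?B \<union> S \<times> {y} = insert (v, y) ?C" using v by auto
    then have "pm (u, x) \<in> span (insert (pm (v, y)) (pm ` ?C))" using S(1) by (simp add: P_def)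
    moreover have "pm ` ?C \<subseteq> carrier R"
      by (rule pm_subset_closed[of "insert y Z" _ exps]) (use c Sf in auto)
    moreover have "pm (v, y) \<in> carrier R" using c by (simp add: pm_def)
    ultimately have "pm (v, y) \<in> span (insert (pm (u, x)) (pm ` ?C))"
      using span_exchange by blast
    moreover have "insert (pm (u, x)) (pm ` ?C) \<subseteq> pm ` (exps \<times> Z \<union> (exps - {v}) \<times> {y})"
    proof -
      have "insert (u, x) ?C \<subseteq> exps \<times> Z \<union> (exps - {v}) \<times> {y}" using ux(1) xZ Sf(2) by auto
      then show ?thesis by blast
    qed
    ultimately have "pm (v, y) \<in> span (pm ` (exps \<times> Z \<union> (exps - {v}) \<times> {y}))"
      using span_mono by blast
    then show ?thesis using torsionI[OF _ _ c(1,2)] v Sf by blast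
  qed
qed

text \<open>Generators are treated one at a time: each either extends the free family or is torsion
  modulo it. In the second case its multiplier is absorbed into \<open>f\<close>, whose leading
  exponent is kept under control by \<open>lead_mult\<close>.\<close>

theorem free_rank:
  assumes "finite Y" "Y \<subseteq> carrier R"
  shows "\<exists>Z f m. Z \<subseteq> Y \<and> indep {} pm (exps \<times> Z) \<and> lead f m \<and> (\<forall>y\<in>Y. f \<otimes> y \<in> span (pm ` (exps \<times> Z)))"
  using assms
proof (induction Y rule: finite_induct)
  case empty
  have "indep {} pm (exps \<times> {})" by simp
  then show ?case using lead_one by blast
next
  case (insert y Y)
  then obtain Z f m where *: "Z \<subseteq> Y" "indep {} pm (exps \<times> Z)" "lead f m"
    "\<And>y. y \<in> Y \<Longrightarrow> f \<otimes> y \<in> span (pm ` (exps \<times> Z))"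
    by auto
  have c: "Z \<subseteq> carrier R" "y \<in> carrier R" "y \<notin> Z" using * insert by auto
  have fs: "f \<in> span (mon ` exps)" using lead_span_exps[OF *(3)] .
  show ?case
  proof (cases "indep {} pm (exps \<times> insert y Z)")
    case True
    have "f \<otimes> y' \<in> span (pm ` (exps \<times> insert y Z))" if "y' \<in> insert y Y" for y'
    proof (cases "y' = y")
      case True
      have "pm (0, y) = y" using c by (simp add: pm_def)
      then have "y \<in> pm ` (exps \<times> insert y Z)" by (metis exps_zero imageI insertI1 mem_Sigma_iff)
      then have "y \<in> span (pm ` (exps \<times> insert y Z))" by (rule span_base)
      then show ?thesis unfolding True
        by (rule mon_mult_pm_span[OF fs]) (use c in auto)
    next
      case False
      then have "f \<otimes> y' \<in> span (pm ` (exps \<times> Z))" using that *(4) by simp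
      moreover have "pm ` (exps \<times> Z) \<subseteq> pm ` (exps \<times> insert y Z)" by auto
      ultimately show ?thesis using span_mono by blast
    qed
    then show ?thesis using True * by (intro exI[of _ "insert y Z"] exI[of _ f] exI[of _ m]) auto
  next
    case False
    obtain f' m' where f': "lead f' m'" "f' \<otimes> y \<in> span (pm ` (exps \<times> Z))"
      using dependent_torsion[OF *(2) False c] by blast
    have fs': "f' \<in> span (mon ` exps)" using lead_span_exps[OF f'(1)] .
    have fc: "f \<in> carrier R" "f' \<in> carrier R" using lead_closed[OF *(3)] lead_closed[OF f'(1)] by auto
    have "(f \<otimes> f') \<otimes> y' \<in> span (pm ` (exps \<times> Z))" if "y' \<in> insert y Y" for y'
    proof (cases "y' = y")
      case True
      have "f \<otimes> (f' \<otimes> y) \<in> span (pm ` (exps \<times> Z))"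
        by (rule mon_mult_pm_span[OF fs f'(2) c(1)]) auto
      then show ?thesis using True fc c by (simp add: m_assoc)
    next
      case False
      then have y': "y' \<in> Y" "y' \<in> carrier R" using that insert by auto
      have "f' \<otimes> (f \<otimes> y') \<in> span (pm ` (exps \<times> Z))"
        by (rule mon_mult_pm_span[OF fs' *(4)[OF y'(1)] c(1)]) auto
      then show ?thesis using y' fc by (simp add: m_ac)
    qed
    moreover have "Z \<subseteq> insert y Y" using *(1) by blast
    ultimately show ?thesis using *(2) lead_mult[OF *(3) f'(1)]
      by (intro exI[of _ Z] exI[of _ "f \<otimes> f'"] exI[of _ "m + m'"] conjI ballI)
  qed
qed

end

section \<open>Colengths of monomial ideals in parameters\<close>

context monomials
begin

definition wt :: "(nat \<Rightarrow> nat) \<Rightarrow> (nat \<Rightarrow> nat) \<Rightarrow> nat" where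
  "wt \<omega> u = (\<Sum>i\<in>{1..d}. \<omega> i * u i)"

lemma wt_add: "wt \<omega> (u + v) = wt \<omega> u + wt \<omega> v"
  by (simp add: wt_def algebra_simps sum.distrib)

definition below :: "(nat \<Rightarrow> nat) \<Rightarrow> nat \<Rightarrow> (nat \<Rightarrow> nat) set" where
  "below \<omega> n = {u \<in> exps. wt \<omega> u < n}"

definition above :: "(nat \<Rightarrow> nat) \<Rightarrow> nat \<Rightarrow> (nat \<Rightarrow> nat) set" where
  "above \<omega> n = {u \<in> exps. n \<le> wt \<omega> u}"

lemma below_eq: "below \<omega> n = simplex_points d \<omega> n"
  by (auto simp: below_def simplex_points_def exps_def wt_def)

lemma upset_above: "upset (above \<omega> n)"
  by (auto simp: upset_def above_def wt_add)

definition monideal :: "(nat \<Rightarrow> nat) set \<Rightarrow> 'a set" where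
  "monideal M = span {mon u \<otimes> r | u r. u \<in> M \<and> r \<in> carrier R}"

lemma monideal_gen_carrier: "{mon u \<otimes> r | u r. u \<in> M \<and> r \<in> carrier R} \<subseteq> carrier R"
  by auto

lemma ideal_monideal: "ideal (monideal M) R"
  unfolding monideal_def
proof (rule ideal_spanI[OF monideal_gen_carrier])
  fix n r x assume r: "r \<in> G n" and "x \<in> {mon u \<otimes> r | u r. u \<in> M \<and> r \<in> carrier R}"
  then obtain u s where *: "x = mon u \<otimes> s" "u \<in> M" "s \<in> carrier R" by blast
  have rc: "r \<in> carrier R" using r G_carr by blast
  have "r \<otimes> x = mon u \<otimes> (r \<otimes> s)" using * rc by (simp add: m_lcomm)
  then show "r \<otimes> x \<in> span {mon u \<otimes> r | u r. u \<in> M \<and> r \<in> carrier R}"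
    using * rc by (intro span_base) blast
qed

lemma monideal_carrier: "monideal M \<subseteq> carrier R"
  unfolding monideal_def by (rule span_closed[OF monideal_gen_carrier])

lemma mon_in_monideal: "\<lbrakk>u \<in> M; r \<in> carrier R\<rbrakk> \<Longrightarrow> mon u \<otimes> r \<in> monideal M"
  unfolding monideal_def by (rule span_base) blast

lemma monideal_least:
  assumes "ideal I R" "\<And>u. u \<in> M \<Longrightarrow> mon u \<in> I"
  shows "monideal M \<subseteq> I"
proof -
  have "{mon u \<otimes> r | u r. u \<in> M \<and> r \<in> carrier R} \<subseteq> I"
    using assms(2) ideal.I_r_closed[OF assms(1)] by auto
  from span_mono[OF this] show ?thesis unfolding monideal_def ideal_span[OF assms(1)] .
qed

end

text \<open>
  \<open>R\<close> is spanned by \<open>Y\<close> over the polynomials in the \<open>z i\<close>, and \<open>Z\<close> is a basis of a free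
  submodule over these polynomials which contains \<open>f R\<close>; the leading exponent of \<open>f\<close> is \<open>\<mu>\<close>.
\<close>

locale parameters = monomials +
  fixes a :: "nat \<Rightarrow> nat" and Y Z :: "'a set" and C :: nat and f :: 'a and \<mu> :: "nat \<Rightarrow> nat"
  assumes a_pos: "i \<in> {1..d} \<Longrightarrow> a i > 0"
    and z_degree: "i \<in> {1..d} \<Longrightarrow> z i \<in> G (a i)"
    and finite_Y: "finite Y"
    and Y_degree: "Y \<subseteq> (\<Union>m\<in>{..C}. G m)"
    and G_span_pm: "G n \<subseteq> span (pm ` ({u \<in> exps. wt a u \<le> n \<and> n \<le> wt a u + C} \<times> Y))"
    and Z_subset: "Z \<subseteq> Y"
    and indep_Z: "indep {} pm (exps \<times> Z)"
    and lead_f: "lead f \<mu>"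
    and f_Y: "y \<in> Y \<Longrightarrow> f \<otimes> y \<in> span (pm ` (exps \<times> Z))"
begin

lemma Y_carrier: "Y \<subseteq> carrier R"
  using Y_degree UN_G_carrier by blast

lemma Z_carrier: "Z \<subseteq> carrier R"
  using Y_carrier Z_subset by blast

lemma finite_Z: "finite Z"
  using finite_Y Z_subset finite_subset by blast

lemma f_closed [simp]: "f \<in> carrier R"
  using lead_closed[OF lead_f] .

lemma mu_exps [simp]: "\<mu> \<in> exps"
  using lead_f by (simp add: lead_def)

lemma carrier_span: "carrier R = span (pm ` (exps \<times> Y))"
proof
  have "G n \<subseteq> span (pm ` (exps \<times> Y))" for n
    using G_span_pm[of n] span_mono[of "pm ` ({u \<in> exps. wt a u \<le> n \<and> n \<le> wt a u + C} \<times> Y)" "pm ` (exps \<times> Y)"]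
    by auto
  then show "carrier R \<subseteq> span (pm ` (exps \<times> Y))" unfolding span_all[symmetric] by (intro span_least) blast
qed (rule span_closed[OF pm_closed[OF Y_carrier]])

lemma f_mult: assumes "r \<in> carrier R" shows "f \<otimes> r \<in> span (pm ` (exps \<times> Z))"
proof (rule span_mult_in[OF _ f_closed pm_closed[OF Y_carrier]])
  show "r \<in> span (pm ` (exps \<times> Y))" using assms carrier_span by simp
  fix x assume "x \<in> pm ` (exps \<times> Y)"
  then obtain u y where *: "u \<in> exps" "y \<in> Y" "x = mon u \<otimes> y" by (auto simp: pm_def)
  have "mon u \<otimes> (f \<otimes> y) \<in> span (pm ` (exps \<times> Z))"
    by (rule mon_mult_pm_span[where A = "{u}", OF _ f_Y[OF *(2)] Z_carrier]) (use *(1) in \<open>auto intro: span_base\<close>)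
  moreover have "y \<in> carrier R" using * Y_carrier by blast
  then have "f \<otimes> x = mon u \<otimes> (f \<otimes> y)" using * by (simp add: m_lcomm)
  ultimately show "f \<otimes> x \<in> span (pm ` (exps \<times> Z))" by simp
qed

lemma f_monideal:
  assumes M: "upset M" and x: "x \<in> monideal M" shows "f \<otimes> x \<in> span (pm ` (M \<times> Z))"
proof (rule span_mult_in[OF x[unfolded monideal_def] f_closed monideal_gen_carrier])
  fix x assume "x \<in> {mon u \<otimes> r | u r. u \<in> M \<and> r \<in> carrier R}"
  then obtain u r where *: "u \<in> M" "r \<in> carrier R" "x = mon u \<otimes> r" by blast
  have "mon u \<otimes> (f \<otimes> r) \<in> span (pm ` (M \<times> Z))"
  proof (rule mon_mult_pm_span[where A = "{u}", OF _ f_mult[OF *(2)] Z_carrier])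
    fix w v assume "w \<in> {u}" "v \<in> exps"
    then show "w + v \<in> M" using M *(1) by (auto simp: upset_def add.commute[of u v])
  qed (auto intro: span_base)
  moreover have "f \<otimes> x = mon u \<otimes> (f \<otimes> r)" using * by (simp add: m_lcomm)
  ultimately show "f \<otimes> x \<in> span (pm ` (M \<times> Z))" by simp
qed

section \<open>Bounds for the dimension of \<open>R\<close> modulo the monomials of large
  weight\<close>

lemma finite_below: "(\<And>i. i \<in> {1..d} \<Longrightarrow> \<omega> i > 0) \<Longrightarrow> finite (below \<omega> n)"
  unfolding below_eq by (rule finite_simplex_points)

text \<open>For a combination \<open>e\<close> of basis elements that lies in the ideal,
  \<open>f \<otimes> e\<close> is a combination of basis elements of weight at least
  \<open>n\<close>. By \<open>leading_exponent\<close> some exponent of \<open>e\<close> has weight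
  at least \<open>n - wt \<omega> \<mu>\<close>. The margin is exactly what multiplication by
  \<open>f\<close> costs.\<close>

lemma indep_below:
  "indep (monideal (above \<omega> n)) pm (below \<omega> (n - wt \<omega> \<mu>) \<times> Z)"
  unfolding indep_def
proof (intro ballI notI)
  let ?I = "monideal (above \<omega> n)" and ?A = "below \<omega> (n - wt \<omega> \<mu>)"
  fix s assume s: "s \<in> ?A \<times> Z" and sp: "pm s \<in> span (?I \<union> pm ` (?A \<times> Z - {s}))"
  have Ac: "pm ` (?A \<times> Z - {s}) \<subseteq> carrier R" using pm_closed[OF Z_carrier, of ?A] by blast
  obtain e y where e: "e \<in> span ?I" "y \<in> span (pm ` (?A \<times> Z - {s}))" "pm s = e \<oplus> y"
    using span_UnE[OF sp monideal_carrier Ac] .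
  have eI: "e \<in> ?I" using e(1) ideal_span[OF ideal_monideal] by blast
  have ec: "e \<in> carrier R" using eI monideal_carrier by blast
  have yc: "y \<in> carrier R" using span_carr[OF e(2) Ac] .
  have "pm s \<in> carrier R" using e(3) ec yc by simp
  have "(y \<oplus> e) \<ominus> y = e" by (rule add_minus_cancel[OF yc ec])
  then have e_eq: "e = pm s \<ominus> y" using e(3) ec yc by (simp add: a_comm)
  have "y \<in> span (pm ` (?A \<times> Z))" using e(2) span_mono[of "pm ` (?A \<times> Z - {s})" "pm ` (?A \<times> Z)"] by blast
  moreover have "pm s \<in> span (pm ` (?A \<times> Z))" using s by (intro span_base) blast
  ultimately have e1: "e \<in> span (pm ` (?A \<times> Z))"
    unfolding e_eq using pm_closed[OF Z_carrier] by (intro span_minus)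
  have A: "?A \<subseteq> exps" by (auto simp: below_def)
  have M: "above \<omega> n \<subseteq> exps" by (auto simp: above_def)
  have disj: "?A \<inter> above \<omega> n = {}" by (auto simp: below_def above_def)
  have e2: "e \<notin> span (pm ` (above \<omega> n \<times> Z))"
  proof
    assume "e \<in> span (pm ` (above \<omega> n \<times> Z))"
    moreover have "pm ` (above \<omega> n \<times> Z) \<subseteq> pm ` (exps \<times> Z - {s})" using M disj s by (intro image_mono) auto
    moreover have "pm ` (?A \<times> Z - {s}) \<subseteq> pm ` (exps \<times> Z - {s})" using A by (intro image_mono) auto
    ultimately have "e \<in> span (pm ` (exps \<times> Z - {s}))" "y \<in> span (pm ` (exps \<times> Z - {s}))"
      using span_mono e(2) by blast+
    then have "pm s \<in> span (pm ` (exps \<times> Z - {s}))" unfolding e(3) by (rule span_add)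
    moreover have "s \<in> exps \<times> Z" using s A by auto
    ultimately show False using indepD[OF indep_Z, of s] by simp
  qed
  obtain u0 where u0: "u0 \<in> ?A - above \<omega> n"
    "\<forall>f m. lead f m \<longrightarrow> f \<otimes> e \<in> span (pm ` (above \<omega> n \<times> Z)) \<longrightarrow> m + u0 \<in> above \<omega> n"
    using leading_exponent[OF indep_Z Z_carrier upset_above A e1 e2] by (elim bexE)
  have "\<mu> + u0 \<in> above \<omega> n" using u0(2) lead_f f_monideal[OF upset_above eI] by simp
  then show False using u0(1) by (auto simp: above_def below_def wt_add)
qed

text \<open>The exponents to which division by \<open>f\<close> does not apply. As a difference of
  two counts with the same leading coefficient, their number is negligible against
  \<open>n ^ d\<close>.\<close>

lemma card_below_not_ge:
  assumes "\<And>i. i \<in> {1..d} \<Longrightarrow> \<omega> i > 0"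
  shows "card {u \<in> below \<omega> n. \<not> (\<forall>i. \<mu> i \<le> u i)} =
    card (simplex_points d \<omega> n) - card (simplex_points d \<omega> (n - wt \<omega> \<mu>))"
proof -
  let ?h = "\<lambda>v. \<mu> + v"
  have eq: "{u \<in> below \<omega> n. \<forall>i. \<mu> i \<le> u i} = ?h ` below \<omega> (n - wt \<omega> \<mu>)"
  proof (intro equalityI subsetI)
    fix u assume u: "u \<in> {u \<in> below \<omega> n. \<forall>i. \<mu> i \<le> u i}"
    define v where "v = (\<lambda>i. u i - \<mu> i)"
    have uv: "u = \<mu> + v" using u by (auto simp: v_def fun_eq_iff)
    have "v \<in> exps" using u by (auto simp: v_def exps_def below_def)
    moreover have "wt \<omega> \<mu> + wt \<omega> v < n" using u uv by (simp add: below_def wt_add)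
    ultimately have "v \<in> below \<omega> (n - wt \<omega> \<mu>)" by (simp add: below_def)
    then show "u \<in> ?h ` below \<omega> (n - wt \<omega> \<mu>)" using uv by blast
  next
    fix u assume "u \<in> ?h ` below \<omega> (n - wt \<omega> \<mu>)"
    then obtain v where v: "v \<in> below \<omega> (n - wt \<omega> \<mu>)" "u = \<mu> + v" by blast
    then have "u \<in> exps" by (auto simp: below_def)
    then show "u \<in> {u \<in> below \<omega> n. \<forall>i. \<mu> i \<le> u i}" using v by (auto simp: below_def wt_add)
  qed
  have "inj ?h" by (auto intro: injI)
  then have card: "card {u \<in> below \<omega> n. \<forall>i. \<mu> i \<le> u i} = card (below \<omega> (n - wt \<omega> \<mu>))"
    unfolding eq by (intro card_image) (auto intro: inj_on_subset)
  have "{u \<in> below \<omega> n. \<not> (\<forall>i. \<mu> i \<le> u i)} = below \<omega> n - {u \<in> below \<omega> n. \<forall>i. \<mu> i \<le> u i}" by auto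
  then show ?thesis using card finite_below[OF assms] by (simp add: card_Diff_subset below_eq)
qed

text \<open>Division by \<open>f\<close>: for an exponent \<open>v + \<mu>\<close>, the product
  \<open>mon v \<otimes> (f \<otimes> y)\<close> lies in the free module and equals the given term
  plus terms of larger key. Hence the basis elements below \<open>n\<close> suffice, together with
  the multiples of \<open>Y\<close> by exponents that do not dominate \<open>\<mu>\<close>.\<close>

lemma spanning_below:
  assumes \<omega>: "\<And>i. i \<in> {1..d} \<Longrightarrow> \<omega> i > 0"
  shows "\<exists>W. finite W \<and> W \<subseteq> carrier R \<and> carrier R \<subseteq> span (monideal (above \<omega> n) \<union> W) \<and>
    card W \<le> card (simplex_points d \<omega> n) * card Z +
      (card (simplex_points d \<omega> n) - card (simplex_points d \<omega> (n - wt \<omega> \<mu>))) * card Y"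
proof -
  let ?I = "monideal (above \<omega> n)"
  let ?B = "{u \<in> below \<omega> n. \<not> (\<forall>i. \<mu> i \<le> u i)}"
  define W where "W = pm ` (below \<omega> n \<times> Z) \<union> pm ` (?B \<times> Y)"
  have fin: "finite (below \<omega> n)" "finite ?B" using finite_below[OF \<omega>] by auto
  have "finite W" unfolding W_def using fin finite_Z finite_Y by auto
  moreover have Wc: "W \<subseteq> carrier R" unfolding W_def using pm_closed[OF Z_carrier] pm_closed[OF Y_carrier] by blast
  moreover have "card W \<le> card (simplex_points d \<omega> n) * card Z +
      (card (simplex_points d \<omega> n) - card (simplex_points d \<omega> (n - wt \<omega> \<mu>))) * card Y"
  proof -
    have "card W \<le> card (pm ` (below \<omega> n \<times> Z)) + card (pm ` (?B \<times> Y))"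
      unfolding W_def by (rule card_Un_le)
    also have "\<dots> \<le> card (below \<omega> n \<times> Z) + card (?B \<times> Y)"
      using fin finite_Z finite_Y by (intro add_mono card_image_le) auto
    also have "\<dots> = card (below \<omega> n) * card Z + card ?B * card Y" by (simp add: card_cartesian_product)
    also have "card ?B = card (simplex_points d \<omega> n) - card (simplex_points d \<omega> (n - wt \<omega> \<mu>))"
      by (rule card_below_not_ge[OF \<omega>])
    finally show ?thesis by (simp only: below_eq)
  qed
  moreover have "carrier R \<subseteq> span (?I \<union> W)"
  proof -
    let ?V = "?I \<union> W"
    have Vc: "?V \<subseteq> carrier R" using Wc monideal_carrier by blast
    have inI: "pm (u, y) \<in> span ?V" if "u \<in> above \<omega> n" "y \<in> carrier R" for u y
      using mon_in_monideal[OF that] by (auto simp: pm_def intro: span_base)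
    have ab: "u \<in> above \<omega> n \<or> u \<in> below \<omega> n" if "u \<in> exps" for u
      using that by (auto simp: above_def below_def)
    have Zsub: "span (pm ` (exps \<times> Z)) \<subseteq> span ?V"
    proof (rule span_least, rule subsetI)
      fix x assume "x \<in> pm ` (exps \<times> Z)"
      then obtain u y where *: "u \<in> exps" "y \<in> Z" "x = pm (u, y)" by auto
      show "x \<in> span ?V"
      proof (cases "u \<in> above \<omega> n")
        case True
        then show ?thesis using inI * Z_carrier by blast
      next
        case False
        then have "x \<in> W" using ab * by (auto simp: W_def)
        then show ?thesis by (auto intro: span_base)
      qed
    qed
    obtain B where B: "\<And>u. u \<in> below \<omega> n \<Longrightarrow> key u \<le> B"
      using fin(1) by (metis Max_ge finite_imageI imageI)
    \<comment> \<open>Larger keys come first. Exponents outside \<open>below \<omega> n\<close> give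
      elements of the ideal, and on \<open>below \<omega> n\<close> the keys are at most
      \<open>B\<close>; with \<open>Suc B\<close> the truncated difference decreases strictly even
      at \<open>key u = B\<close>.\<close>
    have main: "pm (u, y) \<in> span ?V" if "u \<in> exps" "y \<in> Y" for u y
      using that(1)
    proof (induction "Suc B - key u" arbitrary: u rule: less_induct)
      case less
      have yc: "y \<in> carrier R" using that(2) Y_carrier by blast
      consider "u \<in> above \<omega> n" | "u \<in> ?B" | "u \<in> below \<omega> n" "\<forall>i. \<mu> i \<le> u i" using ab less.prems by blast
      then show ?case
      proof cases
        case 1
        then show ?thesis using inI yc by blast
      next
        case 2
        then have "pm (u, y) \<in> W" unfolding W_def using that(2) by blast
        then show ?thesis by (auto intro: span_base)
      next
        case 3
        define v where "v = (\<lambda>i. u i - \<mu> i)"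
        have uv: "u = v + \<mu>" using 3 by (auto simp: v_def fun_eq_iff)
        have vexp: "v \<in> exps" using less.prems by (auto simp: v_def exps_def)
        obtain g where g: "g \<in> span (mon ` {u \<in> exps. key u > key \<mu>})" "g \<in> carrier R" "f = mon \<mu> \<oplus> g"
          using leadE[OF lead_f] .
        have "mon v \<otimes> (f \<otimes> y) \<in> span (pm ` (exps \<times> Z))"
          by (rule mon_mult_pm_span[where A = "{v}", OF _ f_mult[OF yc] Z_carrier])
            (use vexp in \<open>auto intro: span_base\<close>)
        then have 1: "mon v \<otimes> (f \<otimes> y) \<in> span ?V" using Zsub by blast
        have "(mon v \<otimes> y) \<otimes> g \<in> span ?V"
        proof (rule span_mult_in[OF g(1) _ mon_image_carrier])
          fix x assume "x \<in> mon ` {u \<in> exps. key u > key \<mu>}"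
          then obtain w where w: "w \<in> exps" "key w > key \<mu>" "x = mon w" by blast
          have "key (w + v) > key (\<mu> + v)" using key_add_less[OF w(2), of v v] by simp
          then have "key (v + w) > key u" unfolding uv by (simp add: add.commute)
          moreover have "key u \<le> B" using B 3 by blast
          ultimately have "pm (v + w, y) \<in> span ?V" using vexp w(1) by (intro less.hyps) auto
          moreover have "mon v \<otimes> y \<otimes> x = pm (v + w, y)" using w yc by (simp add: pm_def mon_add m_ac)
          ultimately show "mon v \<otimes> y \<otimes> x \<in> span ?V" by simp
        qed (use yc in simp)
        then have "mon v \<otimes> (f \<otimes> y) \<ominus> (mon v \<otimes> y) \<otimes> g \<in> span ?V" using 1 Vc by (intro span_minus)
        moreover have "mon v \<otimes> (f \<otimes> y) = (mon v \<otimes> y) \<otimes> g \<oplus> pm (u, y)"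
          unfolding uv g(3) using g(2) yc by (simp add: pm_def mon_add l_distr r_distr m_ac a_comm)
        then have "mon v \<otimes> (f \<otimes> y) \<ominus> (mon v \<otimes> y) \<otimes> g = pm (u, y)"
          using add_minus_cancel[of "(mon v \<otimes> y) \<otimes> g" "pm (u, y)"] g(2) yc by (simp add: pm_def)
        ultimately show ?thesis by simp
      qed
    qed
    show ?thesis unfolding carrier_span
    proof (rule span_least, rule subsetI)
      fix x assume "x \<in> pm ` (exps \<times> Y)"
      then obtain u y where "u \<in> exps" "y \<in> Y" "x = pm (u, y)" by auto
      then show "x \<in> span ?V" using main by blast
    qed
  qed
  ultimately show ?thesis by blast
qed

end

section \<open>Finite generation over the parameters\<close>

context graded_algebra
begin

text \<open>Products of generators with homogeneous elements span an ideal, and the degree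
  \<open>n\<close> part of that span involves only products of degree \<open>n\<close>. The
  generators are paired with degrees because zero lies in every component.\<close>

lemma Idl_degree:
  assumes S': "\<forall>e k. (e, k) \<in> S \<longrightarrow> e \<in> G k" and x: "x \<in> G n" "x \<in> Idl (fst ` S)"
  shows "x \<in> span {e \<otimes> r | e k r m. (e, k) \<in> S \<and> r \<in> G m \<and> k + m = n}"
proof -
  have S: "e \<in> G k" if "(e, k) \<in> S" for e k using S' that by blast
  define E where "E n = {e \<otimes> r | e k r m. (e, k) \<in> S \<and> r \<in> G m \<and> k + m = n}" for n
  have EG: "E n \<subseteq> G n" for n using S component_mult by (auto simp: E_def)
  then have Ec: "(\<Union>n. E n) \<subseteq> carrier R" using G_carrier by blast
  have "ideal (span (\<Union>n. E n)) R"
  proof (rule ideal_spanI[OF Ec])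
    fix l s y assume s: "s \<in> G l" and "y \<in> (\<Union>n. E n)"
    then obtain e k r m where *: "(e, k) \<in> S" "r \<in> G m" "y = e \<otimes> r" by (auto simp: E_def)
    have "e \<in> carrier R" "r \<in> carrier R" "s \<in> carrier R"
      using G_carr[OF S[OF *(1)]] G_carr[OF *(2)] G_carr[OF s] .
    then have "s \<otimes> y = e \<otimes> (s \<otimes> r)" unfolding *(3) by (simp add: m_lcomm)
    moreover have "s \<otimes> r \<in> G (l + m)" using s * component_mult by blast
    ultimately have "s \<otimes> y \<in> E (k + (l + m))" using * unfolding E_def by blast
    then show "s \<otimes> y \<in> span (\<Union>n. E n)" by (intro span_base) blast
  qed
  moreover have "fst ` S \<subseteq> span (\<Union>n. E n)"
  proof
    fix e assume "e \<in> fst ` S"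
    then obtain k where k: "(e, k) \<in> S" by auto
    then have "e \<otimes> \<one> \<in> E (k + 0)" using K_one unfolding E_def by blast
    then have "e \<in> E k" using G_carr[OF S[OF k]] by simp
    then show "e \<in> span (\<Union>n. E n)" by (intro span_base) blast
  qed
  ultimately have "x \<in> span (\<Union>n. E n)" using genideal_minimal x(2) by blast
  then show ?thesis using span_degree[OF x(1) _ EG] by (simp add: E_def)
qed

lemma irrelevant_generators:
  assumes "noetherian_ring R"
  obtains H where "finite H" "\<And>e k. (e, k) \<in> H \<Longrightarrow> e \<in> G k \<and> k > 0" "gr_ge 1 = Idl (fst ` H)"
proof -
  obtain A where A: "A \<subseteq> carrier R" "finite A" "gr_ge 1 = Idl A"
    using noetherian_ring.finetely_gen[OF assms ideal_gr_ge] by blast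
  have "A \<subseteq> gr_ge 1" using A genideal_self by blast
  have "\<exists>S. finite S \<and> S \<subseteq> (\<Union>m\<in>{1..}. G m) \<and> x \<in> span S" if "x \<in> A" for x
  proof -
    have "x \<in> span (\<Union>m\<in>{1..}. G m)" using that \<open>A \<subseteq> gr_ge 1\<close> by (auto simp: gr_ge_def)
    then obtain S where "finite S" "S \<subseteq> (\<Union>m\<in>{1..}. G m)" "x \<in> span S" by (rule span_finite_subset)
    then show ?thesis by (intro exI[of _ S] conjI)
  qed
  then obtain S where S: "\<And>x. x \<in> A \<Longrightarrow> finite (S x)" "\<And>x. x \<in> A \<Longrightarrow> S x \<subseteq> (\<Union>m\<in>{1..}. G m)"
    "\<And>x. x \<in> A \<Longrightarrow> x \<in> span (S x)" by metis
  define T where "T = (\<Union>x\<in>A. S x)"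
  have T: "finite T" "T \<subseteq> (\<Union>m\<in>{1..}. G m)" using A(2) S(1,2) by (auto simp: T_def)
  then have Tc: "T \<subseteq> carrier R" using UN_G_carrier by blast
  have "\<exists>k. e \<in> G k \<and> k > 0" if e: "e \<in> T" for e
  proof -
    obtain k where "k \<in> {1..}" "e \<in> G k" using T(2) e by blast
    then show ?thesis by (intro exI[of _ k]) auto
  qed
  then obtain dg where dg: "\<And>e. e \<in> T \<Longrightarrow> e \<in> G (dg e) \<and> dg e > 0" by metis
  define H where "H = (\<lambda>e. (e, dg e)) ` T"
  have fH: "fst ` H = T" by (force simp: H_def)
  have "A \<subseteq> Idl T"
  proof
    fix x assume x: "x \<in> A"
    have "S x \<subseteq> Idl T" using x genideal_self[OF Tc] by (auto simp: T_def)
    from span_mono[OF this] have "span (S x) \<subseteq> Idl T" unfolding ideal_span[OF genideal_ideal[OF Tc]] .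
    then show "x \<in> Idl T" using S(3)[OF x] by blast
  qed
  then have "Idl A \<subseteq> Idl T" using genideal_minimal genideal_ideal[OF Tc] by blast
  moreover have "T \<subseteq> gr_ge 1" unfolding gr_ge_def using T(2) span_superset by blast
  then have "Idl T \<subseteq> gr_ge 1" using genideal_minimal ideal_gr_ge by blast
  ultimately have "gr_ge 1 = Idl (fst ` H)" using A(3) fH by simp
  moreover have "finite H" using T(1) by (simp add: H_def)
  moreover have "e \<in> G k \<and> k > 0" if "(e, k) \<in> H" for e k using that dg by (auto simp: H_def)
  ultimately show thesis using that by blast
qed

text \<open>In positive degree every element is a combination of products of a generator with an
  element of smaller degree, so finite spanning sets propagate upwards from
  \<open>{\<one>}\<close>.\<close>

lemma finite_dim:
  assumes H: "finite H" "\<And>e k. (e, k) \<in> H \<Longrightarrow> e \<in> G k \<and> k > 0" "gr_ge 1 = Idl (fst ` H)"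
  shows "\<exists>E. finite E \<and> E \<subseteq> G n \<and> G n \<subseteq> span E"
proof (induction n rule: less_induct)
  case (less n)
  show ?case
  proof (cases "n = 0")
    case True
    have "c \<in> span {\<one>}" if "c \<in> G 0" for c
      using span_smult[OF that span_base[of \<one> "{\<one>}"]] that by simp
    then show ?thesis using True K_one by (intro exI[of _ "{\<one>}"]) auto
  next
    case False
    obtain E where E: "\<And>m. m < n \<Longrightarrow> finite (E m) \<and> E m \<subseteq> G m \<and> G m \<subseteq> span (E m)"
      using less by metis
    define F where "F = (\<Union>(e, k)\<in>{s\<in>H. snd s \<le> n}. (\<lambda>r. e \<otimes> r) ` E (n - k))"
    have lt: "n - k < n" if "(e, k) \<in> H" for e k using H(2)[OF that] False by simp
    have "finite F" unfolding F_def using H(1) E lt by auto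
    moreover have FG: "F \<subseteq> G n"
    proof
      fix x assume "x \<in> F"
      then obtain e k r where *: "(e, k) \<in> H" "k \<le> n" "r \<in> E (n - k)" "x = e \<otimes> r" by (auto simp: F_def)
      have "r \<in> G (n - k)" using E[OF lt[OF *(1)]] *(3) by blast
      then have "x \<in> G (k + (n - k))" unfolding *(4) using H(2)[OF *(1)] component_mult by blast
      then show "x \<in> G n" using *(2) by simp
    qed
    moreover have "G n \<subseteq> span F"
    proof
      fix x assume x: "x \<in> G n"
      then have "x \<in> Idl (fst ` H)" using G_gr_ge[of 1 n] False H(3) by auto
      then have "x \<in> span {e \<otimes> r | e k r m. (e, k) \<in> H \<and> r \<in> G m \<and> k + m = n}"
        by (rule Idl_degree[OF _ x, rotated]) (use H(2) in blast)
      moreover have "{e \<otimes> r | e k r m. (e, k) \<in> H \<and> r \<in> G m \<and> k + m = n} \<subseteq> span F"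
      proof
        fix w assume "w \<in> {e \<otimes> r | e k r m. (e, k) \<in> H \<and> r \<in> G m \<and> k + m = n}"
        then obtain e k r m where *: "(e, k) \<in> H" "r \<in> G m" "k + m = n" "w = e \<otimes> r" by blast
        have m: "m = n - k" using * by simp
        have r: "r \<in> span (E m)" using E[OF lt[OF *(1)]] *(2) m by blast
        have Em: "E m \<subseteq> carrier R" using E[OF lt[OF *(1)]] m G_carrier by blast
        show "w \<in> span F" unfolding *(4)
        proof (rule span_mult_in[OF r _ Em])
          show "e \<in> carrier R" using H(2)[OF *(1)] G_carr by blast
          fix y assume "y \<in> E m"
          then have "e \<otimes> y \<in> (\<lambda>r. e \<otimes> r) ` E (n - k)" using m by blast
          moreover have "(e, k) \<in> {s \<in> H. snd s \<le> n}" using *(1,3) by auto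
          ultimately have "e \<otimes> y \<in> F" unfolding F_def by blast
          then show "e \<otimes> y \<in> span F" by (rule span_base)
        qed
      qed
      ultimately show "x \<in> span F" using span_least by blast
    qed
    ultimately show ?thesis by blast
  qed
qed

lemma nilpotent_degrees:
  assumes H: "finite H" "\<And>e k. (e, k) \<in> H \<Longrightarrow> e \<in> G k \<and> k > 0" "gr_ge 1 = Idl (fst ` H)"
    and P: "\<And>e k. (e, k) \<in> P \<Longrightarrow> e \<in> G k"
    and rad: "\<And>h k. (h, k) \<in> H \<Longrightarrow> \<exists>j::nat. h [^] j \<in> Idl (fst ` P)"
  shows "\<exists>D. \<forall>n\<ge>D. G n \<subseteq> Idl (fst ` P)"
proof -
  have Pc: "fst ` P \<subseteq> carrier R" using P G_carr by force
  have Hc: "fst ` H \<subseteq> carrier R" using H(2) G_carr by force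
  have "\<exists>D. \<forall>n\<ge>D. G n \<subseteq> Idl (fst ` (P \<union> (H - S)))" if "S \<subseteq> H" for S
  proof -
    have "finite S" using that H(1) finite_subset by blast
    then show ?thesis using that
    proof (induction S rule: finite_induct)
      case empty
      have c: "fst ` (P \<union> (H - {})) \<subseteq> carrier R" using Pc Hc by auto
      have "fst ` H \<subseteq> Idl (fst ` (P \<union> (H - {})))" using genideal_self[OF c] by (auto simp: image_Un)
      then have "gr_ge 1 \<subseteq> Idl (fst ` (P \<union> (H - {})))"
        unfolding H(3) using genideal_minimal[OF genideal_ideal[OF c]] by blast
      then show ?case using G_gr_ge[of 1] by (intro exI[of _ 1]) blast
    next
      case (insert s S)
      obtain h k where hk: "s = (h, k)" by (cases s)
      have hH: "(h, k) \<in> H" using insert.prems hk by simp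
      have hc: "h \<in> carrier R" using H(2)[OF hH] G_carr by blast
      obtain D where D: "\<And>n. n \<ge> D \<Longrightarrow> G n \<subseteq> Idl (fst ` (P \<union> (H - S)))"
        using insert.IH insert.prems by auto
      let ?E = "P \<union> (H - insert s S)"
      have Ec: "fst ` ?E \<subseteq> carrier R" using Pc Hc by auto
      define B where "B = Idl (fst ` ?E)"
      interpret B: ideal B R unfolding B_def by (rule genideal_ideal[OF Ec])
      have EG: "e \<in> G l" if "(e, l) \<in> insert (h, k) ?E" for e l using that P H(2) hH by auto
      have HS: "P \<union> (H - S) = insert (h, k) ?E" using insert.hyps hk hH by auto
      have step: "x \<in> span {e \<otimes> r | e l r m. (e, l) \<in> insert (h, k) ?E \<and> r \<in> G m \<and> l + m = n}"
        if "x \<in> G n" "n \<ge> D" for x n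
      proof -
        have "x \<in> Idl (fst ` insert (h, k) ?E)" using D[OF that(2)] that(1) HS by auto
        then show ?thesis by (rule Idl_degree[OF _ that(1), rotated]) (use EG in blast)
      qed
      \<comment> \<open>Modulo the other generators one more factor \<open>h\<close> is extracted at
        a time. The cofactor loses degree \<open>k\<close>, so starting at \<open>D + j * k\<close>
        this can be repeated \<open>j\<close> times.\<close>
      have main: "\<forall>n x. n \<ge> D + j * k \<longrightarrow> x \<in> G n \<longrightarrow> (\<exists>b\<in>B. \<exists>r\<in>carrier R. x = b \<oplus> h [^] j \<otimes> r)" for j :: nat
      proof (induction j)
        case 0
        show ?case
        proof (intro allI impI)
          fix n x assume "x \<in> G n"
          then have "x \<in> carrier R" by (rule G_carr)
          then have "x = \<zero> \<oplus> h [^] (0::nat) \<otimes> x" using hc by simp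
          then show "\<exists>b\<in>B. \<exists>r\<in>carrier R. x = b \<oplus> h [^] (0::nat) \<otimes> r"
            using B.zero_closed \<open>x \<in> carrier R\<close> by blast
        qed
      next
        case (Suc j)
        show ?case
        proof (intro allI impI)
          fix n x assume n: "D + Suc j * k \<le> n" and x: "x \<in> G n"
          let ?V = "{b \<oplus> h [^] Suc j \<otimes> r | b r. b \<in> B \<and> r \<in> carrier R}"
          have BV: "b \<in> ?V" if "b \<in> B" for b
          proof -
            have "b = b \<oplus> h [^] Suc j \<otimes> \<zero>" using B.Icarr[OF that] hc by simp
            then show ?thesis using that by blast
          qed
          have "span {e \<otimes> r | e l r m. (e, l) \<in> insert (h, k) ?E \<and> r \<in> G m \<and> l + m = n} \<subseteq> ?V"
          proof (rule span_subsetI)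
            show "{e \<otimes> r | e l r m. (e, l) \<in> insert (h, k) ?E \<and> r \<in> G m \<and> l + m = n} \<subseteq> ?V"
            proof
              fix w assume "w \<in> {e \<otimes> r | e l r m. (e, l) \<in> insert (h, k) ?E \<and> r \<in> G m \<and> l + m = n}"
              then obtain e l r m where *: "(e, l) \<in> insert (h, k) ?E" "r \<in> G m" "l + m = n" "w = e \<otimes> r" by blast
              show "w \<in> ?V"
              proof (cases "(e, l) \<in> ?E")
                case True
                then have "e \<in> B" unfolding B_def using genideal_self[OF Ec] by force
                then have "w \<in> B" unfolding *(4) using *(2) G_carr B.I_r_closed by blast
                then show ?thesis by (rule BV)
              next
                case False
                then have eh: "e = h" "l = k" using *(1) by auto
                have "m \<ge> D + j * k" using n *(3) eh by simp
                then obtain b r' where br: "b \<in> B" "r' \<in> carrier R" "r = b \<oplus> h [^] j \<otimes> r'"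
                  using Suc.IH *(2) by blast
                have bc: "b \<in> carrier R" using br B.Icarr by blast
                have "w = h \<otimes> b \<oplus> h [^] Suc j \<otimes> r'"
                  unfolding *(4) br(3) eh(1) using hc bc br(2) by (simp add: r_distr m_ac)
                moreover have "h \<otimes> b \<in> B" using br(1) hc B.I_l_closed by blast
                ultimately show ?thesis using br(2) by blast
              qed
            qed
            show "\<zero> \<in> ?V" using BV B.zero_closed by blast
          next
            fix u v assume "u \<in> ?V" "v \<in> ?V"
            then obtain b r b' r' where *: "b \<in> B" "r \<in> carrier R" "u = b \<oplus> h [^] Suc j \<otimes> r"
              "b' \<in> B" "r' \<in> carrier R" "v = b' \<oplus> h [^] Suc j \<otimes> r'" by blast
            have bc: "b \<in> carrier R" "b' \<in> carrier R" "h [^] Suc j \<in> carrier R" using * B.Icarr hc by auto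
            have "u \<oplus> v = (b \<oplus> b') \<oplus> h [^] Suc j \<otimes> (r \<oplus> r')"
              unfolding *(3,6) using bc *(2,5) by (simp add: r_distr a_ac del: nat_pow_Suc)
            then show "u \<oplus> v \<in> ?V" using * B.a_closed by blast
          next
            fix c u assume c: "c \<in> G 0" and "u \<in> ?V"
            then obtain b r where *: "b \<in> B" "r \<in> carrier R" "u = b \<oplus> h [^] Suc j \<otimes> r" by blast
            have bc: "b \<in> carrier R" "h [^] Suc j \<in> carrier R" "c \<in> carrier R" using * B.Icarr hc c by auto
            have "c \<otimes> u = c \<otimes> b \<oplus> h [^] Suc j \<otimes> (c \<otimes> r)"
              unfolding *(3) using bc *(2) by (simp add: r_distr m_ac del: nat_pow_Suc)
            moreover have "c \<otimes> b \<in> B" using * bc B.I_l_closed by blast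
            ultimately show "c \<otimes> u \<in> ?V" using *(2) bc(3) by blast
          qed
          then have "x \<in> ?V" using step[OF x] n by auto
          then show "\<exists>b\<in>B. \<exists>r\<in>carrier R. x = b \<oplus> h [^] Suc j \<otimes> r" by blast
        qed
      qed
      obtain j :: nat where "h [^] j \<in> Idl (fst ` P)" using rad[OF hH] by blast
      moreover have "Idl (fst ` P) \<subseteq> B" unfolding B_def by (rule subset_Idl_subset[OF Ec]) auto
      ultimately have hj: "h [^] j \<in> B" by blast
      have "G n \<subseteq> B" if n: "n \<ge> D + j * k" for n
      proof
        fix x assume "x \<in> G n"
        then obtain b r where "b \<in> B" "r \<in> carrier R" "x = b \<oplus> h [^] j \<otimes> r" using main n by blast
        then show "x \<in> B" using hj B.I_r_closed B.a_closed by blast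
      qed
      then show ?case unfolding B_def by blast
    qed
  qed
  from this[of H] show ?thesis by simp
qed

end

section \<open>Finiteness of a graded ring over a homogeneous system of parameters\<close>

context monomials
begin

definition unit_exp :: "nat \<Rightarrow> nat \<Rightarrow> nat" where
  "unit_exp i = (\<lambda>j. if j = i then 1 else 0)"

lemma unit_exp_exps: "i \<in> {1..d} \<Longrightarrow> unit_exp i \<in> exps"
  by (auto simp: unit_exp_def exps_def)

lemma mon_unit_exp: assumes "i \<in> {1..d}" shows "mon (unit_exp i) = z i"
proof -
  have "mon (unit_exp i) = (\<Otimes>j\<in>{1..d}. if j = i then z j else \<one>)"
    unfolding mon_def by (rule finprod_cong') (use z_closed in \<open>auto simp: unit_exp_def\<close>)
  also have "\<dots> = z i" by (rule finprod_singleton_swap) (use assms z_closed in auto)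
  finally show ?thesis .
qed

lemma wt_unit_exp: assumes "i \<in> {1..d}" shows "wt \<omega> (unit_exp i) = \<omega> i"
proof -
  have "wt \<omega> (unit_exp i) = (\<Sum>j\<in>{1..d}. if j = i then \<omega> j else 0)"
    unfolding wt_def by (rule sum.cong) (auto simp: unit_exp_def)
  then show ?thesis using assms by simp
qed

text \<open>From degree \<open>D\<close> on, everything lies in the ideal of the parameters and can
  be written with cofactors of smaller degree. Descent ends below \<open>D\<close>, so finitely many
  elements of those degrees generate the module, and \<open>D\<close> also serves as the bound
  \<open>C\<close> for their degrees.\<close>

theorem parameters_exist:
  assumes noeth: "noetherian_ring R"
    and a_pos: "\<And>i. i \<in> {1..d} \<Longrightarrow> a i > 0" and z_deg: "\<And>i. i \<in> {1..d} \<Longrightarrow> z i \<in> G (a i)"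
    and rad: "radical R (Idl (z ` {1..d})) = irrelevant_ideal R G"
  shows "\<exists>Y Z C f \<mu>. parameters R G d z a Y Z C f \<mu>"
proof (rule irrelevant_generators[OF noeth])
  fix H :: "('a \<times> nat) set"
  assume H: "finite H" "\<And>e k. (e, k) \<in> H \<Longrightarrow> e \<in> G k \<and> k > 0" "gr_ge 1 = Idl (fst ` H)"
  define P where "P = (\<lambda>i. (z i, a i)) ` {1..d}"
  have fP: "fst ` P = z ` {1..d}" by (force simp: P_def)
  have PG: "e \<in> G k" if "(e, k) \<in> P" for e k using that z_deg by (auto simp: P_def)
  have "\<exists>j::nat. h [^] j \<in> Idl (fst ` P)" if "(h, k) \<in> H" for h k
  proof -
    have "G k \<subseteq> gr_ge 1" using H(2)[OF that] by (intro G_gr_ge) simp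
    then have "h \<in> irrelevant_ideal R G" using H(2)[OF that] irrelevant_ideal_eq by blast
    then show ?thesis unfolding rad[symmetric] fP by (simp add: radical_def)
  qed
  then obtain D where D: "\<And>n. n \<ge> D \<Longrightarrow> G n \<subseteq> Idl (z ` {1..d})"
    using nilpotent_degrees[OF H PG] fP by metis
  obtain E where E: "\<And>n. finite (E n)" "\<And>n. E n \<subseteq> G n" "\<And>n. G n \<subseteq> span (E n)"
    using finite_dim[OF H] by metis
  define Y where "Y = (\<Union>n\<in>{..<D}. E n)"
  have Y: "finite Y" "Y \<subseteq> (\<Union>m\<in>{..D}. G m)"
  proof -
    show "finite Y" using E(1) by (simp add: Y_def)
    have "E n \<subseteq> (\<Union>m\<in>{..D}. G m)" if "n < D" for n using E(2)[of n] that by fastforce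
    then show "Y \<subseteq> (\<Union>m\<in>{..D}. G m)" unfolding Y_def by blast
  qed
  have Yc: "Y \<subseteq> carrier R" using Y(2) UN_G_carrier by blast
  have span_pm: "G n \<subseteq> span (pm ` ({u \<in> exps. wt a u \<le> n \<and> n \<le> wt a u + D} \<times> Y))" for n
  proof (induction n rule: less_induct)
    case (less n)
    let ?T = "\<lambda>n. pm ` ({u \<in> exps. wt a u \<le> n \<and> n \<le> wt a u + D} \<times> Y)"
    show ?case
    proof (cases "n < D")
      case True
      have "E n \<subseteq> ?T n"
      proof
        fix x assume x: "x \<in> E n"
        have "wt a 0 = 0" by (simp add: wt_def)
        then have "(0, x) \<in> {u \<in> exps. wt a u \<le> n \<and> n \<le> wt a u + D} \<times> Y"
          using x True by (auto simp: Y_def)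
        moreover have "x \<in> carrier R" using x E(2) G_carrier by blast
        then have "x = pm (0, x)" by (simp add: pm_def)
        ultimately show "x \<in> ?T n" by (rule rev_image_eqI)
      qed
      then show ?thesis using span_mono E(3) by blast
    next
      case False
      show ?thesis
      proof
        fix x assume x: "x \<in> G n"
        then have "x \<in> Idl (fst ` P)" using D[of n] False fP by auto
        then have "x \<in> span {e \<otimes> r | e k r m. (e, k) \<in> P \<and> r \<in> G m \<and> k + m = n}"
          by (rule Idl_degree[OF _ x, rotated]) (use PG in blast)
        moreover have "span {e \<otimes> r | e k r m. (e, k) \<in> P \<and> r \<in> G m \<and> k + m = n} \<subseteq> span (?T n)"
        proof (rule span_least, rule subsetI)
          fix w assume "w \<in> {e \<otimes> r | e k r m. (e, k) \<in> P \<and> r \<in> G m \<and> k + m = n}"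
          then obtain i r m where *: "i \<in> {1..d}" "r \<in> G m" "a i + m = n" "w = z i \<otimes> r"
            by (auto simp: P_def)
          have "m < n" using *(3) a_pos[OF *(1)] by simp
          then have r: "r \<in> span (?T m)" using less *(2) by blast
          show "w \<in> span (?T n)" unfolding *(4)
          proof (rule span_mult_in[OF r z_closed[OF *(1)] pm_closed[OF Yc]])
            fix y assume "y \<in> ?T m"
            then obtain u y' where uy: "u \<in> exps" "wt a u \<le> m" "m \<le> wt a u + D" "y' \<in> Y" "y = pm (u, y')" by auto
            have eq: "z i \<otimes> y = pm (unit_exp i + u, y')"
              using mon_pm[of "(u, y')" "unit_exp i"] uy Yc mon_unit_exp[OF *(1)] by auto
            have "(unit_exp i + u, y') \<in> {u \<in> exps. wt a u \<le> n \<and> n \<le> wt a u + D} \<times> Y"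
              using uy *(3) unit_exp_exps[OF *(1)] wt_unit_exp[OF *(1), of a] by (auto simp: wt_add)
            then show "z i \<otimes> y \<in> span (?T n)" unfolding eq by (intro span_base imageI)
          qed
        qed
        ultimately show "x \<in> span (?T n)" by (rule rev_subsetD)
      qed
    qed
  qed
  obtain Z f \<mu> where "Z \<subseteq> Y" "indep {} pm (exps \<times> Z)" "lead f \<mu>" "\<forall>y\<in>Y. f \<otimes> y \<in> span (pm ` (exps \<times> Z))"
    using free_rank[OF Y(1) Yc] by (elim exE conjE)
  then have "parameters R G d z a Y Z D f \<mu>"
    using a_pos z_deg Y span_pm
    by (intro parameters.intro parameters_axioms.intro monomials_axioms) (assumption | blast)+
  then show ?thesis by blast
qed

end

section \<open>Growth of graded algebras\<close>

context graded_algebra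
begin

definition gr_less :: "nat \<Rightarrow> 'a set" where
  "gr_less n = span (\<Union>m\<in>{..<n}. G m)"

lemma gr_less_carrier: "gr_less n \<subseteq> carrier R"
  unfolding gr_less_def by (rule span_closed[OF UN_G_carrier])

lemma gr_less_mono: "m \<le> n \<Longrightarrow> gr_less m \<subseteq> gr_less n"
  unfolding gr_less_def by (intro span_mono UN_mono) auto

lemma gr_less_mult:
  assumes "x \<in> gr_less (Suc m)" "y \<in> gr_less n" shows "x \<otimes> y \<in> gr_less (m + n)"
proof -
  have xc: "x \<in> carrier R" using assms gr_less_carrier by blast
  show ?thesis unfolding gr_less_def
  proof (rule span_mult_in[OF assms(2)[unfolded gr_less_def] xc UN_G_carrier])
    fix v assume "v \<in> (\<Union>m\<in>{..<n}. G m)"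
    then obtain l where l: "l < n" "v \<in> G l" by auto
    have vc: "v \<in> carrier R" using l G_carr by blast
    have "v \<otimes> x \<in> span (\<Union>k\<in>{..<m + n}. G k)"
    proof (rule span_mult_in[OF assms(1)[unfolded gr_less_def] vc UN_G_carrier])
      fix w assume "w \<in> (\<Union>k\<in>{..<Suc m}. G k)"
      then obtain k where k: "k \<le> m" "w \<in> G k" by (auto simp: less_Suc_eq_le)
      then have "v \<otimes> w \<in> G (l + k)" "l + k < m + n" using l component_mult by auto
      then show "v \<otimes> w \<in> span (\<Union>k\<in>{..<m + n}. G k)" by (intro span_base) blast
    qed
    then show "x \<otimes> v \<in> span (\<Union>k\<in>{..<m + n}. G k)" using m_comm[OF xc vc] by simp
  qed
qed

section \<open>Growth forced by a chain of primes\<close>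

lemma carrier_gr_less: assumes "x \<in> carrier R" shows "\<exists>n. x \<in> gr_less n"
proof -
  have "x \<in> span (\<Union>m. G m)" using assms span_all by simp
  then obtain S where S: "finite S" "S \<subseteq> (\<Union>m. G m)" "x \<in> span S" by (rule span_finite_subset)
  then obtain dg where dg: "\<And>s. s \<in> S \<Longrightarrow> s \<in> G (dg s)" by (metis UN_E subsetD)
  obtain n where n: "\<And>s. s \<in> S \<Longrightarrow> dg s < n" using S(1) by (metis finite_imageI finite_nat_set_iff_bounded imageI)
  have "S \<subseteq> (\<Union>m\<in>{..<n}. G m)" using dg n by blast
  then show ?thesis unfolding gr_less_def using span_mono S(3) by blast
qed

lemma indep_union:
  assumes V: "indep U (\<lambda>x. x) V" "V \<subseteq> P" and W: "indep P (\<lambda>x. x) W"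
    and U: "U \<subseteq> P" and P: "span P = P" and c: "P \<subseteq> carrier R" "W \<subseteq> carrier R"
  shows "indep U (\<lambda>x. x) (V \<union> W)" "V \<inter> W = {}"
proof -
  show disj: "V \<inter> W = {}"
  proof (rule ccontr)
    assume "V \<inter> W \<noteq> {}"
    then obtain w where w: "w \<in> V" "w \<in> W" by blast
    then have "w \<in> span (P \<union> (\<lambda>x. x) ` (W - {w}))" using V(2) by (intro span_base) auto
    then show False using indepD[OF W w(2)] by blast
  qed
  show "indep U (\<lambda>x. x) (V \<union> W)"
    unfolding indep_def
  proof (intro ballI notI)
    fix s assume s: "s \<in> V \<union> W" and sp: "s \<in> span (U \<union> (\<lambda>x. x) ` (V \<union> W - {s}))"
    show False
    proof (cases "s \<in> W")
      case True
      have "U \<union> (\<lambda>x. x) ` (V \<union> W - {s}) \<subseteq> P \<union> (\<lambda>x. x) ` (W - {s})" using U V(2) by auto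
      from span_mono[OF this] sp indepD[OF W True] show False by blast
    next
      case False
      then have sV: "s \<in> V" using s by simp
      text \<open>A relation involving some \<open>w \<in> W\<close> would express \<open>w\<close> modulo \<open>P\<close> by the rest of \<open>W\<close>.\<close>
      obtain T where T: "finite T" "T \<subseteq> U \<union> (V \<union> W - {s})" "s \<in> span T"
        using span_finite_subset[OF sp[unfolded image_ident]] .
      define Q where "Q S \<longleftrightarrow> finite S \<and> S \<subseteq> W \<and> s \<in> span (U \<union> (V - {s}) \<union> S)" for S
      have "T \<subseteq> U \<union> (V - {s}) \<union> (T \<inter> W)" using T(2) by blast
      from span_mono[OF this] have "Q (T \<inter> W)" unfolding Q_def using T by blast
      then obtain S where S: "Q S" "\<And>S'. Q S' \<Longrightarrow> card S \<le> card S'"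
        using arg_min_nat_lemma[of Q _ card] by metis
      have Sf: "finite S" "S \<subseteq> W" "s \<in> span (U \<union> (V - {s}) \<union> S)" using S(1) by (auto simp: Q_def)
      show False
      proof (cases "S = {}")
        case True
        then have "s \<in> span (U \<union> (\<lambda>x. x) ` (V - {s}))" using Sf by simp
        then show False using indepD[OF V(1) sV] by blast
      next
        case False
        then obtain w where w: "w \<in> S" by blast
        let ?B = "U \<union> (V - {s}) \<union> (S - {w})"
        have "s \<notin> span ?B"
        proof
          assume "s \<in> span ?B"
          then have "Q (S - {w})" using Sf by (auto simp: Q_def)
          then have "card S \<le> card (S - {w})" by (rule S(2))
          then show False using card_Diff1_less[OF Sf(1) w] by simp
        qed
        moreover have "insert w ?B = U \<union> (V - {s}) \<union> S" using w by auto
        moreover have "?B \<subseteq> carrier R" "w \<in> carrier R" using U V(2) c Sf(2) w by auto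
        ultimately have "w \<in> span (insert s ?B)" using span_exchange[of s w ?B] Sf(3) by simp
        moreover have "insert s ?B \<subseteq> P \<union> (\<lambda>x. x) ` (W - {w})" using sV V(2) U Sf(2) by auto
        ultimately have "w \<in> span (P \<union> (\<lambda>x. x) ` (W - {w}))" using span_mono by blast
        moreover have "w \<in> W" using w Sf(2) by blast
        ultimately show False using indepD[OF W] by blast
      qed
    qed
  qed
qed

text \<open>Multiplication by \<open>g\<close> is injective on the domain \<open>R / P\<close>, so a
  linear relation between multiples of \<open>g\<close> can be divided by \<open>g\<close>.\<close>

lemma prime_cancel_span:
  assumes P: "primeideal P R" and g: "g \<in> carrier R" "g \<notin> P" and E: "E \<subseteq> carrier R" and x: "x \<in> carrier R"
    and sp: "g \<otimes> x \<in> span (P \<union> (\<lambda>e. g \<otimes> e) ` E)"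
  shows "x \<in> span (P \<union> E)"
proof -
  interpret P: primeideal P R by fact
  have Pc: "P \<subseteq> carrier R" by (rule P.a_subset)
  obtain p y where py: "p \<in> span P" "y \<in> span ((\<lambda>e. g \<otimes> e) ` E)" "g \<otimes> x = p \<oplus> y"
    using span_UnE[OF sp Pc] E g by blast
  have pP: "p \<in> P" using py(1) ideal_span[OF P.is_ideal] by simp
  have "y \<in> (\<lambda>e. g \<otimes> e) ` span E"
  proof -
    have "span ((\<lambda>e. g \<otimes> e) ` E) \<subseteq> (\<lambda>e. g \<otimes> e) ` span E"
    proof (rule span_subsetI)
      show "(\<lambda>e. g \<otimes> e) ` E \<subseteq> (\<lambda>e. g \<otimes> e) ` span E" using span_superset by blast
      show "\<zero> \<in> (\<lambda>e. g \<otimes> e) ` span E" using g(1) span_zero by (metis image_eqI r_null)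
    next
      fix u v assume "u \<in> (\<lambda>e. g \<otimes> e) ` span E" "v \<in> (\<lambda>e. g \<otimes> e) ` span E"
      then obtain s t where "s \<in> span E" "t \<in> span E" "u = g \<otimes> s" "v = g \<otimes> t" by blast
      then have "u \<oplus> v = g \<otimes> (s \<oplus> t)" "s \<oplus> t \<in> span E"
        using g(1) span_carr[OF _ E] by (auto simp: r_distr intro: span_add)
      then show "u \<oplus> v \<in> (\<lambda>e. g \<otimes> e) ` span E" by blast
    next
      fix c u assume c: "c \<in> G 0" and "u \<in> (\<lambda>e. g \<otimes> e) ` span E"
      then obtain s where "s \<in> span E" "u = g \<otimes> s" by blast
      then have "c \<otimes> u = g \<otimes> (c \<otimes> s)" "c \<otimes> s \<in> span E"
        using g(1) c span_carr[OF _ E] by (auto simp: m_lcomm intro: span_smult)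
      then show "c \<otimes> u \<in> (\<lambda>e. g \<otimes> e) ` span E" by blast
    qed
    then show ?thesis using py(2) by blast
  qed
  then obtain e where e: "e \<in> span E" "y = g \<otimes> e" by blast
  have ec: "e \<in> carrier R" using span_carr[OF e(1) E] .
  have pc: "p \<in> carrier R" using pP P.Icarr by blast
  have "g \<otimes> (x \<ominus> e) = (g \<otimes> e \<oplus> p) \<ominus> g \<otimes> e"
    using py(3) e(2) g(1) x ec pc by (simp add: a_minus_def r_distr r_minus a_comm)
  also have "\<dots> = p" using add_minus_cancel g(1) ec pc by simp
  finally have "g \<otimes> (x \<ominus> e) \<in> P" using pP by simp
  then have "x \<ominus> e \<in> P" using P.I_prime[OF g(1)] g(2) x ec by auto
  then have "x \<ominus> e \<in> span (P \<union> E)" by (intro span_base) simp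
  moreover have "e \<in> span (P \<union> E)" using e(1) span_mono[of E "P \<union> E"] by blast
  ultimately have "(x \<ominus> e) \<oplus> e \<in> span (P \<union> E)" by (rule span_add)
  then show ?thesis using x ec by (simp add: a_minus_def a_assoc l_neg)
qed

text \<open>With \<open>g\<close> in \<open>P 1\<close> but not in \<open>P 0\<close>,
  multiplication by \<open>g\<close> embeds \<open>R / P 0\<close> into \<open>P 1 / P 0\<close>,
  while a family independent modulo \<open>P 1\<close> remains independent of that image. Adding the
  two families is Pascal's rule. The primes need not be homogeneous, so sizes are measured by the
  filtration \<open>gr_less\<close>.\<close>

theorem prime_chain_growth:
  assumes P: "\<And>i. i \<le> n \<Longrightarrow> primeideal (P i) R" and st: "\<And>i. i < n \<Longrightarrow> P i \<subset> P (Suc i)"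
  shows "\<exists>s>0. \<forall>N. \<exists>W. W \<subseteq> gr_less (s * Suc N) \<and> indep (P 0) (\<lambda>x. x) W \<and> finite W \<and> card W = (N + n choose n)"
  using assms
proof (induction n arbitrary: P)
  case 0
  interpret P: primeideal "P 0" R using 0 by simp
  have "\<one> \<notin> P 0" using P.I_notcarr P.one_imp_carrier by blast
  moreover have "P 0 \<union> (\<lambda>x. x) ` ({\<one>} - {\<one>}) = P 0" by simp
  ultimately have "indep (P 0) (\<lambda>x. x) {\<one>}" unfolding indep_def using ideal_span[OF P.is_ideal] by simp
  moreover have "\<one> \<in> gr_less (1 * Suc N)" for N
    unfolding gr_less_def by (rule span_base, rule UN_I[of 0]) (use K_one in auto)
  ultimately show ?case by (intro exI[of _ 1] conjI allI exI[of _ "{\<one>}"]) auto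
next
  case (Suc n)
  obtain s where s: "s > 0" "\<forall>N. \<exists>W. W \<subseteq> gr_less (s * Suc N) \<and> indep (P 1) (\<lambda>x. x) W \<and> finite W \<and> card W = (N + n choose n)"
    using Suc.IH[of "\<lambda>i. P (Suc i)"] Suc.prems by auto
  interpret P0: primeideal "P 0" R using Suc.prems by simp
  interpret P1: primeideal "P 1" R using Suc.prems(1)[of 1] by simp
  have sub: "P 0 \<subset> P 1" using Suc.prems(2)[of 0] by simp
  then obtain g where g: "g \<in> P 1" "g \<notin> P 0" by blast
  have gc: "g \<in> carrier R" using g(1) P1.Icarr by blast
  obtain s' where s': "g \<in> gr_less s'" using carrier_gr_less[OF gc] by blast
  \<comment> \<open>At least \<open>s'\<close>, so multiplication by \<open>g\<close> advances the
    filtration by at most one block of length \<open>t\<close>; at least \<open>s\<close>, so the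
    family for the shorter chain fits into the same block.\<close>
  define t where "t = max s s'"
  have "g \<in> gr_less (Suc t)" using s' gr_less_mono[of s' "Suc t"] unfolding t_def by fastforce
  then have gmult: "g \<otimes> x \<in> gr_less (t + m)" if "x \<in> gr_less m" for x m using gr_less_mult that by blast
  have P0c: "P 0 \<subseteq> carrier R" and P1c: "P 1 \<subseteq> carrier R" by (rule P0.a_subset, rule P1.a_subset)
  have "\<exists>W. W \<subseteq> gr_less (t * Suc N) \<and> indep (P 0) (\<lambda>x. x) W \<and> finite W \<and> card W = (N + Suc n choose Suc n)" for N
  proof (induction N)
    case 0
    obtain W where W: "W \<subseteq> gr_less (s * Suc 0)" "indep (P 1) (\<lambda>x. x) W" "finite W" "card W = (0 + n choose n)"
      using s(2) by blast
    have "W \<subseteq> gr_less (t * Suc 0)" using W(1) gr_less_mono[of "s * Suc 0" "t * Suc 0"] by (auto simp: t_def)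
    moreover have "P 0 \<subseteq> span (P 1)" using sub span_superset by blast
    then have "indep (P 0) (\<lambda>x. x) W" using indep_mono[OF W(2)] by blast
    ultimately show ?case using W(3,4) by (intro exI[of _ W]) simp
  next
    case (Suc N)
    obtain W where W: "W \<subseteq> gr_less (s * Suc (Suc N))" "indep (P 1) (\<lambda>x. x) W" "finite W" "card W = (Suc N + n choose n)"
      using s(2) by blast
    obtain V where V: "V \<subseteq> gr_less (t * Suc N)" "indep (P 0) (\<lambda>x. x) V" "finite V" "card V = (N + Suc n choose Suc n)"
      using Suc by blast
    have Vc: "V \<subseteq> carrier R" using V(1) gr_less_carrier by blast
    have Wc: "W \<subseteq> carrier R" using W(1) gr_less_carrier by blast
    let ?h = "\<lambda>e. g \<otimes> e"
    have inj: "inj_on ?h V"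
    proof (rule inj_onI, rule ccontr)
      fix x y assume xy: "x \<in> V" "y \<in> V" "g \<otimes> x = g \<otimes> y" "x \<noteq> y"
      have "g \<otimes> x \<in> span (P 0 \<union> ?h ` (V - {x}))" unfolding xy(3) using xy by (intro span_base) blast
      then have "x \<in> span (P 0 \<union> (V - {x}))"
        by (rule prime_cancel_span[OF P0.primeideal gc g(2), rotated -1]) (use Vc xy(1) in auto)
      then show False using indepD[OF V(2) xy(1)] by simp
    qed
    have hV: "indep (P 0) (\<lambda>x. x) (?h ` V)"
      unfolding indep_def
    proof (intro ballI notI)
      fix w assume "w \<in> ?h ` V" and sp: "w \<in> span (P 0 \<union> (\<lambda>x. x) ` (?h ` V - {w}))"
      then obtain x where x: "x \<in> V" "w = g \<otimes> x" by blast
      have "?h ` V - {w} \<subseteq> ?h ` (V - {x})" using x(2) by blast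
      then have "P 0 \<union> (\<lambda>x. x) ` (?h ` V - {w}) \<subseteq> P 0 \<union> ?h ` (V - {x})" by auto
      from span_mono[OF this] sp have "g \<otimes> x \<in> span (P 0 \<union> ?h ` (V - {x}))" using x(2) by blast
      then have "x \<in> span (P 0 \<union> (V - {x}))"
        by (rule prime_cancel_span[OF P0.primeideal gc g(2), rotated -1]) (use Vc x(1) in auto)
      then show False using indepD[OF V(2) x(1)] by simp
    qed
    have hP: "?h ` V \<subseteq> P 1" using g(1) Vc P1.I_r_closed by blast
    have un: "indep (P 0) (\<lambda>x. x) (?h ` V \<union> W)" "?h ` V \<inter> W = {}"
      using indep_union[OF hV hP W(2) _ ideal_span[OF P1.is_ideal] P1c Wc] sub by auto
    have "?h ` V \<subseteq> gr_less (t + t * Suc N)" using gmult V(1) by blast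
    then have "?h ` V \<subseteq> gr_less (t * Suc (Suc N))" by simp
    moreover have "W \<subseteq> gr_less (t * Suc (Suc N))"
    proof -
      have "s * Suc (Suc N) \<le> t * Suc (Suc N)" by (rule mult_right_mono) (auto simp: t_def)
      then show ?thesis using W(1) gr_less_mono by blast
    qed
    moreover have "card (?h ` V \<union> W) = (Suc N + Suc n choose Suc n)"
      using V(3,4) W(3,4) un(2) card_image[OF inj] by (simp add: card_Un_disjoint)
    ultimately show ?case using un(1) V(3) W(3) by (intro exI[of _ "?h ` V \<union> W"]) auto
  qed
  moreover have "t > 0" using s(1) by (simp add: t_def)
  ultimately show ?case by blast
qed

end

section \<open>Multiplicity\<close>

context graded_algebra
begin

lemma disjoint_degree_sets:
  assumes "y \<in> span (\<Union>m\<in>M. G m)" "y \<in> span (\<Union>m\<in>N. G m)" "M \<inter> N = {}"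
  shows "y = \<zero>"
proof -
  obtain f A where f: "finite A" "A \<subseteq> M" "\<forall>m. f m \<in> G m" "\<forall>m. m \<notin> A \<longrightarrow> f m = \<zero>" "y = finsum R f A"
    using span_UN_rep[OF assms(1)] by blast
  obtain g B where g: "finite B" "B \<subseteq> N" "\<forall>m. g m \<in> G m" "\<forall>m. m \<notin> B \<longrightarrow> g m = \<zero>" "y = finsum R g B"
    using span_UN_rep[OF assms(2)] by blast
  have fin: "finite {m. f m \<noteq> \<zero>}" "finite {m. g m \<noteq> \<zero>}"
    using f(1,4) g(1,4) by (auto intro: finite_subset[of _ A] finite_subset[of _ B])
  have yc: "y \<in> carrier R" using span_carr[OF assms(1) UN_G_carrier] .
  have "f = g"
    using direct_sum[OF yc] fin f(3) g(3) f(5) g(5) finsum_support[OF f(1,3,4)] finsum_support[OF g(1,3,4)] by auto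
  then have "f m = \<zero>" for m using f(2,4) g(2,4) assms(3) by (metis disjoint_iff subsetD)
  then have "finsum R f A = \<zero>" by (intro add.finprod_one_eqI) simp
  then show ?thesis using f(5) by simp
qed

text \<open>Elements of degree below \<open>n\<close> meet \<open>gr_ge n\<close> only in zero, so
  nothing is lost in the quotient by high degrees.\<close>

lemma indep_gr_ge:
  assumes W: "W \<subseteq> gr_less n" "indep {} (\<lambda>x. x) W"
  shows "indep (gr_ge n) (\<lambda>x. x) W"
  unfolding indep_def
proof (intro ballI notI)
  fix w assume w: "w \<in> W" and sp: "w \<in> span (gr_ge n \<union> (\<lambda>x. x) ` (W - {w}))"
  have Wc: "W \<subseteq> carrier R" using W(1) gr_less_carrier by blast
  have c: "(\<lambda>x. x) ` (W - {w}) \<subseteq> carrier R" using Wc by auto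
  obtain x y where xy: "x \<in> span (gr_ge n)" "y \<in> span ((\<lambda>x. x) ` (W - {w}))" "w = x \<oplus> y"
    using span_UnE[OF sp gr_ge_carrier c] .
  have x: "x \<in> gr_ge n" using xy(1) ideal_span[OF ideal_gr_ge] by simp
  have "span (W - {w}) \<subseteq> gr_less n" unfolding gr_less_def
    by (rule span_least) (use W(1) in \<open>auto simp: gr_less_def\<close>)
  then have y: "y \<in> gr_less n" using xy(2) by auto
  have carr: "x \<in> carrier R" "y \<in> carrier R" using x y gr_ge_carrier gr_less_carrier by auto
  have "w \<ominus> y \<in> gr_less n"
    using y w W(1) unfolding gr_less_def by (intro span_minus UN_G_carrier) auto
  moreover have "w \<ominus> y = x"
    using add_minus_cancel[OF carr(2,1)] xy(3) carr by (simp add: a_comm)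
  ultimately have "x \<in> gr_less n" by simp
  then have "x = \<zero>"
    using x unfolding gr_ge_def gr_less_def by (rule disjoint_degree_sets[where M = "{..<n}" and N = "{n..}"]) auto
  then have "w \<in> span ({} \<union> (\<lambda>x. x) ` (W - {w}))" using xy carr by simp
  then show False using indepD[OF W(2) w] by simp
qed

lemma finprod_degree:
  assumes "finite A" "\<And>i. i \<in> A \<Longrightarrow> g i \<in> G (k i)"
  shows "(\<Otimes>i\<in>A. g i) \<in> G (\<Sum>i\<in>A. k i)"
  using assms
proof (induction A rule: finite_induct)
  case empty
  then show ?case using K_one by simp
next
  case (insert x A)
  have "(\<Otimes>i\<in>insert x A. g i) = g x \<otimes> (\<Otimes>i\<in>A. g i)"
    using insert.hyps insert.prems G_carr by (intro finprod_insert) auto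
  then show ?case using insert component_mult by simp
qed

end

context parameters
begin

lemma mon_degree: "mon u \<in> G (wt a u)"
proof -
  have "(\<Otimes>i\<in>{1..d}. z i [^] u i) \<in> G (\<Sum>i\<in>{1..d}. u i * a i)"
    by (rule finprod_degree) (use z_degree G_pow in auto)
  then show ?thesis by (simp add: mon_def wt_def mult.commute)
qed

lemma monideal_gr_ge: "monideal (above a n) \<subseteq> gr_ge n"
proof (rule monideal_least[OF ideal_gr_ge])
  fix u assume "u \<in> above a n"
  then show "mon u \<in> gr_ge n" using mon_degree[of u] G_gr_ge[of n "wt a u"] by (auto simp: above_def)
qed

lemma G_monideal:
  assumes "\<And>u. \<lbrakk>u \<in> exps; m \<le> wt a u + C\<rbrakk> \<Longrightarrow> u \<in> M"
  shows "G m \<subseteq> monideal M"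
proof -
  have "pm ` ({u \<in> exps. wt a u \<le> m \<and> m \<le> wt a u + C} \<times> Y) \<subseteq> monideal M"
  proof
    fix x assume "x \<in> pm ` ({u \<in> exps. wt a u \<le> m \<and> m \<le> wt a u + C} \<times> Y)"
    then obtain u y where "u \<in> exps" "m \<le> wt a u + C" "y \<in> Y" "x = mon u \<otimes> y" by (auto simp: pm_def)
    then show "x \<in> monideal M" using assms mon_in_monideal Y_carrier by blast
  qed
  from span_mono[OF this] show ?thesis using G_span_pm[of m] ideal_span[OF ideal_monideal] by blast
qed

text \<open>Module generators contribute degree at most \<open>C\<close>. With
  \<open>monideal_gr_ge\<close> this makes the filtration by degree and the one by weight in the
  parameters agree up to the shift \<open>C\<close>.\<close>

lemma gr_ge_monideal: "gr_ge (n + C) \<subseteq> monideal (above a n)"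
proof -
  have "G m \<subseteq> monideal (above a n)" if "m \<ge> n + C" for m
    by (rule G_monideal) (use that in \<open>auto simp: above_def\<close>)
  then have "(\<Union>m\<in>{n + C..}. G m) \<subseteq> monideal (above a n)" by blast
  from span_mono[OF this] show ?thesis unfolding gr_ge_def ideal_span[OF ideal_monideal] .
qed

lemma spanning_gr_ge:
  "\<exists>W. finite W \<and> W \<subseteq> carrier R \<and> carrier R \<subseteq> span (gr_ge n \<union> W) \<and>
    card W \<le> card (simplex_points d a n) * card Z +
      (card (simplex_points d a n) - card (simplex_points d a (n - wt a \<mu>))) * card Y"
proof -
  obtain W where W: "finite W" "W \<subseteq> carrier R" "carrier R \<subseteq> span (monideal (above a n) \<union> W)"
    "card W \<le> card (simplex_points d a n) * card Z +
      (card (simplex_points d a n) - card (simplex_points d a (n - wt a \<mu>))) * card Y"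
    using spanning_below[of a n, OF a_pos] by blast
  have "span (monideal (above a n) \<union> W) \<subseteq> span (gr_ge n \<union> W)"
    by (rule span_mono) (use monideal_gr_ge in auto)
  then show ?thesis using W by blast
qed

lemma indep_gr_ge_below: "indep (gr_ge (n + C)) pm (below a (n - wt a \<mu>) \<times> Z)"
  by (rule indep_mono[OF indep_below]) (use gr_ge_monideal ideal_span[OF ideal_monideal] in auto)

text \<open>If \<open>Z\<close> were empty, only the error term of \<open>spanning_gr_ge\<close>
  would remain. It is negligible against \<open>n ^ d\<close>, contrary to the growth forced by the
  primes.\<close>

lemma card_pos_of_primes:
  assumes d: "d \<ge> 1" and P: "\<And>i. i \<le> d \<Longrightarrow> primeideal (P i) R" "\<And>i. i < d \<Longrightarrow> P i \<subset> P (Suc i)"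
  shows "card Z > 0"
proof (rule ccontr)
  assume "\<not> card Z > 0"
  then have Z0: "card Z = 0" by simp
  obtain s where s: "s > 0" "\<forall>N. \<exists>W. W \<subseteq> gr_less (s * Suc N) \<and> indep (P 0) (\<lambda>x. x) W \<and> finite W \<and> card W = (N + d choose d)"
    using prime_chain_growth[of d P, OF P] by auto
  let ?f = "\<lambda>n. real (card (simplex_points d a n)) / real n ^ d - real (card (simplex_points d a (n - wt a \<mu>))) / real n ^ d"
  \<comment> \<open>The constant results from \<open>N + d choose d\<close> being at least
    ((N+1)/d)^d, divided by the d-th power of the degree s(N+1).\<close>
  have bound: "(1 / (real s * real d)) ^ d \<le> ?f (s * Suc N) * real (card Y)" for N
  proof -
    let ?n = "s * Suc N"
    obtain W where W: "W \<subseteq> gr_less ?n" "indep (P 0) (\<lambda>x. x) W" "finite W" "card W = (N + d choose d)"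
      using s(2) by blast
    have W1: "indep (gr_ge ?n) (\<lambda>x. x) W"
      by (rule indep_gr_ge[OF W(1) indep_mono[OF W(2)]]) auto
    obtain V where V: "finite V" "V \<subseteq> carrier R" "carrier R \<subseteq> span (gr_ge ?n \<union> V)"
      "card V \<le> card (simplex_points d a ?n) * card Z +
        (card (simplex_points d a ?n) - card (simplex_points d a (?n - wt a \<mu>))) * card Y"
      using spanning_gr_ge[of ?n] by blast
    have "(\<lambda>x. x) ` W \<subseteq> span (gr_ge ?n \<union> V)" using W(1) gr_less_carrier V(3) by auto
    then have "card W \<le> card V" using steinitz[OF W1 V(1) _ gr_ge_carrier V(2)] by blast
    then have "N + d choose d \<le> (card (simplex_points d a ?n) - card (simplex_points d a (?n - wt a \<mu>))) * card Y"
      using V(4) W(4) Z0 by simp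
    then have le: "real (N + d choose d) \<le> real ((card (simplex_points d a ?n) - card (simplex_points d a (?n - wt a \<mu>))) * card Y)"
      by (rule of_nat_mono)
    have sub: "simplex_points d a (?n - wt a \<mu>) \<subseteq> simplex_points d a ?n" by (auto simp: simplex_points_def)
    then have "card (simplex_points d a (?n - wt a \<mu>)) \<le> card (simplex_points d a ?n)"
      using finite_simplex_points[of d a ?n, OF a_pos] by (intro card_mono)
    then have le2: "real (N + d choose d) \<le> (real (card (simplex_points d a ?n)) - real (card (simplex_points d a (?n - wt a \<mu>)))) * real (card Y)"
      using le by (simp only: of_nat_mult of_nat_diff)
    have "(real (Suc N) / real d) ^ d \<le> (real (N + d) / real d) ^ d"
      using d by (intro power_mono divide_right_mono) auto
    also have "\<dots> \<le> real (N + d choose d)" using binomial_ge_n_over_k_pow_k[of d "N + d"] by simp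
    finally have "(real (Suc N) / real d) ^ d / real ?n ^ d \<le>
      (real (card (simplex_points d a ?n)) - real (card (simplex_points d a (?n - wt a \<mu>)))) * real (card Y) / real ?n ^ d"
      using le2 by (intro divide_right_mono) auto
    also have "(real (Suc N) / real d) ^ d / real ?n ^ d = (1 / (real s * real d)) ^ d"
    proof -
      have "real (Suc N) / real d / real ?n = 1 / (real s * real d)"
        unfolding of_nat_mult by (simp del: of_nat_Suc)
      then show ?thesis unfolding power_divide[symmetric] by (rule arg_cong)
    qed
    also have "(real (card (simplex_points d a ?n)) - real (card (simplex_points d a (?n - wt a \<mu>)))) * real (card Y) / real ?n ^ d = ?f ?n * real (card Y)"
      by (simp only: diff_divide_distrib[symmetric] times_divide_eq_left)
    finally show ?thesis .
  qed
  have "?f \<longlonglongrightarrow> 1 / (fact d * (\<Prod>i\<in>{1..d}. real (a i))) - 1 / (fact d * (\<Prod>i\<in>{1..d}. real (a i)))"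
    using card_simplex_points_limit[of d a 0 0, OF a_pos] card_simplex_points_limit[of d a 0 "wt a \<mu>", OF a_pos]
    by (intro tendsto_diff) auto
  then have "(\<lambda>n. ?f n * real (card Y)) \<longlonglongrightarrow> 0" by (intro tendsto_mult_left_zero) simp
  moreover have "filterlim (\<lambda>N. s * Suc N) sequentially sequentially"
    by (rule filterlim_subseq) (use s(1) in \<open>auto simp: strict_mono_def\<close>)
  ultimately have "(\<lambda>N. ?f (s * Suc N) * real (card Y)) \<longlonglongrightarrow> 0"
    by (rule filterlim_compose)
  then have "(1 / (real s * real d)) ^ d \<le> 0"
    by (rule tendsto_lowerbound) (use bound in auto)
  moreover have "(1 / (real s * real d)) ^ d > 0" using s(1) d by simp
  ultimately show False by simp
qed

abbreviation one_wt :: "nat \<Rightarrow> nat" where "one_wt \<equiv> \<lambda>_. 1"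

text \<open>With unit weights the weight of an exponent is the number of factors, so powers of the
  parameter ideal become monomial ideals to which the dimension bounds apply.\<close>

lemma ideal_power_eq:
  "ideal_power R (Idl (z ` {1..d})) n = monideal (above one_wt n)"
proof -
  interpret I: comm_monoid "ideals_set R" by (rule ideals_set_is_comm_monoid)
  have zc: "z ` {1..d} \<subseteq> carrier R" using z_closed by auto
  let ?I = "Idl (z ` {1..d})"
  have I: "ideal ?I R" by (rule genideal_ideal[OF zc])
  have mI: "mon (unit_exp i) \<in> ?I" if "i \<in> {1..d}" for i
    using mon_unit_exp[OF that] genideal_self[OF zc] that by auto
  show ?thesis
  proof (induction n)
    case 0
    have "monideal (above one_wt 0) = carrier R"
    proof
      show "carrier R \<subseteq> monideal (above one_wt 0)"
      proof
        fix r assume r: "r \<in> carrier R"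
        have "0 \<in> above one_wt 0" by (simp add: above_def)
        from mon_in_monideal[OF this r] show "r \<in> monideal (above one_wt 0)" using r by simp
      qed
    qed (rule monideal_carrier)
    then show ?case by (simp add: ideals_set_def)
  next
    case (Suc n)
    let ?M = "monideal (above one_wt n)" and ?M' = "monideal (above one_wt (Suc n))"
    have M: "ideal ?M R" and M': "ideal ?M' R" by (rule ideal_monideal)+
    interpret M: ideal ?M R by (rule M)
    interpret M': ideal ?M' R by (rule M')
    have "ideal_power R ?I (Suc n) = ideal_prod R ?M ?I"
      using Suc by (simp add: ideals_set_def)
    also have "\<dots> = ?M'"
    proof
      have prod: "m \<otimes> i \<in> ?M'" if m: "m \<in> ?M" and i: "i \<in> ?I" for m i
      proof -
        have mc: "m \<in> carrier R" using m M.Icarr by blast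
        have "z ` {1..d} \<subseteq> {i \<in> carrier R. i \<otimes> m \<in> ?M'}"
        proof
          fix w assume "w \<in> z ` {1..d}"
          then obtain j where j: "j \<in> {1..d}" "w = z j" by blast
          have "w \<otimes> m \<in> span {mon u \<otimes> r | u r. u \<in> above one_wt (Suc n) \<and> r \<in> carrier R}"
          proof (rule span_mult_in[OF m[unfolded monideal_def] _ monideal_gen_carrier])
            show "w \<in> carrier R" using j z_closed by simp
            fix v assume "v \<in> {mon u \<otimes> r | u r. u \<in> above one_wt n \<and> r \<in> carrier R}"
            then obtain u r where ur: "u \<in> above one_wt n" "r \<in> carrier R" "v = mon u \<otimes> r" by blast
            have "w \<otimes> v = mon (unit_exp j + u) \<otimes> r"
              unfolding mon_add mon_unit_exp[OF j(1)] ur(3) j(2) using z_closed[OF j(1)] ur(2) by (simp add: m_assoc)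
            moreover have "unit_exp j + u \<in> above one_wt (Suc n)"
              using ur(1) unit_exp_exps[OF j(1)] wt_unit_exp[OF j(1), of one_wt] by (auto simp: above_def wt_add)
            ultimately show "w \<otimes> v \<in> span {mon u \<otimes> r | u r. u \<in> above one_wt (Suc n) \<and> r \<in> carrier R}"
              using ur(2) by (intro span_base) blast
          qed
          then show "w \<in> {i \<in> carrier R. i \<otimes> m \<in> ?M'}"
            unfolding monideal_def using j z_closed by simp
        qed
        then have "?I \<subseteq> {i \<in> carrier R. i \<otimes> m \<in> ?M'}" by (rule genideal_minimal[OF ideal_colon[OF M' mc]])
        then show ?thesis using i mc m_comm[of i m] by auto
      qed
      show "ideal_prod R ?M ?I \<subseteq> ?M'"
      proof
        fix x assume "x \<in> ideal_prod R ?M ?I"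
        then show "x \<in> ?M'" by induction (use prod M'.a_closed in auto)
      qed
      show "?M' \<subseteq> ideal_prod R ?M ?I"
      proof (rule monideal_least[OF ideal_prod_is_ideal[OF M I]])
        fix u assume u: "u \<in> above one_wt (Suc n)"
        have "\<exists>i\<in>{1..d}. u i > 0"
        proof (rule ccontr)
          assume "\<not> ?thesis"
          then have "wt one_wt u = 0" by (simp add: wt_def)
          then show False using u by (simp add: above_def)
        qed
        then obtain i where i: "i \<in> {1..d}" "u i > 0" by blast
        define v where "v = u(i := u i - 1)"
        have uv: "u = v + unit_exp i" using i(2) by (auto simp: v_def unit_exp_def fun_eq_iff)
        have "v \<in> exps" using u i by (auto simp: v_def above_def exps_def)
        then have "v \<in> above one_wt n" using u wt_unit_exp[OF i(1), of one_wt] unfolding uv by (simp add: above_def wt_add)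
        from mon_in_monideal[OF this one_closed] have "mon v \<in> ?M" by simp
        then show "mon u \<in> ideal_prod R ?M ?I" unfolding uv mon_add using mI[OF i(1)] by (rule ideal_prod.prod)
      qed
    qed
    finally show ?case .
  qed
qed

text \<open>The colength is squeezed between multiples of lattice point counts that differ by
  o(n^d). With unit weights the simplex has volume 1/d!, which the normalizing factorial
  cancels.\<close>

theorem multiplicity_eq:
  assumes d: "d \<ge> 1"
  shows "hs_multiplicity R d (Idl (z ` {1..d})) = ereal (real (card Z))"
proof -
  let ?I = "\<lambda>n. monideal (above one_wt n)"
  let ?N = "\<lambda>n. card (simplex_points d one_wt n)"
  let ?c = "wt one_wt \<mu>"
  have "\<exists>L. module_length R (quot_module R (?I n)) = enat L \<and> ?N (n - ?c) * card Z \<le> L \<and>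
      L \<le> ?N n * card Z + (?N n - ?N (n - ?c)) * card Y" for n
  proof -
    obtain W where W: "finite W" "W \<subseteq> carrier R" "carrier R \<subseteq> span (?I n \<union> W)"
      "card W \<le> ?N n * card Z + (?N n - ?N (n - ?c)) * card Y"
      using spanning_below[of one_wt n] by auto
    have up: "module_length R (quot_module R (?I n)) \<le> enat (card W)"
      by (rule module_length_le[OF ideal_monideal W(1-3)])
    then obtain L where L: "module_length R (quot_module R (?I n)) = enat L" using enat_ile by blast
    define A where "A = (\<Sum>i\<in>{1..d}. a i)"
    have A: "A > 0"
    proof -
      have "a 1 \<le> A" unfolding A_def by (rule member_le_sum) (use d in auto)
      then show ?thesis using a_pos[of 1] d by simp
    qed
    \<comment> \<open>\<open>A\<close> bounds every degree, so few factors mean small degree. This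
      supplies the vanishing in high degrees on which \<open>module_length_ge\<close> rests.\<close>
    have big: "G m \<subseteq> ?I n" if m: "m \<ge> A * n + C" for m
    proof (rule G_monideal)
      fix u assume u: "u \<in> exps" "m \<le> wt a u + C"
      have "wt a u \<le> A * wt one_wt u" unfolding wt_def sum_distrib_left
      proof (rule sum_mono)
        fix i assume "i \<in> {1..d}"
        then have "a i \<le> A" unfolding A_def by (intro member_le_sum) auto
        then show "a i * u i \<le> A * (1 * u i)" by simp
      qed
      then have "A * n \<le> A * wt one_wt u" using u m by linarith
      then show "u \<in> above one_wt n" using A u by (simp add: above_def)
    qed
    have "enat (card (below one_wt (n - ?c) \<times> Z)) \<le> module_length R (quot_module R (?I n))"
    proof (rule module_length_ge[OF ideal_monideal big W(1-3) indep_below])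
      show "pm ` (below one_wt (n - ?c) \<times> Z) \<subseteq> carrier R" by (rule pm_closed[OF Z_carrier])
    qed
    then show ?thesis using L up W(4) by (auto simp: card_cartesian_product below_eq)
  qed
  then obtain L where L: "\<And>n. module_length R (quot_module R (?I n)) = enat (L n)"
    "\<And>n. ?N (n - ?c) * card Z \<le> L n" "\<And>n. L n \<le> ?N n * card Z + (?N n - ?N (n - ?c)) * card Y" by metis
  have lim: "(\<lambda>n. real (?N (n - c)) / real n ^ d) \<longlonglongrightarrow> 1 / fact d" for c
    using card_simplex_points_limit[of d one_wt 0 c] by simp
  have le: "?N (n - ?c) \<le> ?N n" for n
    using finite_simplex_points[of d one_wt n] by (intro card_mono) (auto simp: simplex_points_def)
  have "(\<lambda>n. real (L n) / real n ^ d) \<longlonglongrightarrow> real (card Z) / fact d"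
  proof (rule tendsto_sandwich)
    show "(\<lambda>n. real (?N (n - ?c)) / real n ^ d * real (card Z)) \<longlonglongrightarrow> real (card Z) / fact d"
      using tendsto_mult[OF lim[of ?c] tendsto_const[of "real (card Z)"]] by simp
    have "(\<lambda>n. real (?N (n - 0)) / real n ^ d * real (card Z) +
        (real (?N (n - 0)) / real n ^ d - real (?N (n - ?c)) / real n ^ d) * real (card Y))
      \<longlonglongrightarrow> 1 / fact d * real (card Z) + (1 / fact d - 1 / fact d) * real (card Y)"
      by (intro tendsto_intros lim)
    then show "(\<lambda>n. real (?N n) / real n ^ d * real (card Z) +
        (real (?N n) / real n ^ d - real (?N (n - ?c)) / real n ^ d) * real (card Y))
      \<longlonglongrightarrow> real (card Z) / fact d"
      by simp
    show "\<forall>\<^sub>F n in sequentially. real (?N (n - ?c)) / real n ^ d * real (card Z) \<le> real (L n) / real n ^ d"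
    proof (rule always_eventually, rule allI)
      fix n
      have "real (?N (n - ?c)) * real (card Z) \<le> real (L n)" using L(2)[of n] by (metis of_nat_le_iff of_nat_mult)
      then show "real (?N (n - ?c)) / real n ^ d * real (card Z) \<le> real (L n) / real n ^ d"
        by (simp add: divide_right_mono)
    qed
    show "\<forall>\<^sub>F n in sequentially. real (L n) / real n ^ d \<le> real (?N n) / real n ^ d * real (card Z) +
        (real (?N n) / real n ^ d - real (?N (n - ?c)) / real n ^ d) * real (card Y)"
    proof (rule always_eventually, rule allI)
      fix n
      have "real (L n) \<le> real (?N n * card Z + (?N n - ?N (n - ?c)) * card Y)" using L(3)[of n] by (rule of_nat_mono)
      then have "real (L n) \<le> real (?N n) * real (card Z) + (real (?N n) - real (?N (n - ?c))) * real (card Y)"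
        using le[of n] by (simp add: of_nat_diff)
      then have "real (L n) / real n ^ d \<le>
        (real (?N n) * real (card Z) + (real (?N n) - real (?N (n - ?c))) * real (card Y)) / real n ^ d"
        by (rule divide_right_mono) simp
      also have "\<dots> = real (?N n) / real n ^ d * real (card Z) +
        (real (?N n) / real n ^ d - real (?N (n - ?c)) / real n ^ d) * real (card Y)"
        by (simp add: add_divide_distrib diff_divide_distrib left_diff_distrib)
      finally show "real (L n) / real n ^ d \<le> real (?N n) / real n ^ d * real (card Z) +
        (real (?N n) / real n ^ d - real (?N (n - ?c)) / real n ^ d) * real (card Y)" .
    qed
  qed
  from tendsto_mult[OF tendsto_const[of "fact d"] this]
  have "(\<lambda>n. fact d * (real (L n) / real n ^ d)) \<longlonglongrightarrow> real (card Z)" by simp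
  then have "(\<lambda>n. ereal (fact d * (real (L n) / real n ^ d))) \<longlonglongrightarrow> ereal (real (card Z))" by simp
  moreover have "\<forall>\<^sub>F n in sequentially. ereal (fact d * (real (L n) / real n ^ d)) =
      ereal (fact d) * ereal_of_enat (module_length R (quot_module R (?I n))) / ereal (real n ^ d)"
    using eventually_gt_at_top[of 0]
  proof eventually_elim
    case (elim n)
    then show ?case unfolding L(1) by simp
  qed
  ultimately have "(\<lambda>n. ereal (fact d) * ereal_of_enat (module_length R (quot_module R (?I n))) / ereal (real n ^ d))
      \<longlonglongrightarrow> ereal (real (card Z))"
    by (rule Lim_transform_eventually)
  then show ?thesis unfolding hs_multiplicity_def ideal_power_eq by (rule limI)
qed

end

text \<open>The quotients by \<open>gr_ge\<close> are defined without reference to parameters. One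
  system gives independent vectors in them, the other a spanning set; comparing leading coefficients
  gives the inequality, and exchanging the systems gives equality.\<close>

lemma rank_le:
  assumes X: "parameters R G d x a Y Z C f \<mu>" and X': "parameters R G d x' a' Y' Z' C' f' \<mu>'"
  shows "real (card Z) / (\<Prod>i\<in>{1..d}. real (a i)) \<le> real (card Z') / (\<Prod>i\<in>{1..d}. real (a' i))"
proof -
  interpret X: parameters R G d x a Y Z C f \<mu> by fact
  interpret X': parameters R G d x' a' Y' Z' C' f' \<mu>' by fact
  let ?N = "\<lambda>n. card (simplex_points d a n)" and ?N' = "\<lambda>n. card (simplex_points d a' n)"
  let ?c = "X.wt a \<mu>" and ?c' = "X'.wt a' \<mu>'"
  have lim: "(\<lambda>n. real (?N (n - c)) / real n ^ d) \<longlonglongrightarrow> 1 / (fact d * (\<Prod>i\<in>{1..d}. real (a i)))" for c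
    using card_simplex_points_limit[of d a 0 c, OF X.a_pos] by simp
  note lim' = card_simplex_points_limit[of d a' C, OF X'.a_pos]
  have bound: "real (?N (n - ?c)) * real (card Z) \<le>
    real (?N' (n + C)) * real (card Z') + (real (?N' (n + C)) - real (?N' (n + C - ?c'))) * real (card Y')" for n
  proof -
    obtain W where W: "finite W" "W \<subseteq> carrier R" "carrier R \<subseteq> X.span (X.gr_ge (n + C) \<union> W)"
      "card W \<le> ?N' (n + C) * card Z' + (?N' (n + C) - ?N' (n + C - ?c')) * card Y'"
      using X'.spanning_gr_ge[of "n + C"] by blast
    have "X.pm ` (X.below a (n - ?c) \<times> Z) \<subseteq> X.span (X.gr_ge (n + C) \<union> W)"
      using X.pm_closed[OF X.Z_carrier] W(3) by blast
    then have "card (X.below a (n - ?c) \<times> Z) \<le> card W"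
      using X.steinitz[OF X.indep_gr_ge_below W(1) _ X.gr_ge_carrier W(2)] by blast
    then have "?N (n - ?c) * card Z \<le> ?N' (n + C) * card Z' + (?N' (n + C) - ?N' (n + C - ?c')) * card Y'"
      using W(4) by (simp add: card_cartesian_product X.below_eq)
    then have "real (?N (n - ?c) * card Z) \<le> real (?N' (n + C) * card Z' + (?N' (n + C) - ?N' (n + C - ?c')) * card Y')"
      by (rule of_nat_mono)
    moreover have "?N' (n + C - ?c') \<le> ?N' (n + C)"
      using finite_simplex_points[of d a' "n + C", OF X'.a_pos] by (intro card_mono) (auto simp: simplex_points_def)
    ultimately show ?thesis by (simp add: of_nat_diff)
  qed
  have "1 / (fact d * (\<Prod>i\<in>{1..d}. real (a i))) * real (card Z) \<le>
    1 / (fact d * (\<Prod>i\<in>{1..d}. real (a' i))) * real (card Z') +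
    (1 / (fact d * (\<Prod>i\<in>{1..d}. real (a' i))) - 1 / (fact d * (\<Prod>i\<in>{1..d}. real (a' i)))) * real (card Y')"
  proof (rule tendsto_le[OF sequentially_bot])
    show "(\<lambda>n. real (?N (n - ?c)) / real n ^ d * real (card Z)) \<longlonglongrightarrow>
      1 / (fact d * (\<Prod>i\<in>{1..d}. real (a i))) * real (card Z)"
      by (intro tendsto_intros lim)
    show "(\<lambda>n. real (?N' (n + C - 0)) / real n ^ d * real (card Z') +
       (real (?N' (n + C - 0)) / real n ^ d - real (?N' (n + C - ?c')) / real n ^ d) * real (card Y')) \<longlonglongrightarrow>
      1 / (fact d * (\<Prod>i\<in>{1..d}. real (a' i))) * real (card Z') +
      (1 / (fact d * (\<Prod>i\<in>{1..d}. real (a' i))) - 1 / (fact d * (\<Prod>i\<in>{1..d}. real (a' i)))) * real (card Y')"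
      by (intro tendsto_add tendsto_mult tendsto_diff tendsto_const lim')
    show "\<forall>\<^sub>F n in sequentially. real (?N (n - ?c)) / real n ^ d * real (card Z) \<le>
       real (?N' (n + C - 0)) / real n ^ d * real (card Z') +
       (real (?N' (n + C - 0)) / real n ^ d - real (?N' (n + C - ?c')) / real n ^ d) * real (card Y')"
    proof (rule always_eventually, rule allI)
      fix n
      have "real (?N (n - ?c)) * real (card Z) / real n ^ d \<le>
        (real (?N' (n + C)) * real (card Z') + (real (?N' (n + C)) - real (?N' (n + C - ?c'))) * real (card Y')) / real n ^ d"
        using bound[of n] by (rule divide_right_mono) simp
      then show "real (?N (n - ?c)) / real n ^ d * real (card Z) \<le>
       real (?N' (n + C - 0)) / real n ^ d * real (card Z') +
       (real (?N' (n + C - 0)) / real n ^ d - real (?N' (n + C - ?c')) / real n ^ d) * real (card Y')"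
        by (simp add: add_divide_distrib diff_divide_distrib left_diff_distrib)
    qed
  qed
  then have "(real (card Z) / (\<Prod>i\<in>{1..d}. real (a i))) / fact d \<le> (real (card Z') / (\<Prod>i\<in>{1..d}. real (a' i))) / fact d"
    by (simp add: field_simps)
  from this[unfolded divide_le_cancel] show ?thesis using fact_gt_zero[where ?'a = real, of d] by blast
qed

section \<open>The Frobenius homomorphism\<close>

context cring
begin

lemma binomial_expansion:
  assumes x: "x \<in> carrier R" and y: "y \<in> carrier R"
  shows "(x \<oplus> y) [^] (n::nat) = (\<Oplus>k\<in>{..n}. add_pow R (n choose k) (x [^] k \<otimes> y [^] (n - k)))"
proof (induction n)
  case 0
  show ?case by simp
next
  case (Suc n)
  let ?S = "\<lambda>n. \<Oplus>k\<in>{..n}. add_pow R (n choose k) (x [^] k \<otimes> y [^] (n - k))"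
  let ?t = "\<lambda>k. add_pow R (n choose k) (x [^] Suc k \<otimes> y [^] (n - k))"
  let ?u = "\<lambda>k. add_pow R (n choose k) (x [^] k \<otimes> y [^] (Suc n - k))"
  have tc: "?t \<in> A \<rightarrow> carrier R" "?u \<in> A \<rightarrow> carrier R" for A using x y by auto
  have xS: "x \<otimes> ?S n = finsum R ?t {..n}"
  proof -
    have "x \<otimes> ?S n = (\<Oplus>k\<in>{..n}. x \<otimes> (add_pow R (n choose k) (x [^] k \<otimes> y [^] (n - k))))"
      using x y by (intro finsum_rdistr) auto
    also have "\<dots> = finsum R ?t {..n}"
      by (rule finsum_cong') (use x y in \<open>auto simp: add_pow_rdistr m_ac\<close>)
    finally show ?thesis .
  qed
  have yS: "y \<otimes> ?S n = finsum R ?u {..n}"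
  proof -
    have "y \<otimes> ?S n = (\<Oplus>k\<in>{..n}. y \<otimes> (add_pow R (n choose k) (x [^] k \<otimes> y [^] (n - k))))"
      using x y by (intro finsum_rdistr) auto
    also have "\<dots> = finsum R ?u {..n}"
    proof (rule finsum_cong')
      fix k assume "k \<in> {..n}"
      then have "Suc n - k = Suc (n - k)" by auto
      then show "y \<otimes> (add_pow R (n choose k) (x [^] k \<otimes> y [^] (n - k))) = ?u k"
        using x y by (simp add: add_pow_rdistr m_ac)
    qed (use tc in auto)
    finally show ?thesis .
  qed
  have "(x \<oplus> y) [^] Suc n = ?S n \<otimes> (x \<oplus> y)" using Suc by simp
  also have "\<dots> = finsum R ?t {..n} \<oplus> finsum R ?u {..n}"
  proof -
    have "?S n \<in> carrier R" using x y by (intro finsum_closed) auto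
    then have "?S n \<otimes> (x \<oplus> y) = x \<otimes> ?S n \<oplus> y \<otimes> ?S n"
      using r_distr[OF x y, of "?S n"] m_comm[OF x, of "?S n"] m_comm[OF y, of "?S n"] by argo
    then show ?thesis unfolding xS yS .
  qed
  also have "finsum R ?u {..n} = finsum R ?u {..Suc n}"
    using finsum_Suc[of ?u n] tc[of "{..n}"] tc[of "{..Suc n}"] by (simp add: binomial_eq_0)
  also have "\<dots> = finsum R (\<lambda>k. ?u (Suc k)) {..n} \<oplus> ?u 0"
    by (rule finsum_Suc2[OF tc(2)])
  also have "finsum R ?t {..n} \<oplus> (finsum R (\<lambda>k. ?u (Suc k)) {..n} \<oplus> ?u 0) =
     finsum R (\<lambda>k. ?t k \<oplus> ?u (Suc k)) {..n} \<oplus> ?u 0"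
    using x y by (subst finsum_addf) (auto simp: a_assoc)
  also have "finsum R (\<lambda>k. ?t k \<oplus> ?u (Suc k)) {..n} =
     finsum R (\<lambda>k. add_pow R (Suc n choose Suc k) (x [^] Suc k \<otimes> y [^] (Suc n - Suc k))) {..n}"
  proof (rule finsum_cong')
    fix k assume "k \<in> {..n}"
    have "x [^] Suc k \<otimes> y [^] (n - k) \<in> carrier R" using x y by auto
    then show "?t k \<oplus> ?u (Suc k) = add_pow R (Suc n choose Suc k) (x [^] Suc k \<otimes> y [^] (Suc n - Suc k))"
      by (simp add: add.nat_pow_mult del: nat_pow_Suc)
  qed (use x y in auto)
  also have "\<dots> \<oplus> ?u 0 = ?S (Suc n)"
    using finsum_Suc2[of "\<lambda>k. add_pow R (Suc n choose k) (x [^] k \<otimes> y [^] (Suc n - k))" n] x y by simp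
  finally show ?case .
qed

lemma add_pow_char_dvd:
  assumes "add_pow R (p::nat) \<one> = \<zero>" "p dvd c" "z \<in> carrier R"
  shows "add_pow R (c) z = \<zero>"
proof -
  obtain k where k: "c = p * k" using assms(2) by blast
  have "add_pow R (p) z = add_pow R (p) \<one> \<otimes> z" using assms(3) by (simp add: add_pow_ldistr)
  then have "add_pow R (p) z = \<zero>" using assms by simp
  then show ?thesis unfolding k using add.nat_pow_pow[OF assms(3), of k p] by (simp add: mult.commute)
qed

lemma frobenius_add:
  assumes p: "Factorial_Ring.prime (p::nat)" "add_pow R (p) \<one> = \<zero>" and c: "x \<in> carrier R" "y \<in> carrier R"
  shows "(x \<oplus> y) [^] p = x [^] p \<oplus> y [^] p"
proof -
  let ?f = "\<lambda>k. add_pow R (p choose k) (x [^] k \<otimes> y [^] (p - k))"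
  have p0: "p > 0" using p(1) prime_gt_0_nat by blast
  have "(x \<oplus> y) [^] p = finsum R ?f {..p}" by (rule binomial_expansion[OF c])
  also have "\<dots> = finsum R ?f {0, p}"
  proof (rule add.finprod_mono_neutral_cong_right)
    fix k assume k: "k \<in> {..p} - {0, p}"
    then have "p dvd (p choose k)" using p0 p(1) by (intro dvd_choose_prime) auto
    then show "?f k = \<zero>" using add_pow_char_dvd[OF p(2)] c by simp
  qed (use c in auto)
  also have "\<dots> = ?f 0 \<oplus> ?f p" using p0 c by (simp add: finsum_insert)
  also have "\<dots> = x [^] p \<oplus> y [^] p" using c by (simp add: a_comm)
  finally show ?thesis .
qed

lemma frobenius_power_add:
  assumes p: "Factorial_Ring.prime (p::nat)" "add_pow R (p) \<one> = \<zero>" and c: "x \<in> carrier R" "y \<in> carrier R"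
  shows "(x \<oplus> y) [^] (p ^ e) = x [^] (p ^ e) \<oplus> y [^] (p ^ e)"
proof (induction e)
  case 0
  then show ?case using c by simp
next
  case (Suc e)
  have "(x \<oplus> y) [^] (p ^ Suc e) = ((x \<oplus> y) [^] (p ^ e)) [^] p"
    using c by (simp add: nat_pow_pow mult.commute)
  also have "\<dots> = (x [^] (p ^ e)) [^] p \<oplus> (y [^] (p ^ e)) [^] p"
    unfolding Suc by (rule frobenius_add[OF p]) (use c in auto)
  finally show ?case using c by (simp add: nat_pow_pow mult.commute)
qed

text \<open>Since q-th powers are additive, the elements whose q-th power lies in \<open>I\<close>
  form an ideal, so the condition has to be checked on generators of the original ideal
  only.\<close>

lemma frobenius_power_least:
  assumes p: "Factorial_Ring.prime (p::nat)" "add_pow R (p) \<one> = \<zero>" and E: "E \<subseteq> carrier R" and I: "ideal I R"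
    and gen: "\<And>x. x \<in> E \<Longrightarrow> x [^] (p ^ e) \<in> I"
  shows "frobenius_power R (Idl E) (p ^ e) \<subseteq> I"
proof -
  interpret I: ideal I R by fact
  let ?V = "{r \<in> carrier R. r [^] (p ^ e) \<in> I}"
  have p0: "p ^ e > 0" using p(1) prime_gt_0_nat by simp
  have V: "ideal ?V R"
  proof (rule idealI_cring)
    show "\<zero> \<in> ?V" using p0 by (simp add: nat_pow_zero)
    show "x \<oplus> y \<in> ?V" if "x \<in> ?V" "y \<in> ?V" for x y
      using that frobenius_power_add[OF p, of x y e] I.a_closed by simp
    show "r \<otimes> x \<in> ?V" if "r \<in> carrier R" "x \<in> ?V" for r x
      using that nat_pow_distrib[of r x "p ^ e"] I.I_l_closed by simp
  qed auto
  have "Idl E \<subseteq> ?V" by (rule genideal_minimal[OF V]) (use E gen in auto)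
  then have "(\<lambda>x. x [^] (p ^ e)) ` (Idl E) \<subseteq> I" by auto
  then show ?thesis unfolding frobenius_power_def by (rule genideal_minimal[OF I])
qed

end

lemma (in subfield_algebra) characteristic_prime:
  assumes "ring_characteristic (R\<lparr>carrier := K\<rparr>) = p" "p > 0"
  shows "Factorial_Ring.prime p" "add_pow R (p) \<one> = \<zero>"
proof -
  let ?K = "R\<lparr>carrier := K\<rparr>"
  have eq: "add_pow ?K (n::nat) \<one>\<^bsub>?K\<^esub> = add_pow R (n) \<one>" for n
    by (simp add: add_pow_def nat_pow_def)
  have ex: "\<exists>n>0. add_pow R (n::nat) \<one> = \<zero>" and pl: "p = (LEAST n. n > 0 \<and> add_pow R (n) \<one> = \<zero>)"
    using assms unfolding ring_characteristic_def eq by (auto split: if_splits)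
  have p: "p > 0 \<and> add_pow R (p) \<one> = \<zero>" unfolding pl using LeastI_ex[of "\<lambda>n. n > 0 \<and> add_pow R (n) \<one> = \<zero>"] ex by blast
  then show p0: "add_pow R (p) \<one> = \<zero>" by simp
  have least: "add_pow R (n) \<one> \<noteq> \<zero>" if "0 < n" "n < p" for n
    using not_less_Least[of n "\<lambda>n. n > 0 \<and> add_pow R (n) \<one> = \<zero>"] that pl by blast
  have inK: "add_pow R (n::nat) \<one> \<in> K" for n
  proof (induction n)
    case (Suc n)
    then show ?case using subringE(7)[OF subfieldE(1)[OF K]] by simp
  qed simp
  have "p \<noteq> 1" using p0 one_not_zero by auto
  show "Factorial_Ring.prime p"
  proof (rule ccontr)
    assume "\<not> Factorial_Ring.prime p"
    then obtain m n where mn: "p = m * n" "1 < m" "m < p" "1 < n" "n < p"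
      using \<open>p \<noteq> 1\<close> p prime_nat_iff by (metis One_nat_def dvdE less_one linorder_neqE_nat mult.commute mult.right_neutral n_less_m_mult_n nat_0_less_mult_iff not_less_eq zero_less_iff_neq_zero)
    have "add_pow R (m) \<one> \<otimes> add_pow R (n) \<one> = add_pow R (m) (add_pow R (n) \<one>)" by (simp add: add_pow_ldistr)
    also have "\<dots> = add_pow R (p) \<one>" using add.nat_pow_pow[of \<one> m n] mn(1) by (simp add: mult.commute)
    finally have "add_pow R (m) \<one> \<otimes> add_pow R (n) \<one> = \<zero>" using p0 by simp
    then have "add_pow R (m) \<one> = \<zero> \<or> add_pow R (n) \<one> = \<zero>"
      using subdomainE(9)[OF subfield.axioms(1)[OF K]] inK by blast
    then show False using least mn by auto
  qed
qed

section \<open>The envelope of a Frobenius power\<close>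

lemma card_box:
  assumes "finite S"
  shows "card {u::nat \<Rightarrow> nat. (\<forall>i\<in>S. u i \<le> n) \<and> (\<forall>i. i \<notin> S \<longrightarrow> u i = 0)} = Suc n ^ card S"
    and "finite {u::nat \<Rightarrow> nat. (\<forall>i\<in>S. u i \<le> n) \<and> (\<forall>i. i \<notin> S \<longrightarrow> u i = 0)}"
proof -
  let ?h = "\<lambda>g i. if i \<in> S then g i else (0::nat)"
  have eq: "{u::nat \<Rightarrow> nat. (\<forall>i\<in>S. u i \<le> n) \<and> (\<forall>i. i \<notin> S \<longrightarrow> u i = 0)} = ?h ` (S \<rightarrow>\<^sub>E {..n})" (is "?B = _")
  proof (intro equalityI subsetI)
    fix u assume u: "u \<in> ?B"
    then have "restrict u S \<in> S \<rightarrow>\<^sub>E {..n}" by auto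
    moreover have "u = ?h (restrict u S)" using u by auto
    ultimately show "u \<in> ?h ` (S \<rightarrow>\<^sub>E {..n})" by blast
  qed auto
  have inj: "inj_on ?h (S \<rightarrow>\<^sub>E {..n})"
  proof (rule inj_onI)
    fix g g' assume gg: "g \<in> S \<rightarrow>\<^sub>E {..n}" "g' \<in> S \<rightarrow>\<^sub>E {..n}" "?h g = ?h g'"
    have "g i = g' i" if "i \<in> S" for i using fun_cong[OF gg(3), of i] that by simp
    then show "g = g'" using gg(1,2) by (auto intro: PiE_ext)
  qed
  show "card ?B = Suc n ^ card S" unfolding eq using card_image[OF inj] assms by (simp add: card_PiE)
  show "finite ?B" unfolding eq using assms by (intro finite_imageI finite_PiE) auto
qed

text \<open>Indices of \<open>S\<close> outside \<open>{1..j}\<close> are at least as many as those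
  of \<open>{1..j}\<close> missing from \<open>S\<close>; the values at the former are at least
  \<open>b j\<close>, at the latter at most \<open>b j\<close>.\<close>

lemma sum_first_le:
  fixes b :: "nat \<Rightarrow> nat"
  assumes b: "mono_on {1..d} b" and S: "S \<subseteq> {1..d}" "card S \<ge> j" and j: "j \<in> {1..d}"
  shows "(\<Sum>i\<in>{1..j}. b i) \<le> (\<Sum>i\<in>S. b i)"
proof -
  have fin: "finite S" using S finite_subset by blast
  have "card {1..j} = card ({1..j} - S) + card ({1..j} \<inter> S)"
    using sum.Int_Diff[of "{1..j}" "\<lambda>_. 1::nat" S] by simp
  moreover have "card S = card (S - {1..j}) + card ({1..j} \<inter> S)"
    using sum.Int_Diff[OF fin, of "\<lambda>_. 1::nat" "{1..j}"] by (simp add: Int_commute)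
  ultimately have card: "card ({1..j} - S) \<le> card (S - {1..j})" using S(2) by simp
  have "(\<Sum>i\<in>{1..j} - S. b i) \<le> card ({1..j} - S) * b j"
  proof -
    have "b i \<le> b j" if "i \<in> {1..j} - S" for i using that j by (intro monotone_onD[OF b]) auto
    then show ?thesis using sum_bounded_above[of "{1..j} - S" b "b j"] by simp
  qed
  also have "\<dots> \<le> card (S - {1..j}) * b j" using card by simp
  also have "\<dots> \<le> (\<Sum>i\<in>S - {1..j}. b i)"
  proof -
    have "b j \<le> b i" if "i \<in> S - {1..j}" for i using that S(1) j by (intro monotone_onD[OF b]) auto
    then show ?thesis using sum_bounded_below[of "S - {1..j}" "b j" b] by simp
  qed
  finally have "(\<Sum>i\<in>{1..j} - S. b i) + (\<Sum>i\<in>{1..j} \<inter> S. b i) \<le> (\<Sum>i\<in>S - {1..j}. b i) + (\<Sum>i\<in>S \<inter> {1..j}. b i)"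
    by (simp add: Int_commute)
  then show ?thesis using sum.Int_Diff[of "{1..j}" b S] sum.Int_Diff[OF fin, of b "{1..j}"] by simp
qed

context parameters
begin

text \<open>The exponents of the monomial ideal generated by the q-th powers of the
  variables.\<close>

definition cube :: "nat \<Rightarrow> (nat \<Rightarrow> nat) set" where
  "cube q = {u \<in> exps. \<exists>i\<in>{1..d}. q \<le> u i}"

lemma upset_cube: "upset (cube q)"
  unfolding upset_def cube_def by (fastforce intro: trans_le_add2)

text \<open>The monomial span on the right is stable under polynomials in the \<open>z i\<close>,
  but not under all of \<open>R\<close>; quantifying over \<open>g\<close> makes the set an ideal of
  \<open>R\<close>.\<close>

definition envelope :: "nat \<Rightarrow> 'a set" where
  "envelope q = {w \<in> carrier R. \<forall>g\<in>carrier R. f \<otimes> (g \<otimes> w) \<in> span (pm ` (cube q \<times> Z))}"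

lemma ideal_envelope: "ideal (envelope q) R"
proof (rule idealI_cring)
  show "envelope q \<subseteq> carrier R" "\<zero> \<in> envelope q" by (auto simp: envelope_def span_zero)
  show "x \<oplus> y \<in> envelope q" if "x \<in> envelope q" "y \<in> envelope q" for x y
    using that by (simp add: envelope_def r_distr span_add)
  fix r x assume rx: "r \<in> carrier R" "x \<in> envelope q"
  have "f \<otimes> (g \<otimes> (r \<otimes> x)) = f \<otimes> ((g \<otimes> r) \<otimes> x)" if "g \<in> carrier R" for g
    using that rx by (simp add: envelope_def m_assoc)
  then show "r \<otimes> x \<in> envelope q" using rx by (simp add: envelope_def)
qed

lemma power_in_envelope:
  assumes i: "i \<in> {1..d}" shows "z i [^] q \<in> envelope q"
proof -
  define u where "u = (\<lambda>j. if j = i then q else 0)"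
  have "mon u = (\<Otimes>j\<in>{1..d}. if j = i then z j [^] q else \<one>)"
    unfolding mon_def by (rule finprod_cong') (use z_closed in \<open>auto simp: u_def\<close>)
  also have "\<dots> = z i [^] q" by (rule finprod_singleton_swap) (use i z_closed in auto)
  finally have mu: "mon u = z i [^] q" .
  have u: "u \<in> cube q" using i by (auto simp: cube_def u_def exps_def)
  have "f \<otimes> (g \<otimes> z i [^] q) \<in> span (pm ` (cube q \<times> Z))" if g: "g \<in> carrier R" for g
  proof -
    have "mon u \<otimes> g \<in> monideal (cube q)" using u g by (rule mon_in_monideal)
    then have "g \<otimes> z i [^] q \<in> monideal (cube q)" using g mu m_comm[OF g mon_closed, of u] by simp
    then show ?thesis by (rule f_monideal[OF upset_cube])
  qed
  then show ?thesis using z_closed[OF i] by (simp add: envelope_def)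
qed

text \<open>For \<open>y\<close> in \<open>Z\<close> the product \<open>f \<otimes> y\<close>
  contains the basis element with exponent \<open>\<mu>\<close> with coefficient one, and
  \<open>\<mu>\<close> is outside the cube once \<open>q\<close> exceeds all its entries.\<close>

lemma one_not_in_envelope:
  assumes "card Z > 0" "\<And>i. i \<in> {1..d} \<Longrightarrow> \<mu> i < q"
  shows "\<one> \<notin> envelope q"
proof
  assume "\<one> \<in> envelope q"
  obtain y where y: "y \<in> Z" using assms(1) by (metis card.empty ex_in_conv less_numeral_extra(3))
  then have yc: "y \<in> carrier R" using Z_carrier by blast
  have fy: "f \<otimes> y \<in> span (pm ` (cube q \<times> Z))"
    using \<open>\<one> \<in> envelope q\<close> yc by (auto simp: envelope_def)
  obtain g where g: "g \<in> span (mon ` {u \<in> exps. key u > key \<mu>})" "g \<in> carrier R" "f = mon \<mu> \<oplus> g"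
    using leadE[OF lead_f] .
  define B where "B = exps \<times> Z - {(\<mu>, y)}"
  have Bc: "pm ` B \<subseteq> carrier R" by (rule pm_subset_closed[OF Z_carrier, of _ exps]) (auto simp: B_def)
  have "cube q \<times> Z \<subseteq> B" using assms(2) by (fastforce simp: B_def cube_def)
  then have 1: "f \<otimes> y \<in> span (pm ` B)" using fy span_mono[OF image_mono] by blast
  have "y \<otimes> g \<in> span (pm ` B)"
  proof (rule span_mult_in[OF g(1) yc mon_image_carrier])
    fix x assume "x \<in> mon ` {u \<in> exps. key u > key \<mu>}"
    then obtain u where u: "u \<in> exps" "key u > key \<mu>" "x = mon u" by blast
    then have "(u, y) \<in> B" using y by (auto simp: B_def)
    moreover have "y \<otimes> x = pm (u, y)" using u yc by (simp add: pm_def m_comm)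
    ultimately show "y \<otimes> x \<in> span (pm ` B)" by (auto intro: span_base)
  qed
  then have "f \<otimes> y \<ominus> y \<otimes> g \<in> span (pm ` B)" using 1 Bc by (intro span_minus)
  moreover have "f \<otimes> y = y \<otimes> g \<oplus> pm (\<mu>, y)"
    unfolding g(3) using g(2) yc by (simp add: pm_def l_distr m_comm[OF yc g(2)] a_comm)
  then have "f \<otimes> y \<ominus> y \<otimes> g = pm (\<mu>, y)"
    using add_minus_cancel[of "y \<otimes> g" "pm (\<mu>, y)"] g(2) yc by (simp add: pm_def)
  ultimately have "pm (\<mu>, y) \<in> span (pm ` B)" by simp
  then show False using indepD[OF indep_Z, of "(\<mu>, y)"] y by (simp add: B_def)
qed

text \<open>\<open>f\<close> is in general not homogeneous, so the weights that occur in
  \<open>f \<otimes> y\<close> are bounded rather than determined by degree. A bound uniform in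
  \<open>y\<close> is possible because \<open>Y\<close> is finite.\<close>

lemma f_Y_bounded:
  "\<exists>c. \<forall>y\<in>Y. f \<otimes> y \<in> span (pm ` ({u \<in> exps. wt a u \<le> c} \<times> Z))"
proof -
  have ex: "\<exists>c. f \<otimes> y \<in> span (pm ` ({u \<in> exps. wt a u \<le> c} \<times> Z))" if y: "y \<in> Y" for y
  proof -
    obtain T where T: "finite T" "T \<subseteq> pm ` (exps \<times> Z)" "f \<otimes> y \<in> span T"
      using span_finite_subset[OF f_Y[OF y]] .
    obtain S where S: "S \<subseteq> exps \<times> Z" "finite S" "T = pm ` S" using T(1,2) finite_subset_image by metis
    define c where "c = Max ((\<lambda>s. wt a (fst s)) ` S)"
    have c: "wt a (fst s) \<le> c" if "s \<in> S" for s using that S(2) by (simp add: c_def)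
    have "S \<subseteq> {u \<in> exps. wt a u \<le> c} \<times> Z" using S(1) c by fastforce
    then have "T \<subseteq> pm ` ({u \<in> exps. wt a u \<le> c} \<times> Z)" unfolding S(3) by (rule image_mono)
    from subsetD[OF span_mono[OF this] T(3)] show ?thesis by (intro exI[of _ c])
  qed
  define c where "c y = (SOME c. f \<otimes> y \<in> span (pm ` ({u \<in> exps. wt a u \<le> c} \<times> Z)))" for y
  have c: "f \<otimes> y \<in> span (pm ` ({u \<in> exps. wt a u \<le> c y} \<times> Z))" if "y \<in> Y" for y
    unfolding c_def by (rule someI_ex[OF ex[OF that]])
  define m where "m = Max (c ` Y)"
  have m: "c y \<le> m" if "y \<in> Y" for y using that finite_Y by (simp add: m_def)
  have "f \<otimes> y \<in> span (pm ` ({u \<in> exps. wt a u \<le> m} \<times> Z))" if y: "y \<in> Y" for y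
  proof -
    have "pm ` ({u \<in> exps. wt a u \<le> c y} \<times> Z) \<subseteq> pm ` ({u \<in> exps. wt a u \<le> m} \<times> Z)"
      using m[OF y] by (intro image_mono) auto
    from subsetD[OF span_mono[OF this] c[OF y]] show ?thesis .
  qed
  then show ?thesis by (intro exI ballI)
qed

text \<open>\<open>S\<close> is the set of coordinates in which the leading exponent of some multiple of \<open>f w\<close> is
  within \<open>c0\<close> of \<open>q\<close>: if \<open>S\<close> were too small, an element of \<open>B\<close> with leading exponent supported
  off \<open>S\<close> could not multiply \<open>w\<close> into the envelope.\<close>

lemma degree_bound:
  assumes c: "\<And>y. y \<in> Y \<Longrightarrow> f \<otimes> y \<in> span (pm ` ({u \<in> exps. wt a u \<le> c} \<times> Z))"
    and B: "B \<subseteq> carrier R"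
    and lead: "\<And>T. \<lbrakk>T \<subseteq> {1..d}; card T + j > d\<rbrakk> \<Longrightarrow>
      \<exists>\<alpha>\<in>B. \<exists>m. lead \<alpha> m \<and> (\<forall>i. i \<notin> T \<longrightarrow> m i = 0) \<and> (\<forall>i. m i \<le> c0)"
    and w: "w \<in> G n" "w \<notin> envelope q" and Bw: "\<And>\<beta>. \<beta> \<in> B \<Longrightarrow> \<beta> \<otimes> w \<in> envelope q"
  shows "\<exists>S\<subseteq>{1..d}. card S \<ge> j \<and> (q - c0) * (\<Sum>i\<in>S. a i) \<le> n + (C + c)"
proof -
  let ?F = "span (pm ` (cube q \<times> Z))"
  have wc: "w \<in> carrier R" using w G_carr by blast
  have cube: "cube q \<subseteq> exps" by (auto simp: cube_def)
  \<comment> \<open>The multiplier that detects the failure can be taken among the module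
    generators, so \<open>y \<otimes> w\<close> is homogeneous and its degree exceeds that of
    \<open>w\<close> by at most \<open>C\<close>.\<close>
  have "\<exists>y\<in>Y. f \<otimes> (y \<otimes> w) \<notin> ?F"
  proof (rule ccontr)
    assume "\<not> ?thesis"
    then have all: "f \<otimes> (y \<otimes> w) \<in> ?F" if "y \<in> Y" for y using that by blast
    have "f \<otimes> (g \<otimes> w) \<in> ?F" if g: "g \<in> carrier R" for g
    proof -
      have "(f \<otimes> w) \<otimes> g \<in> ?F"
      proof (rule span_mult_in[OF _ _ pm_closed[OF Y_carrier]])
        show "g \<in> span (pm ` (exps \<times> Y))" using g carrier_span by simp
        show "f \<otimes> w \<in> carrier R" using wc by simp
        fix x assume "x \<in> pm ` (exps \<times> Y)"
        then obtain u y where uy: "u \<in> exps" "y \<in> Y" "x = mon u \<otimes> y" by (auto simp: pm_def)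
        have yc: "y \<in> carrier R" using uy Y_carrier by blast
        have "mon u \<otimes> (f \<otimes> (y \<otimes> w)) \<in> ?F"
        proof (rule mon_mult_pm_span[where A = "{u}", OF _ all[OF uy(2)] Z_carrier])
          fix v v' assume "v \<in> {u}" "v' \<in> cube q"
          then show "v + v' \<in> cube q" using upset_cube uy(1) by (auto simp: upset_def)
        qed (auto intro: span_base)
        moreover have "(f \<otimes> w) \<otimes> x = mon u \<otimes> (f \<otimes> (y \<otimes> w))" using uy(3) yc wc by (simp add: m_ac)
        ultimately show "(f \<otimes> w) \<otimes> x \<in> ?F" by simp
      qed
      moreover have "(f \<otimes> w) \<otimes> g = f \<otimes> (g \<otimes> w)" using g wc by (simp add: m_ac)
      ultimately show ?thesis by simp
    qed
    then show False using w(2) wc by (simp add: envelope_def)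
  qed
  then obtain y where y: "y \<in> Y" "f \<otimes> (y \<otimes> w) \<notin> ?F" by blast
  have yc: "y \<in> carrier R" using y Y_carrier by blast
  obtain m where m: "m \<le> C" "y \<in> G m" using y Y_degree by auto
  let ?A = "{u \<in> exps. wt a u \<le> n + (C + c)}"
  have "y \<otimes> w \<in> G (m + n)" using m w component_mult by blast
  then have yw: "y \<otimes> w \<in> span (pm ` ({u \<in> exps. wt a u \<le> m + n \<and> m + n \<le> wt a u + C} \<times> Y))"
    using G_span_pm by blast
  have e1: "f \<otimes> (y \<otimes> w) \<in> span (pm ` (?A \<times> Z))"
  proof (rule span_mult_in[OF yw f_closed pm_closed[OF Y_carrier]])
    fix x assume "x \<in> pm ` ({u \<in> exps. wt a u \<le> m + n \<and> m + n \<le> wt a u + C} \<times> Y)"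
    then obtain u y' where uy: "u \<in> exps" "wt a u \<le> m + n" "y' \<in> Y" "x = mon u \<otimes> y'" by (auto simp: pm_def)
    have "mon u \<otimes> (f \<otimes> y') \<in> span (pm ` (?A \<times> Z))"
    proof (rule mon_mult_pm_span[where A = "{u}", OF _ c[OF uy(3)] Z_carrier])
      fix v v' assume "v \<in> {u}" "v' \<in> {u \<in> exps. wt a u \<le> c}"
      then show "v + v' \<in> ?A" using uy m(1) by (auto simp: wt_add)
    qed (auto intro: span_base)
    moreover have "y' \<in> carrier R" using uy Y_carrier by blast
    then have "f \<otimes> x = mon u \<otimes> (f \<otimes> y')" using uy by (simp add: m_lcomm)
    ultimately show "f \<otimes> x \<in> span (pm ` (?A \<times> Z))" by simp
  qed
  have A: "?A \<subseteq> exps" by auto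
  obtain u0 where u0: "u0 \<in> ?A - cube q"
    "\<forall>\<alpha> m. lead \<alpha> m \<longrightarrow> \<alpha> \<otimes> (f \<otimes> (y \<otimes> w)) \<in> ?F \<longrightarrow> m + u0 \<in> cube q"
    using leading_exponent[OF indep_Z Z_carrier upset_cube A e1 y(2)] by (elim bexE)
  define S where "S = {i \<in> {1..d}. q \<le> u0 i + c0}"
  have "card S \<ge> j"
  proof (rule ccontr)
    assume "\<not> card S \<ge> j"
    moreover have "card ({1..d} - S) = d - card S" by (subst card_Diff_subset) (auto simp: S_def)
    moreover have "S \<subseteq> {1..d}" by (auto simp: S_def)
    then have "card S \<le> d" using card_mono[of "{1..d}" S] by simp
    ultimately have "card ({1..d} - S) + j > d" by linarith
    then obtain \<alpha> \<nu> where \<alpha>: "\<alpha> \<in> B" "lead \<alpha> \<nu>" "\<And>i. i \<notin> {1..d} - S \<Longrightarrow> \<nu> i = 0" "\<And>i. \<nu> i \<le> c0"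
      using lead[of "{1..d} - S"] by blast
    have ac: "\<alpha> \<in> carrier R" using \<alpha>(1) B by blast
    have "f \<otimes> (y \<otimes> (\<alpha> \<otimes> w)) \<in> ?F" using Bw[OF \<alpha>(1)] yc by (simp add: envelope_def)
    moreover have "f \<otimes> (y \<otimes> (\<alpha> \<otimes> w)) = \<alpha> \<otimes> (f \<otimes> (y \<otimes> w))" using yc wc ac by (simp add: m_ac)
    ultimately have "\<nu> + u0 \<in> cube q" using u0(2) \<alpha>(2) by simp
    then obtain i where i: "i \<in> {1..d}" "q \<le> \<nu> i + u0 i" by (auto simp: cube_def)
    show False
    proof (cases "i \<in> S")
      case True
      then have "q \<le> u0 i" using i(2) \<alpha>(3)[of i] by simp
      then show False using u0(1) i(1) by (auto simp: cube_def)
    next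
      case False
      then show False using i \<alpha>(4)[of i] by (simp add: S_def)
    qed
  qed
  moreover have "(q - c0) * (\<Sum>i\<in>S. a i) \<le> n + (C + c)"
  proof -
    have "(q - c0) * (\<Sum>i\<in>S. a i) = (\<Sum>i\<in>S. a i * (q - c0))" by (simp add: sum_distrib_left mult.commute)
    also have "\<dots> \<le> (\<Sum>i\<in>S. a i * u0 i)" by (rule sum_mono) (auto simp: S_def)
    also have "\<dots> \<le> wt a u0" unfolding wt_def by (rule sum_mono2) (auto simp: S_def)
    also have "\<dots> \<le> n + (C + c)" using u0(1) by simp
    finally show ?thesis .
  qed
  moreover have "S \<subseteq> {1..d}" by (auto simp: S_def)
  ultimately show ?thesis by blast
qed

text \<open>More monomials in the \<open>z i\<close>, \<open>i \<in> T\<close>, than the growth of \<open>R / B\<close> allows to be independent.\<close>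

lemma lead_in_ideal:
  assumes B: "ideal B R" and T: "T \<subseteq> {1..d}" "card T > c"
    and growth: "\<And>n. \<exists>W. finite W \<and> W \<subseteq> carrier R \<and> gr_less (Suc n) \<subseteq> span (B \<union> W) \<and> card W \<le> k * Suc n ^ c"
  shows "\<exists>\<alpha>\<in>B. \<exists>m. lead \<alpha> m \<and> (\<forall>i. i \<notin> T \<longrightarrow> m i = 0)"
proof -
  interpret B: ideal B R by fact
  \<comment> \<open>Exponents up to \<open>N\<close> give degrees at most \<open>s * N\<close>,
    where the quotient has dimension at most k (s(N+1))^c. The choice of \<open>N\<close> turns this
    into N (N+1)^c, which is less than (N+1)^(c+1).\<close>
  define s where "s = Suc (\<Sum>i\<in>{1..d}. a i)"
  define N where "N = k * s ^ c"
  define E where "E = {u::nat \<Rightarrow> nat. (\<forall>i\<in>T. u i \<le> N) \<and> (\<forall>i. i \<notin> T \<longrightarrow> u i = 0)}"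
  have finT: "finite T" using T(1) finite_subset by blast
  have E: "card E = Suc N ^ card T" "finite E" unfolding E_def by (rule card_box[OF finT])+
  have Eexp: "E \<subseteq> exps" using T(1) by (auto simp: E_def exps_def)
  have wtE: "wt a u \<le> s * N" if "u \<in> E" for u
  proof -
    have "wt a u \<le> (\<Sum>i\<in>{1..d}. a i * N)" unfolding wt_def
    proof (rule sum_mono)
      fix i assume "i \<in> {1..d}"
      have "u i \<le> N" using that by (cases "i \<in> T") (auto simp: E_def)
      then show "a i * u i \<le> a i * N" by simp
    qed
    then show ?thesis by (simp add: s_def sum_distrib_right)
  qed
  have "\<not> indep B mon E"
  proof
    assume ind: "indep B mon E"
    obtain W where W: "finite W" "W \<subseteq> carrier R" "gr_less (Suc (s * N)) \<subseteq> span (B \<union> W)" "card W \<le> k * Suc (s * N) ^ c"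
      using growth by blast
    have "mon ` E \<subseteq> gr_less (Suc (s * N))"
    proof
      fix x assume "x \<in> mon ` E"
      then obtain u where u: "u \<in> E" "x = mon u" by blast
      then have "x \<in> G (wt a u)" "wt a u < Suc (s * N)" using mon_degree wtE[OF u(1)] by auto
      then show "x \<in> gr_less (Suc (s * N))" unfolding gr_less_def by (intro span_base) blast
    qed
    then have "card E \<le> card W" using steinitz[OF ind W(1) _ B.a_subset W(2)] W(3) by blast
    also have "\<dots> \<le> k * Suc (s * N) ^ c" by (rule W(4))
    also have "\<dots> \<le> k * (s * Suc N) ^ c" by (intro mult_left_mono power_mono) (auto simp: s_def)
    also have "\<dots> = N * Suc N ^ c" by (simp only: N_def power_mult_distrib mult.assoc)
    also have "\<dots> < Suc N * Suc N ^ c" by simp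
    also have "\<dots> = Suc N ^ Suc c" by simp
    also have "\<dots> \<le> Suc N ^ card T" using T(2) by (intro power_increasing) auto
    finally show False using E by simp
  qed
  then obtain u where u: "u \<in> E" "mon u \<in> span (B \<union> mon ` (E - {u}))" by (auto simp: indep_def)
  obtain \<beta> g where bg: "\<beta> \<in> span B" "g \<in> span (mon ` (E - {u}))" "mon u = \<beta> \<oplus> g"
    using span_UnE[OF u(2) B.a_subset mon_image_carrier] .
  have bB: "\<beta> \<in> B" using bg(1) ideal_span[OF B] by simp
  have gc: "g \<in> carrier R" "\<beta> \<in> carrier R" using span_carr[OF bg(2) mon_image_carrier] bB B.Icarr by auto
  have "\<ominus> g \<in> span (mon ` (E - {u}))" using bg(2) by (simp add: span_neg mon_image_carrier)
  moreover have "u \<in> exps" "E - {u} \<subseteq> exps" "finite (E - {u})" using u(1) Eexp E(2) by auto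
  ultimately have "\<exists>c'\<in>G 0. \<exists>m\<in>insert u (E - {u}). lead (c' \<otimes> (\<one> \<otimes> mon u \<oplus> \<ominus> g)) m"
    using one_not_zero K_one by (intro lead_normalize) auto
  then obtain c' m where cm: "c' \<in> G 0" "m \<in> E" "lead (c' \<otimes> (\<one> \<otimes> mon u \<oplus> \<ominus> g)) m" using u(1) by blast
  have "\<one> \<otimes> mon u \<oplus> \<ominus> g = \<beta>" using bg(3) gc by (simp add: a_assoc r_neg)
  then have "lead (c' \<otimes> \<beta>) m" using cm(3) by simp
  moreover have "c' \<otimes> \<beta> \<in> B" using bB cm(1) B.I_l_closed by simp
  moreover have "\<forall>i. i \<notin> T \<longrightarrow> m i = 0" using cm(2) by (simp add: E_def)
  ultimately show ?thesis by blast
qed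

text \<open>Modulo the first \<open>j\<close> parameters only monomials in the other
  \<open>d - j\<close> survive, and in degree at most \<open>n\<close> their exponents are at most
  \<open>n\<close> because the parameters have positive degree.\<close>

lemma growth_quotient:
  assumes j: "j \<le> d"
  shows "\<exists>W. finite W \<and> W \<subseteq> carrier R \<and> gr_less (Suc n) \<subseteq> span (Idl (z ` {1..j}) \<union> W) \<and>
    card W \<le> card Y * Suc n ^ (d - j)"
proof -
  let ?B = "Idl (z ` {1..j})"
  have zc: "z ` {1..j} \<subseteq> carrier R" using z_closed j by auto
  interpret B: ideal ?B R by (rule genideal_ideal[OF zc])
  define E where "E = {u::nat \<Rightarrow> nat. (\<forall>i\<in>{Suc j..d}. u i \<le> n) \<and> (\<forall>i. i \<notin> {Suc j..d} \<longrightarrow> u i = 0)}"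
  define W where "W = pm ` (E \<times> Y)"
  have E: "card E = Suc n ^ card {Suc j..d}" "finite E" unfolding E_def by (rule card_box, simp)+
  have "finite W" using E finite_Y by (simp add: W_def)
  moreover have Wc: "W \<subseteq> carrier R" unfolding W_def by (rule pm_closed[OF Y_carrier])
  moreover have "card W \<le> card (E \<times> Y)" unfolding W_def using E finite_Y by (intro card_image_le) auto
  then have "card W \<le> card Y * Suc n ^ (d - j)" using E by (simp add: card_cartesian_product mult.commute)
  moreover have "gr_less (Suc n) \<subseteq> span (?B \<union> W)"
    unfolding gr_less_def
  proof (rule span_least, rule subsetI)
    fix x assume "x \<in> (\<Union>m\<in>{..<Suc n}. G m)"
    then obtain m where "m < Suc n" "x \<in> G m" by blast
    then have m: "m \<le> n" "x \<in> G m" by auto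
    have "x \<in> span (pm ` ({u \<in> exps. wt a u \<le> m \<and> m \<le> wt a u + C} \<times> Y))" using m G_span_pm by blast
    moreover have "pm ` ({u \<in> exps. wt a u \<le> m \<and> m \<le> wt a u + C} \<times> Y) \<subseteq> ?B \<union> W"
    proof
      fix v assume "v \<in> pm ` ({u \<in> exps. wt a u \<le> m \<and> m \<le> wt a u + C} \<times> Y)"
      then obtain u y where uy: "u \<in> exps" "wt a u \<le> m" "y \<in> Y" "v = pm (u, y)" by auto
      show "v \<in> ?B \<union> W"
      proof (cases "\<exists>i\<in>{1..j}. u i > 0")
        case True
        then obtain i where i: "i \<in> {1..j}" "u i > 0" by blast
        define u' where "u' = u(i := u i - 1)"
        have id: "i \<in> {1..d}" using i(1) j by auto
        have uu: "u = unit_exp i + u'" using i(2) by (auto simp: u'_def unit_exp_def fun_eq_iff)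
        have "mon u = z i \<otimes> mon u'" unfolding uu mon_add mon_unit_exp[OF id] ..
        then have "v = z i \<otimes> (mon u' \<otimes> y)"
          using uy(3,4) Y_carrier z_closed[OF id] by (auto simp: pm_def m_assoc)
        moreover have "z i \<in> ?B" using genideal_self[OF zc] i(1) by blast
        moreover have "mon u' \<otimes> y \<in> carrier R" using uy(3) Y_carrier by auto
        ultimately show ?thesis using B.I_r_closed by blast
      next
        case False
        have "u \<in> E"
        proof -
          have "u i \<le> n" if i: "i \<in> {Suc j..d}" for i
          proof -
            have "u i \<le> a i * u i" using a_pos[of i] i by simp
            also have "\<dots> \<le> wt a u" unfolding wt_def by (rule member_le_sum) (use i in auto)
            finally show ?thesis using uy(2) m(1) by simp
          qed
          moreover have "u i = 0" if "i \<notin> {Suc j..d}" for i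
            using that False uy(1) by (cases "i \<in> {1..j}") (auto simp: exps_def)
          ultimately show ?thesis by (simp add: E_def)
        qed
        then show ?thesis using uy by (auto simp: W_def)
      qed
    qed
    ultimately show "x \<in> span (?B \<union> W)" using span_mono by blast
  qed
  ultimately show ?thesis by blast
qed

end

section \<open>The lower bound for the F-threshold\<close>

lemma finite_uniform_bound:
  fixes P :: "'t \<Rightarrow> nat \<Rightarrow> bool"
  assumes "finite A" "\<And>t. t \<in> A \<Longrightarrow> \<exists>c. P t c" and mono: "\<And>t c c'. P t c \<Longrightarrow> c \<le> c' \<Longrightarrow> P t c'"
  shows "\<exists>c. \<forall>t\<in>A. P t c"
  using assms(1,2)
proof (induction A rule: finite_induct)
  case (insert t A)
  have "\<exists>c. \<forall>t\<in>A. P t c" by (rule insert.IH) (use insert.prems in blast)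
  then obtain c where c: "\<forall>t\<in>A. P t c" by (rule exE)
  obtain c' where c': "P t c'" using insert.prems[of t] by blast
  have "\<forall>s\<in>insert t A. P s (max c c')"
    using mono[of _ c "max c c'"] mono[of t c' "max c c'"] c c' by auto
  then show ?case by (rule exI)
qed simp

text \<open>Summation by parts. Adding \<open>k\<close> makes the partial sums nonnegative, so that
  replacing a weight by the next smaller one can only decrease the bound.\<close>

lemma abel_bound:
  fixes s c :: "nat \<Rightarrow> real"
  assumes d: "d \<ge> 1" and c: "\<And>i. i \<in> {1..d} \<Longrightarrow> c i \<ge> 0"
    and anti: "\<And>i. i \<in> {1..<d} \<Longrightarrow> c (Suc i) \<le> c i"
    and S: "\<And>j. j \<in> {1..d} \<Longrightarrow> - k \<le> (\<Sum>i\<in>{1..j}. s i)"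
  shows "- k * c 1 \<le> (\<Sum>i\<in>{1..d}. c i * s i)"
proof -
  have "n \<le> d \<Longrightarrow> - k * c 1 + c n * ((\<Sum>i\<in>{1..n}. s i) + k) \<le> (\<Sum>i\<in>{1..n}. c i * s i)" if "n \<ge> 1" for n
    using that
  proof (induction n rule: nat_induct_at_least)
    case base
    show ?case by (simp add: algebra_simps)
  next
    case (Suc n)
    have "c (Suc n) * ((\<Sum>i\<in>{1..n}. s i) + k) \<le> c n * ((\<Sum>i\<in>{1..n}. s i) + k)"
      using anti[of n] S[of n] Suc by (intro mult_right_mono) auto
    then show ?case using Suc by (simp add: algebra_simps)
  qed
  then have "- k * c 1 + c d * ((\<Sum>i\<in>{1..d}. s i) + k) \<le> (\<Sum>i\<in>{1..d}. c i * s i)" using d by simp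
  moreover have "0 \<le> c d * ((\<Sum>i\<in>{1..d}. s i) + k)" using c[of d] S[of d] d by (intro mult_nonneg_nonneg) auto
  ultimately show ?thesis by linarith
qed

section \<open>The greedy monomial\<close>

context monomials
begin

definition trunc :: "nat \<Rightarrow> (nat \<Rightarrow> nat) \<Rightarrow> nat \<Rightarrow> nat" where
  "trunc j u = (\<lambda>i. if i \<le> j then u i else 0)"

lemma trunc_factor:
  assumes "i \<le> j" obtains r where "r \<in> carrier R" "mon (trunc j u) = r \<otimes> mon (trunc i u)"
proof -
  have "trunc j u = (\<lambda>l. if i < l \<and> l \<le> j then u l else 0) + trunc i u"
    using assms by (auto simp: trunc_def fun_eq_iff)
  then show thesis using that mon_add mon_closed by metis
qed

text \<open>The exponents of \<open>z 1\<close>, \<open>z 2\<close>, \<open>\<dots>\<close> are chosen in turn as large as possible.\<close>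

lemma greedy_monomial:
  assumes I: "ideal I R" and one: "\<one> \<notin> I" and nil: "\<And>i. i \<in> {1..d} \<Longrightarrow> \<exists>k::nat. z i [^] k \<in> I"
  shows "\<exists>u\<in>exps. mon u \<notin> I \<and> (\<forall>i\<in>{1..d}. z i \<otimes> mon (trunc i u) \<in> I)"
proof -
  interpret I: ideal I R by fact
  have "j \<le> d \<Longrightarrow> \<exists>u\<in>exps. (\<forall>i>j. u i = 0) \<and> mon u \<notin> I \<and> (\<forall>i\<in>{1..j}. z i \<otimes> mon (trunc i u) \<in> I)" for j
  proof (induction j)
    case 0
    show ?case
    proof (rule bexI[of _ 0], intro conjI)
      show "mon 0 \<notin> I" using one by simp
    qed simp_all
  next
    case (Suc j)
    then obtain u where u: "u \<in> exps" "\<And>i. i > j \<Longrightarrow> u i = 0" "mon u \<notin> I"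
      "\<And>i. i \<in> {1..j} \<Longrightarrow> z i \<otimes> mon (trunc i u) \<in> I" by auto
    have jd: "Suc j \<in> {1..d}" using Suc.prems by simp
    define v where "v t = u(Suc j := t)" for t
    have vS: "v (Suc t) = unit_exp (Suc j) + v t" for t by (auto simp: v_def unit_exp_def fun_eq_iff)
    have v0: "v 0 = u" using u(2)[of "Suc j"] by (auto simp: v_def)
    have mon_v: "mon (v t) = z (Suc j) [^] t \<otimes> mon u" for t
    proof (induction t)
      case (Suc t)
      then show ?case unfolding vS mon_add mon_unit_exp[OF jd]
        using z_closed[OF jd] by (simp add: m_ac)
    qed (simp add: v0)
    obtain k where k: "z (Suc j) [^] (k::nat) \<in> I" using nil[OF jd] by blast
    have bound: "t \<le> k" if "mon (v t) \<notin> I" for t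
    proof (rule ccontr)
      assume "\<not> t \<le> k"
      then have "z (Suc j) [^] t = z (Suc j) [^] k \<otimes> z (Suc j) [^] (t - k)"
        using z_closed[OF jd] by (simp add: nat_pow_mult)
      then have "z (Suc j) [^] t \<in> I" using k z_closed[OF jd] I.I_r_closed by simp
      then have "mon (v t) \<in> I" unfolding mon_v using I.I_r_closed by simp
      then show False using that by simp
    qed
    have P0: "mon (v 0) \<notin> I" using u(3) v0 by simp
    define t where "t = Greatest (\<lambda>t. mon (v t) \<notin> I)"
    have t1: "mon (v t) \<notin> I" unfolding t_def
      by (rule GreatestI_nat[where P = "\<lambda>t. mon (v t) \<notin> I" and k = 0 and b = k, OF P0 bound])
    have t2: "mon (v (Suc t)) \<in> I"
    proof (rule ccontr)
      assume "mon (v (Suc t)) \<notin> I"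
      then have "Suc t \<le> t"
        unfolding t_def by (rule Greatest_le_nat[where P = "\<lambda>t. mon (v t) \<notin> I" and b = k, OF _ bound])
      then show False by simp
    qed
    have tr: "trunc (Suc j) (v t) = v t" using u(2) by (auto simp: trunc_def v_def fun_eq_iff)
    have "v t \<in> exps" using u(1) jd by (auto simp: v_def exps_def)
    moreover have "\<forall>i>Suc j. v t i = 0" using u(2) by (auto simp: v_def)
    moreover have "z i \<otimes> mon (trunc i (v t)) \<in> I" if i: "i \<in> {1..Suc j}" for i
    proof (cases "i = Suc j")
      case True
      have "mon (v (Suc t)) = z (Suc j) \<otimes> mon (v t)" unfolding vS mon_add mon_unit_exp[OF jd] ..
      then show ?thesis using t2 True tr by simp
    next
      case False
      then have "trunc i (v t) = trunc i u" using i by (auto simp: trunc_def v_def fun_eq_iff)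
      then show ?thesis using u(4)[of i] i False by simp
    qed
    ultimately show ?case using t1 by (intro bexI[of _ "v t"] conjI) auto
  qed
  from this[of d] show ?thesis by blast
qed

end

section \<open>From the greedy monomial to the threshold\<close>

context graded_algebra
begin

text \<open>The truncation to the first \<open>j\<close> variables escapes the envelope while
  \<open>x 1\<close>, ..., \<open>x j\<close> multiply it in. \<open>degree_bound\<close> then
  bounds its degree below for each \<open>j\<close>, and \<open>abel_bound\<close> combines these
  bounds. It is essential that \<open>k\<close> is chosen before \<open>q\<close>.\<close>

lemma envelope_escape:
  assumes X: "parameters R G d x a Yx Zx Cx fx \<mu>x" and Y: "parameters R G d y b Y Z C f \<mu>"
    and d: "d \<ge> 1" and a: "mono_on {1..d} a" and b: "mono_on {1..d} b"
  shows "\<exists>k::real. \<forall>q. \<one> \<notin> parameters.envelope R G d y Z f q \<longrightarrow>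
    (\<forall>i\<in>{1..d}. \<exists>k::nat. x i [^] k \<in> parameters.envelope R G d y Z f q) \<longrightarrow>
    (\<exists>u\<in>monomials.exps d. monomials.mon R d x u \<notin> parameters.envelope R G d y Z f q \<and>
       real q * (\<Sum>i\<in>{1..d}. real (b i) / real (a i)) - k \<le> real (\<Sum>i\<in>{1..d}. u i))"
proof -
  interpret X: parameters R G d x a Yx Zx Cx fx \<mu>x by fact
  interpret Y: parameters R G d y b Y Z C f \<mu> by fact
  obtain c where c': "\<forall>y\<in>Y. f \<otimes> y \<in> span (Y.pm ` ({u \<in> Y.exps. Y.wt b u \<le> c} \<times> Z))"
    using Y.f_Y_bounded by (rule exE)
  have c: "f \<otimes> y \<in> span (Y.pm ` ({u \<in> Y.exps. Y.wt b u \<le> c} \<times> Z))" if "y \<in> Y" for y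
    using c' that by (rule bspec)
  \<comment> \<open>For these pairs the variables in \<open>T\<close> outnumber the growth exponent
    \<open>d - j\<close>, so a relation exists. There are finitely many pairs, hence one bound
    \<open>c0\<close> on the leading exponents serves all of them and every
    \<open>q\<close>.\<close>
  let ?A = "{(j, T). j \<in> {1..d} \<and> T \<subseteq> {1..d} \<and> card T + j > d}"
  let ?P = "\<lambda>(j, T) c0. \<exists>\<alpha>\<in>Idl (x ` {1..j}). \<exists>m. Y.lead \<alpha> m \<and> (\<forall>i. i \<notin> T \<longrightarrow> m i = 0) \<and> (\<forall>i. m i \<le> c0)"
  have "\<exists>c0. \<forall>t\<in>?A. ?P t c0"
  proof (rule finite_uniform_bound)
    show "finite ?A" by (rule finite_subset[of _ "{1..d} \<times> Pow {1..d}"]) auto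
    show "?P t c'" if le: "?P t c0" "c0 \<le> c'" for t c0 c'
    proof (cases t)
      case (Pair j T)
      then obtain \<alpha> m where am: "\<alpha> \<in> Idl (x ` {1..j})" "Y.lead \<alpha> m" "\<forall>i. i \<notin> T \<longrightarrow> m i = 0" "\<forall>i. m i \<le> c0"
        using le(1) unfolding Pair prod.case by (elim bexE exE conjE)
      have "\<forall>i. m i \<le> c'" using am(4) le(2) by (meson order_trans)
      then show ?thesis unfolding Pair prod.case using am(1-3) by blast
    qed
  next
    fix t assume "t \<in> ?A"
    then obtain j T where t: "t = (j, T)" "j \<in> {1..d}" "T \<subseteq> {1..d}" "card T > d - j" by auto
    have jd: "j \<le> d" using t(2) by simp
    have xc: "x ` {1..j} \<subseteq> carrier R" using X.z_closed jd by auto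
    obtain \<alpha> m where am: "\<alpha> \<in> Idl (x ` {1..j})" "Y.lead \<alpha> m" "\<forall>i. i \<notin> T \<longrightarrow> m i = 0"
      using Y.lead_in_ideal[OF genideal_ideal[OF xc] t(3,4) X.growth_quotient[OF jd]] by (elim bexE exE conjE)
    have "m i \<le> Max (m ` {1..d})" for i
    proof (cases "i \<in> {1..d}")
      case False
      then have "i \<notin> T" using t(3) by blast
      then show ?thesis using am(3) by simp
    qed simp
    then show "\<exists>c. ?P t c" unfolding t(1) prod.case using am by blast
  qed
  then obtain c0 where c0': "\<forall>t\<in>?A. ?P t c0" by (rule exE)
  have c0: "\<exists>\<alpha>\<in>Idl (x ` {1..j}). \<exists>m. Y.lead \<alpha> m \<and> (\<forall>i. i \<notin> T \<longrightarrow> m i = 0) \<and> (\<forall>i. m i \<le> c0)"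
    if "j \<in> {1..d}" "T \<subseteq> {1..d}" "card T + j > d" for j T
  proof -
    have "(j, T) \<in> ?A" using that by simp
    from bspec[OF c0' this] show ?thesis unfolding prod.case .
  qed
  define \<sigma> where "\<sigma> = (\<Sum>i\<in>{1..d}. real (b i) / real (a i))"
  \<comment> \<open>The first summand pays for replacing \<open>q\<close> by \<open>q - c0\<close>,
    the second is the error of summation by parts, whose first weight is 1/a_1.\<close>
  define k where "k = real c0 * \<sigma> + real (C + c) * (1 / real (a 1))"
  have \<sigma>0: "\<sigma> \<ge> 0" unfolding \<sigma>_def by (rule sum_nonneg) simp
  show ?thesis
  proof (intro exI[of _ k] allI impI)
    fix q
    let ?I = "Y.envelope q"
    assume one: "\<one> \<notin> ?I" and nil: "\<forall>i\<in>{1..d}. \<exists>k::nat. x i [^] k \<in> ?I"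
    interpret I: ideal ?I R by (rule Y.ideal_envelope)
    have "\<exists>u\<in>X.exps. X.mon u \<notin> ?I \<and> (\<forall>i\<in>{1..d}. x i \<otimes> X.mon (X.trunc i u) \<in> ?I)"
      by (rule X.greedy_monomial[OF Y.ideal_envelope one]) (use nil in blast)
    then obtain u where u: "u \<in> X.exps" "X.mon u \<notin> ?I" and u3: "\<forall>i\<in>{1..d}. x i \<otimes> X.mon (X.trunc i u) \<in> ?I"
      by (elim bexE conjE)
    have partial: "(q - c0) * (\<Sum>i\<in>{1..j}. b i) \<le> (\<Sum>i\<in>{1..j}. a i * u i) + (C + c)" if j: "j \<in> {1..d}" for j
    proof -
      let ?w = "X.mon (X.trunc j u)"
      have xc: "x ` {1..j} \<subseteq> carrier R" using X.z_closed j by auto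
      have ud: "X.trunc d u = u" using u(1) by (auto simp: X.trunc_def X.exps_def fun_eq_iff)
      \<comment> \<open>The full monomial is a multiple of its truncation, so the truncation cannot
        lie in the ideal either.\<close>
      obtain r where "r \<in> carrier R" "X.mon (X.trunc d u) = r \<otimes> ?w" using X.trunc_factor[of j d u] j by auto
      then have w: "?w \<notin> ?I" using u(2) ud I.I_l_closed by auto
      have "x ` {1..j} \<subseteq> {\<beta> \<in> carrier R. \<beta> \<otimes> ?w \<in> ?I}"
      proof
        fix v assume "v \<in> x ` {1..j}"
        then obtain i where i: "i \<in> {1..j}" "v = x i" by blast
        then have id: "i \<in> {1..d}" "i \<le> j" using j by auto
        obtain r where r: "r \<in> carrier R" "?w = r \<otimes> X.mon (X.trunc i u)" using X.trunc_factor[OF id(2)] .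
        have "x i \<otimes> ?w = r \<otimes> (x i \<otimes> X.mon (X.trunc i u))"
          unfolding r(2) using r(1) X.z_closed[OF id(1)] by (simp add: m_lcomm)
        then have "x i \<otimes> ?w \<in> ?I" using bspec[OF u3 id(1)] r(1) I.I_l_closed by simp
        then show "v \<in> {\<beta> \<in> carrier R. \<beta> \<otimes> ?w \<in> ?I}" using i X.z_closed[OF id(1)] by simp
      qed
      then have "Idl (x ` {1..j}) \<subseteq> {\<beta> \<in> carrier R. \<beta> \<otimes> ?w \<in> ?I}"
        by (intro genideal_minimal ideal_colon Y.ideal_envelope) auto
      then have Bw: "\<beta> \<otimes> ?w \<in> ?I" if "\<beta> \<in> Idl (x ` {1..j})" for \<beta> using that by blast
      have Bc: "Idl (x ` {1..j}) \<subseteq> carrier R"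
        by (rule additive_subgroup.a_subset[OF ideal.axioms(1)[OF genideal_ideal[OF xc]]])
      obtain S where S: "S \<subseteq> {1..d}" "card S \<ge> j"
        "(q - c0) * (\<Sum>i\<in>S. b i) \<le> X.wt a (X.trunc j u) + (C + c)"
        using Y.degree_bound[OF c Bc c0[OF j] X.mon_degree w Bw] by blast
      have "(q - c0) * (\<Sum>i\<in>{1..j}. b i) \<le> (q - c0) * (\<Sum>i\<in>S. b i)"
        by (intro mult_left_mono sum_first_le[OF b S(1,2) j]) simp
      moreover have "X.wt a (X.trunc j u) = (\<Sum>i\<in>{1..j}. a i * u i)"
      proof -
        have "X.wt a (X.trunc j u) = (\<Sum>i\<in>{1..j}. a i * X.trunc j u i)"
          unfolding X.wt_def by (rule sum.mono_neutral_right) (use j in \<open>auto simp: X.trunc_def\<close>)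
        also have "\<dots> = (\<Sum>i\<in>{1..j}. a i * u i)" by (rule sum.cong) (auto simp: X.trunc_def)
        finally show ?thesis .
      qed
      ultimately show ?thesis using S(3) by linarith
    qed
    define s where "s i = real (a i) * real (u i) - real (q - c0) * real (b i)" for i
    have "- real (C + c) * (1 / real (a 1)) \<le> (\<Sum>i\<in>{1..d}. 1 / real (a i) * s i)"
    proof (rule abel_bound[OF d])
      fix i assume "i \<in> {1..<d}"
      then have "a i \<le> a (Suc i)" "a i > 0" using a X.a_pos by (auto intro: monotone_onD)
      then show "1 / real (a (Suc i)) \<le> 1 / real (a i)" by (simp add: frac_le)
    next
      fix j assume j: "j \<in> {1..d}"
      have "real ((q - c0) * (\<Sum>i\<in>{1..j}. b i)) \<le> real ((\<Sum>i\<in>{1..j}. a i * u i) + (C + c))"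
        using partial[OF j] by (rule of_nat_mono)
      then show "- real (C + c) \<le> (\<Sum>i\<in>{1..j}. s i)"
        by (simp add: s_def sum_subtractf sum_distrib_left)
    qed simp
    also have "(\<Sum>i\<in>{1..d}. 1 / real (a i) * s i) = (\<Sum>i\<in>{1..d}. real (u i)) - real (q - c0) * \<sigma>"
    proof -
      have "1 / real (a i) * s i = real (u i) - real (q - c0) * (real (b i) / real (a i))" if "i \<in> {1..d}" for i
        using X.a_pos[OF that] by (simp add: s_def field_simps)
      then show ?thesis by (simp add: \<sigma>_def sum_subtractf sum_distrib_left)
    qed
    finally have "- (real (C + c) * (1 / real (a 1))) \<le> (\<Sum>i\<in>{1..d}. real (u i)) - real (q - c0) * \<sigma>"
      by (simp only: mult_minus_left)
    then have 1: "real (q - c0) * \<sigma> - real (C + c) * (1 / real (a 1)) \<le> (\<Sum>i\<in>{1..d}. real (u i))" by linarith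
    \<comment> \<open>An inequality, because the subtraction on the right is truncated when
      \<open>q < c0\<close>.\<close>
    have "(real q - real c0) * \<sigma> \<le> real (q - c0) * \<sigma>" using \<sigma>0 by (intro mult_right_mono) auto
    then have "real q * \<sigma> - k \<le> real (\<Sum>i\<in>{1..d}. u i)"
      using 1 unfolding k_def of_nat_sum left_diff_distrib by linarith
    then show "\<exists>u\<in>X.exps. X.mon u \<notin> ?I \<and> real q * (\<Sum>i\<in>{1..d}. real (b i) / real (a i)) - k \<le> real (\<Sum>i\<in>{1..d}. u i)"
      using u(1,2) unfolding \<sigma>_def by blast
  qed
qed

text \<open>The Frobenius power is contained in the envelope, so a monomial outside the envelope has
  total exponent at most \<open>f_nu\<close>. The constant error is divided by \<open>p ^ e\<close>,
  and the estimate survives in the lower limit.\<close>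

theorem threshold_bound:
  assumes X: "parameters R G d x a Yx Zx Cx fx \<mu>x" and Y: "parameters R G d y b Y Z C f \<mu>"
    and d: "d \<ge> 1" and a: "mono_on {1..d} a" and b: "mono_on {1..d} b"
    and radX: "\<And>i. i \<in> {1..d} \<Longrightarrow> x i \<in> radical R (Idl (y ` {1..d}))"
    and Z: "card Z > 0" and p: "Factorial_Ring.prime p" "add_pow R p \<one> = \<zero>"
  shows "ereal (\<Sum>i\<in>{1..d}. real (b i) / real (a i)) \<le> f_threshold_lower R p (Idl (y ` {1..d})) (Idl (x ` {1..d}))"
proof -
  interpret X: parameters R G d x a Yx Zx Cx fx \<mu>x by fact
  interpret Y: parameters R G d y b Y Z C f \<mu> by fact
  define \<sigma> where "\<sigma> = (\<Sum>i\<in>{1..d}. real (b i) / real (a i))"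
  let ?I = "Idl (x ` {1..d})" and ?J = "Idl (y ` {1..d})"
  have xc: "x ` {1..d} \<subseteq> carrier R" and yc: "y ` {1..d} \<subseteq> carrier R" using X.z_closed Y.z_closed by auto
  have Jc: "?J \<subseteq> carrier R" by (rule additive_subgroup.a_subset[OF ideal.axioms(1)[OF genideal_ideal[OF yc]]])
  have fc: "(\<lambda>x. x [^] q) ` ?J \<subseteq> carrier R" for q :: nat using Jc by auto
  have FI: "ideal (frobenius_power R ?J q) R" for q
    unfolding frobenius_power_def by (rule genideal_ideal[OF fc])
  have env: "frobenius_power R ?J (p ^ e) \<subseteq> Y.envelope (p ^ e)" for e
    by (rule frobenius_power_least[OF p yc Y.ideal_envelope]) (use Y.power_in_envelope in auto)
  have nil: "\<exists>k::nat. x i [^] k \<in> frobenius_power R ?J q" if i: "i \<in> {1..d}" for i q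
  proof -
    obtain n :: nat where "x i [^] n \<in> ?J" using radX[OF i] by (auto simp: radical_def)
    then have "(x i [^] n) [^] q \<in> frobenius_power R ?J q"
      unfolding frobenius_power_def using genideal_self[OF fc] by blast
    then show ?thesis using X.z_closed[OF i] by (auto simp: nat_pow_pow)
  qed
  obtain k where k: "\<And>q. \<lbrakk>\<one> \<notin> Y.envelope q; \<forall>i\<in>{1..d}. \<exists>k::nat. x i [^] k \<in> Y.envelope q\<rbrakk> \<Longrightarrow>
    \<exists>u\<in>X.exps. X.mon u \<notin> Y.envelope q \<and> real q * \<sigma> - k \<le> real (\<Sum>i\<in>{1..d}. u i)"
    using envelope_escape[OF X Y d a b] unfolding \<sigma>_def by blast
  have nu: "r \<le> f_nu R ?J ?I q" if u: "u \<in> X.exps" "X.mon u \<notin> frobenius_power R ?J q" "r = (\<Sum>i\<in>{1..d}. u i)" for u r q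
  proof -
    let ?F = "frobenius_power R ?J q"
    interpret F: ideal ?F R by (rule FI)
    have Ipow: "ideal_power R ?I n = X.monideal (X.above X.one_wt n)" for n by (rule X.ideal_power_eq)
    have ur: "u \<in> X.above X.one_wt r" using u by (simp add: X.above_def X.wt_def)
    have notr: "\<not> ideal_power R ?I r \<subseteq> ?F"
      using X.mon_in_monideal[OF ur one_closed] u(2) unfolding Ipow by auto
    show ?thesis
    proof (cases "?I \<subseteq> ?F")
      \<comment> \<open>The value of \<open>f_nu\<close> is 0 by convention here, and a monomial
        outside the Frobenius power must be constant.\<close>
      case True
      have "r = 0"
      proof (rule ccontr)
        assume "r \<noteq> 0"
        then have "u \<in> X.above X.one_wt 1" using ur by (simp add: X.above_def)
        then have "X.mon u \<in> ideal_power R ?I 1" using X.mon_in_monideal[of u _ \<one>] unfolding Ipow by simp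
        also have "ideal_power R ?I 1 = ?I"
        proof -
          interpret M: comm_monoid "ideals_set R" by (rule ideals_set_is_comm_monoid)
          have "?I \<in> carrier (ideals_set R)" using genideal_ideal[OF xc] by (simp add: ideals_set_def)
          then show ?thesis using M.nat_pow_eone by simp
        qed
        finally show False using True u(2) by blast
      qed
      then show ?thesis by simp
    next
      case False
      have "\<forall>i\<in>{1..d}. \<exists>k::nat. x i [^] k \<in> ?F" using nil by blast
      from bchoice[OF this] obtain e :: "nat \<Rightarrow> nat" where e': "\<forall>i\<in>{1..d}. x i [^] e i \<in> ?F" by (rule exE)
      have e: "x i [^] e i \<in> ?F" if "i \<in> {1..d}" for i using e' that by (rule bspec)
      \<comment> \<open>A monomial with more than \<open>m\<close> factors contains some
        \<open>x i\<close> at least \<open>e i\<close> times. Hence the set under \<open>Max\<close>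
        is finite, without which \<open>Max\<close> would carry no information.\<close>
      define m where "m = (\<Sum>i\<in>{1..d}. e i)"
      have fin: "n \<le> m" if n: "\<not> ideal_power R ?I n \<subseteq> ?F" for n
      proof (rule ccontr)
        assume nm: "\<not> n \<le> m"
        have "X.monideal (X.above X.one_wt n) \<subseteq> ?F"
        proof (rule X.monideal_least[OF FI])
          fix v assume v: "v \<in> X.above X.one_wt n"
          have "\<exists>i\<in>{1..d}. e i \<le> v i"
          proof (rule ccontr)
            assume "\<not> ?thesis"
            then have "X.wt X.one_wt v \<le> m" unfolding m_def X.wt_def by (intro sum_mono) (auto simp: not_le less_imp_le)
            then show False using v nm by (simp add: X.above_def)
          qed
          then obtain i where i: "i \<in> {1..d}" "e i \<le> v i" by blast
          have "X.mon (w(i := t)) = x i [^] t \<otimes> X.mon (w(i := 0))" for w t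
          proof (induction t)
            case (Suc t)
            have "w(i := Suc t) = X.unit_exp i + w(i := t)" by (auto simp: X.unit_exp_def fun_eq_iff)
            then have "X.mon (w(i := Suc t)) = x i \<otimes> X.mon (w(i := t))" by (simp only: X.mon_add X.mon_unit_exp[OF i(1)])
            also have "\<dots> = x i \<otimes> (x i [^] t \<otimes> X.mon (w(i := 0)))" by (simp only: Suc)
            also have "\<dots> = x i [^] Suc t \<otimes> X.mon (w(i := 0))"
              using X.z_closed[OF i(1)] by (simp only: nat_pow_Suc2 m_assoc nat_pow_closed X.mon_closed)
            finally show ?case .
          qed simp
          from this[of v "v i"] have "X.mon v = x i [^] v i \<otimes> X.mon (v(i := 0))" by simp
          also have "x i [^] v i = x i [^] e i \<otimes> x i [^] (v i - e i)"
            using i X.z_closed[OF i(1)] by (simp add: nat_pow_mult)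
          finally show "X.mon v \<in> ?F" using e[OF i(1)] X.z_closed[OF i(1)] F.I_r_closed by simp
        qed
        then show False using n unfolding Ipow by simp
      qed
      then have "{n. \<not> ideal_power R ?I n \<subseteq> ?F} \<subseteq> {..m}" by blast
      then have "finite {n. \<not> ideal_power R ?I n \<subseteq> ?F}" by (rule finite_subset) simp
      moreover have "r \<in> {n. \<not> ideal_power R ?I n \<subseteq> ?F}" using notr by simp
      ultimately have "r \<le> Max {n. \<not> ideal_power R ?I n \<subseteq> ?F}" by (rule Max_ge)
      then show ?thesis using False by (simp add: f_nu_def)
    qed
  qed
  have p1: "p > 1" using p(1) prime_gt_1_nat by blast
  \<comment> \<open>The threshold for \<open>e\<close> ensures that \<open>p ^ e\<close> exceeds
    every entry of \<open>\<mu>\<close>, so that the envelope is a proper ideal.\<close>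
  have big: "real (f_nu R ?J ?I (p ^ e)) / real (p ^ e) \<ge> \<sigma> - k / real (p ^ e)" if e: "e > (\<Sum>i\<in>{1..d}. \<mu> i)" for e
  proof -
    have lt: "\<mu> i < p ^ e" if i: "i \<in> {1..d}" for i
    proof -
      have "\<mu> i \<le> (\<Sum>i\<in>{1..d}. \<mu> i)" by (rule member_le_sum[OF i]) auto
      also have "\<dots> < e" by (rule e)
      also have "e < p ^ e" using power_gt_expt[of p e] p1 by simp
      finally show ?thesis .
    qed
    have one: "\<one> \<notin> Y.envelope (p ^ e)" by (rule Y.one_not_in_envelope[OF Z lt])
    have "\<forall>i\<in>{1..d}. \<exists>k::nat. x i [^] k \<in> Y.envelope (p ^ e)" using nil env by blast
    from k[OF one this] obtain u where u: "u \<in> X.exps" "X.mon u \<notin> Y.envelope (p ^ e)"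
      "real (p ^ e) * \<sigma> - k \<le> real (\<Sum>i\<in>{1..d}. u i)" by blast
    have "X.mon u \<notin> frobenius_power R ?J (p ^ e)" using u(2) env by blast
    then have "real (\<Sum>i\<in>{1..d}. u i) \<le> real (f_nu R ?J ?I (p ^ e))" using nu[OF u(1) _ refl] by (intro of_nat_mono)
    then have "real (p ^ e) * \<sigma> - k \<le> real (f_nu R ?J ?I (p ^ e))" using u(3) by linarith
    then have "(real (p ^ e) * \<sigma> - k) / real (p ^ e) \<le> real (f_nu R ?J ?I (p ^ e)) / real (p ^ e)"
      by (rule divide_right_mono) simp
    moreover have "(real (p ^ e) * \<sigma> - k) / real (p ^ e) = \<sigma> - k / real (p ^ e)"
      using p1 by (simp add: diff_divide_distrib)
    ultimately show ?thesis by simp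
  qed
  have "(\<lambda>e. \<sigma> - k / real (p ^ e)) \<longlonglongrightarrow> \<sigma> - 0"
  proof (intro tendsto_diff tendsto_const)
    have "filterlim (\<lambda>e. real p ^ e) at_infinity sequentially"
      using filterlim_realpow_sequentially_gt1[of "real p"] p1 by simp
    then show "(\<lambda>e. k / real (p ^ e)) \<longlonglongrightarrow> 0"
      by (intro tendsto_divide_0[OF tendsto_const]) simp
  qed
  then have lim: "(\<lambda>e. ereal (\<sigma> - k / real (p ^ e))) \<longlonglongrightarrow> ereal \<sigma>" by simp
  have "ereal \<sigma> = liminf (\<lambda>e. ereal (\<sigma> - k / real (p ^ e)))"
    using lim_imp_Liminf[OF _ lim] by simp
  also have "\<dots> \<le> liminf (\<lambda>e. ereal (real (f_nu R ?J ?I (p ^ e)) / real (p ^ e)))"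
  proof (rule Liminf_mono)
    show "\<forall>\<^sub>F e in sequentially. ereal (\<sigma> - k / real (p ^ e)) \<le> ereal (real (f_nu R ?J ?I (p ^ e)) / real (p ^ e))"
      using eventually_gt_at_top[of "\<Sum>i\<in>{1..d}. \<mu> i"]
    proof eventually_elim
      case (elim e)
      show ?case using big[OF elim] by (simp only: ereal_less_eq)
    qed
  qed
  finally show ?thesis unfolding f_threshold_lower_def \<sigma>_def .
qed

end

section \<open>Proof of the theorem\<close>

text \<open>After scaling to \<open>s i\<close> with sum at most \<open>d\<close>, the bound is the
  sum of ln s <= s - 1. Equality forces each nonnegative defect s - 1 - ln s to vanish, hence every
  \<open>s i\<close> to be 1, and also the sum of the \<open>t i\<close> to equal
  \<open>r\<close>.\<close>

lemma am_gm_bound: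
  fixes t :: "nat \<Rightarrow> real"
  assumes d: "d \<ge> 1" and t: "\<And>i. i \<in> {1..d} \<Longrightarrow> t i > 0" and r: "(\<Sum>i\<in>{1..d}. t i) \<le> r"
  shows "(real d / r) ^ d * (\<Prod>i\<in>{1..d}. t i) \<le> 1"
    and "(real d / r) ^ d * (\<Prod>i\<in>{1..d}. t i) = 1 \<Longrightarrow> i \<in> {1..d} \<Longrightarrow> t i = r / real d"
proof -
  have "0 < (\<Sum>i\<in>{1..d}. t i)" using d t by (intro sum_pos) auto
  then have r0: "r > 0" using r by simp
  define s where "s i = real d / r * t i" for i
  have s: "s i > 0" if "i \<in> {1..d}" for i using t[OF that] r0 d by (simp add: s_def)
  have prod: "(\<Prod>i\<in>{1..d}. s i) = (real d / r) ^ d * (\<Prod>i\<in>{1..d}. t i)"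
    unfolding s_def by (simp add: prod.distrib power_divide prod_constant del: times_divide_eq_left)
  have "(\<Sum>i\<in>{1..d}. s i) = real d / r * (\<Sum>i\<in>{1..d}. t i)" by (simp add: s_def sum_distrib_left)
  also have "\<dots> \<le> real d / r * r" using r r0 by (intro mult_left_mono) auto
  finally have sum: "(\<Sum>i\<in>{1..d}. s i) \<le> real d" using r0 by simp
  have pos: "0 < (\<Prod>i\<in>{1..d}. s i)" by (rule prod_pos) (use s in auto)
  have ln: "ln (\<Prod>i\<in>{1..d}. s i) = (\<Sum>i\<in>{1..d}. ln (s i))" by (rule ln_prod) (use s in force)+
  have le: "ln (s i) \<le> s i - 1" if "i \<in> {1..d}" for i using ln_le_minus_one s[OF that] by simp
  have sum1: "(\<Sum>i\<in>{1..d}. s i - 1) \<le> 0" using sum by (simp add: sum_subtractf)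
  have "(\<Sum>i\<in>{1..d}. ln (s i)) \<le> (\<Sum>i\<in>{1..d}. s i - 1)" by (rule sum_mono) (rule le)
  then have "ln (\<Prod>i\<in>{1..d}. s i) \<le> 0" using sum1 ln by simp
  then show "(real d / r) ^ d * (\<Prod>i\<in>{1..d}. t i) \<le> 1" using pos unfolding prod[symmetric] by simp
  assume eq: "(real d / r) ^ d * (\<Prod>i\<in>{1..d}. t i) = 1" and i: "i \<in> {1..d}"
  have "(\<Sum>i\<in>{1..d}. ln (s i)) = 0" using ln eq unfolding prod by simp
  then have "(\<Sum>i\<in>{1..d}. s i - 1 - ln (s i)) \<le> 0" using sum1 by (simp add: sum_subtractf)
  moreover have nn: "0 \<le> s i - 1 - ln (s i)" if "i \<in> {1..d}" for i using le[OF that] by simp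
  ultimately have "(\<Sum>i\<in>{1..d}. s i - 1 - ln (s i)) = 0" by (intro antisym sum_nonneg) auto
  then have "s i - 1 - ln (s i) = 0" using sum_nonneg_eq_0_iff[of "{1..d}" "\<lambda>i. s i - 1 - ln (s i)"] nn i by simp
  then have "s i = 1" using ln_eq_minus_one[OF s[OF i]] by simp
  then show "t i = r / real d" using r0 d by (simp add: s_def field_simps)
qed

text \<open>A finite positive supremum of natural numbers is attained, since otherwise
  \<open>d - 1\<close> would be an upper bound.\<close>

lemma krull_dim_chain:
  assumes "krull_dim R = enat d" "d \<ge> 1"
  shows "\<exists>P. (\<forall>i\<le>d. primeideal (P i) R) \<and> (\<forall>i<d. P i \<subset> P (Suc i))"
proof -
  let ?S = "{enat n | n. \<exists>P :: nat \<Rightarrow> 'a set. (\<forall>i\<le>n. primeideal (P i) R) \<and> (\<forall>i<n. P i \<subset> P (Suc i))}"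
  have sup: "Sup ?S = enat d" using assms(1) by (simp add: krull_dim_def)
  have "enat d \<in> ?S"
  proof (rule ccontr)
    assume no: "enat d \<notin> ?S"
    have "Sup ?S \<le> enat (d - 1)"
    proof (rule Sup_least)
      fix e assume e: "e \<in> ?S"
      then obtain n where n: "e = enat n" by blast
      have "e \<le> enat d" using Sup_upper[OF e] sup by simp
      moreover have "e \<noteq> enat d" using e no by blast
      ultimately show "e \<le> enat (d - 1)" unfolding n by simp
    qed
    then show False using sup assms(2) by simp
  qed
  then show ?thesis by auto
qed

lemma (in graded_algebra) hsop_parameters:
  assumes noeth: "noetherian_ring R" and d: "d \<ge> 1" and hsop: "full_hsop R G d x a"
  shows "\<exists>Y Z C f \<mu>. parameters R G d x a Y Z C f \<mu> \<and> card Z > 0"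
proof -
  have dim: "krull_dim R = enat d" and xG: "\<And>i. i \<in> {1..d} \<Longrightarrow> x i \<in> G (a i)"
    and xm: "\<And>i. i \<in> {1..d} \<Longrightarrow> x i \<in> gr_ge 1"
    and rad: "radical R (Idl (x ` {1..d})) = irrelevant_ideal R G"
    using hsop irrelevant_ideal_eq by (auto simp: full_hsop_def)
  interpret M: monomials R G d x by unfold_locales (use xG G_carr in blast)
  obtain P where P': "\<forall>i\<le>d. primeideal (P i) R" "\<forall>i<d. P i \<subset> P (Suc i)"
    using krull_dim_chain[OF dim d] by (elim exE conjE)
  have P: "primeideal (P i) R" if "i \<le> d" for i using P'(1) that by simp
  have P2: "P i \<subset> P (Suc i)" if "i < d" for i using P'(2) that by simp
  text \<open>An element of degree \<open>0\<close> in the irrelevant ideal vanishes, so it may be given degree \<open>1\<close>;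
    algebraic independence then excludes this case.\<close>
  define a' where "a' i = (if a i = 0 then 1 else a i)" for i
  have zero: "x i = \<zero>" if "i \<in> {1..d}" "a i = 0" for i
    using disjoint_degrees[of "x i" "{1..}" 0] xm[OF that(1)] xG[OF that(1)] that(2) by (simp add: gr_ge_def)
  have "\<exists>Y Z C f \<mu>. parameters R G d x a' Y Z C f \<mu>"
  proof (rule M.parameters_exist[OF noeth _ _ rad])
    fix i assume i: "i \<in> {1..d}"
    show "a' i > 0" by (simp add: a'_def)
    show "x i \<in> G (a' i)" using xG[OF i] zero[OF i] by (simp add: a'_def)
  qed
  then obtain Y Z C f \<mu> where par: "parameters R G d x a' Y Z C f \<mu>" by blast
  interpret X: parameters R G d x a' Y Z C f \<mu> by (rule par)
  have Z: "card Z > 0" by (rule X.card_pos_of_primes[of P, OF d P P2])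
  then obtain y where y: "y \<in> Z" by (metis card.empty ex_in_conv less_numeral_extra(3))
  have "a i \<noteq> 0" if i: "i \<in> {1..d}" for i
  proof
    assume "a i = 0"
    then have "x i = \<zero>" using zero i by blast
    then have "M.pm (M.unit_exp i, y) = \<zero>"
      using M.mon_unit_exp[OF i] y X.Z_carrier by (auto simp: M.pm_def)
    then have "M.pm (M.unit_exp i, y) \<in> span ({} \<union> M.pm ` (M.exps \<times> Z - {(M.unit_exp i, y)}))"
      by (simp add: span_zero)
    then show False using indepD[OF X.indep_Z, of "(M.unit_exp i, y)"] y M.unit_exp_exps[OF i] by simp
  qed
  then have "\<exists>Y Z C f \<mu>. parameters R G d x a Y Z C f \<mu>"
    by (intro M.parameters_exist[OF noeth _ xG rad]) auto
  then obtain Y Z C f \<mu> where par: "parameters R G d x a Y Z C f \<mu>" by blast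
  then have "card Z > 0" using parameters.card_pos_of_primes[of R G d x a Y Z C f \<mu> P, OF _ d P P2] by simp
  then show ?thesis using par by blast
qed

theorem corollary2p9:
  fixes R :: "('a, 'b) ring_scheme" and G :: "nat \<Rightarrow> 'a set"
    and d p :: nat and x y :: "nat \<Rightarrow> 'a" and a b :: "nat \<Rightarrow> nat" and I J :: "'a set"
  assumes "graded_cring R G" and "noetherian_ring R"
    and "krull_dim R = enat d" and "d \<ge> 1"
    and "subfield (G 0) R" and "ring_characteristic (R\<lparr>carrier := G 0\<rparr>) = p" and "p > 0"
    and "full_hsop R G d x a" and "mono_on {1..d} a" and "I = Idl\<^bsub>R\<^esub> (x ` {1..d})"
    and "full_hsop R G d y b" and "mono_on {1..d} b" and "J = Idl\<^bsub>R\<^esub> (y ` {1..d})"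
  shows "hs_multiplicity R d I
           \<ge> (ereal (real d) / f_threshold_lower R p J I) ^ d * hs_multiplicity R d J
       \<and> (hs_multiplicity R d I
             = (ereal (real d) / f_threshold_lower R p J I) ^ d * hs_multiplicity R d J
          \<longrightarrow> (\<forall>i\<in>{1..d}. \<forall>j\<in>{1..d}. real (a i) / real (b i) = real (a j) / real (b j)))"
proof -
  interpret graded_algebra R G
    using assms(1,5) by (intro graded_algebra.intro graded_algebra_axioms.intro)
  note d = assms(4)
  obtain Yx Zx Cx fx \<mu>x where X: "parameters R G d x a Yx Zx Cx fx \<mu>x" and Zx: "card Zx > 0"
    using hsop_parameters[OF assms(2) d assms(8)] by blast
  obtain Y Z C f \<mu> where Y: "parameters R G d y b Y Z C f \<mu>" and Z: "card Z > 0"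
    using hsop_parameters[OF assms(2) d assms(11)] by blast
  interpret X: parameters R G d x a Yx Zx Cx fx \<mu>x by fact
  interpret Y: parameters R G d y b Y Z C f \<mu> by fact
  define t where "t i = real (b i) / real (a i)" for i
  have ab: "real (a i) > 0" "real (b i) > 0" if "i \<in> {1..d}" for i using X.a_pos[OF that] Y.a_pos[OF that] by auto
  have t: "t i > 0" if "i \<in> {1..d}" for i using ab[OF that] by (simp add: t_def)
  have eI: "hs_multiplicity R d I = ereal (real (card Zx))" using X.multiplicity_eq[OF d] assms(10) by simp
  have eJ: "hs_multiplicity R d J = ereal (real (card Z))" using Y.multiplicity_eq[OF d] assms(13) by simp
  \<comment> \<open>The normalized ranks agree, so the quotient of the two multiplicities is the
    product of all b_i/a_i and the claim becomes a statement about these ratios.\<close>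
  have "real (card Zx) / (\<Prod>i\<in>{1..d}. real (a i)) = real (card Z) / (\<Prod>i\<in>{1..d}. real (b i))"
    using rank_le[OF X Y] rank_le[OF Y X] by simp
  moreover have "(\<Prod>i\<in>{1..d}. real (b i)) \<noteq> 0" using ab(2) by (metis prod_pos less_irrefl)
  ultimately have "real (card Z) = real (card Zx) / (\<Prod>i\<in>{1..d}. real (a i)) * (\<Prod>i\<in>{1..d}. real (b i))"
    by (metis nonzero_eq_divide_eq)
  then have rank: "real (card Z) = real (card Zx) * (\<Prod>i\<in>{1..d}. t i)"
    by (simp add: t_def prod_dividef)
  have rad: "x i \<in> radical R (Idl\<^bsub>R\<^esub> (y ` {1..d}))" if "i \<in> {1..d}" for i
    using assms(8,11) that by (simp add: full_hsop_def)
  have "ereal (\<Sum>i\<in>{1..d}. t i) \<le> f_threshold_lower R p J I"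
    unfolding t_def assms(10,13)
    using threshold_bound[OF X Y d assms(9,12) rad Z characteristic_prime[OF assms(6,7)]] by simp
  then consider "f_threshold_lower R p J I = \<infinity>"
    | r where "f_threshold_lower R p J I = ereal r" "(\<Sum>i\<in>{1..d}. t i) \<le> r"
    by (cases "f_threshold_lower R p J I") auto
  then show ?thesis
  proof cases
    case 1
    \<comment> \<open>Division by infinity gives 0, and so does its power because \<open>d\<close>
      is positive. Equality is then impossible, as the left multiplicity is positive.\<close>
    have z: "(ereal (real d) / f_threshold_lower R p J I) ^ d * hs_multiplicity R d J = 0"
      unfolding 1 using d by (cases d) auto
    show ?thesis unfolding z eI using Zx by simp
  next
    case 2
    have "0 < (\<Sum>i\<in>{1..d}. t i)" using d t by (intro sum_pos) auto
    then have r: "r > 0" using 2(2) by simp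
    have eq: "(ereal (real d) / f_threshold_lower R p J I) ^ d * hs_multiplicity R d J =
       ereal (real (card Zx) * ((real d / r) ^ d * (\<Prod>i\<in>{1..d}. t i)))"
      unfolding 2(1) eJ rank using r by (simp add: mult_ac)
    have le: "real (card Zx) * ((real d / r) ^ d * (\<Prod>i\<in>{1..d}. t i)) \<le> real (card Zx) * 1"
      by (intro mult_left_mono am_gm_bound(1)[OF d t 2(2)]) auto
    have ratio: "real (a i) / real (b i) = real (a j) / real (b j)"
      if e: "hs_multiplicity R d I = (ereal (real d) / f_threshold_lower R p J I) ^ d * hs_multiplicity R d J"
        and ij: "i \<in> {1..d}" "j \<in> {1..d}" for i j
    proof -
      have "(real d / r) ^ d * (\<Prod>i\<in>{1..d}. t i) = 1" using e Zx unfolding eI eq by simp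
      then have "t i = r / real d" "t j = r / real d" using am_gm_bound(2)[OF d t 2(2)] ij by blast+
      then have "inverse (t i) = inverse (t j)" by simp
      then show ?thesis by (simp add: t_def)
    qed
    show ?thesis
    proof (intro conjI impI ballI)
      show "(ereal (real d) / f_threshold_lower R p J I) ^ d * hs_multiplicity R d J \<le> hs_multiplicity R d I"
        unfolding eq eI ereal_less_eq using le by (simp only: mult_1_right)
    qed (rule ratio)
  qed
qed

end
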